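(* Let $\mathcal{F}$ be a countably infinite class of real-valued functions on $\mathbb{R}^d$ that has an envelope $F$ and is $KMT(\delta_n;P)$ for some sequence $\delta_n\downarrow 0$. Let $\{\mathcal{F}_n\}_{n\ge1}$ be a sequence of finite classes of linearly independent functions with $\mathcal{F}_n\subseteq\mathcal{F}_{n+1}\subset\mathcal{F}$ for all $n\ge1$, and let $k=k(n)=card(\mathcal{F}_n)$. Suppose that $$\lim_{n\to\infty}k(n)=\infty,\qquad \lim_{n\to\infty}\lambda_{1,k}^{-1/2}\,k^{1/2}\,\delta_n\log n=0,\qquad \lim_{n\to\infty}\lambda_{1,k}^{-1}\,k^{3/2}\,n^{-1/2}=0.$$ Let $\Omega=\{Q\in M: Qf=Q_0f,\ f\in\mathcal{F}\}$ for some $Q_0\in M$. Then under $H0$ (that is, if $P\in\Omega$), $$\frac{n\chi_{n,k}^2-k}{\sqrt{2k}}\ \overset{d}{\longrightarrow}\ N(0,1).$$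
   Context: $M$ is the set of signed measures on $\mathbb{R}^d$ with total mass $1$; $Qf=\int f\,dQ$. $X_1,X_2,\dots$ are i.i.d. with law $P$, $P_n=\frac1n\sum_{i\le n}\delta_{X_i}$. An envelope for $\mathcal{F}$ is a function $F$ with $|f|\le F$ for all $f\in\mathcal{F}$. Statistic: $\chi_{n,k}^2=\sup_{f}\ (Q_0-P_n)f-\frac14P_nf^2$, the supremum being over the linear span of $\mathcal{F}_n\cup\{1\}$. Write $\mathcal{F}_n=\{f_1^{(n)},\dots,f_k^{(n)}\}$. $S_k$ is the covariance matrix of $(\gamma_n(f_1^{(n)}),\dots,\gamma_n(f_k^{(n)}))$, where $\gamma_n(f)=\sqrt n(P_n-P)f$; i.e. $S_k$ has entries $Pf_i^{(n)}f_j^{(n)}-Pf_i^{(n)}Pf_j^{(n)}$. $\lambda_{1,k}$ is the smallest eigenvalue of $S_k$. Pregaussian: $\mathcal{F}$ is pregaussian if there is a version $B_P^0(\cdot)$ of $P$-Brownian bridges (indexed by $\mathcal{F}$) uniformly continuous in $\ell^\infty(\mathcal{F})$ with respect to the metric $\rho_P(f,g)=(Var_P|f-g|)^{1/2}$, where $\ell^\infty(\mathcal{F})$ is the Banach space of bounded functionals $H:\mathcal{F}\to\mathbb{R}$ with the sup norm. KMT: let $\delta_n$ be a decreasing sequence with $\delta_n=o(n^{-a})$ for some $a>0$. $\mathcal{F}$ is Koml\'os–Major–Tusn\'ady with respect to $P$ with rate $\delta_n$, written $KMT(\delta_n;P)$, iff it is pregaussian and there is a version $B_n^0(\cdot)$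 of $P$-Brownian bridges such that for any $t>0$ $$\Pr\Big\{\sup_{f\in\mathcal{F}}\big|\sqrt n(P_n-P)f-B_n^0(f)\big|\ge\delta_n(t+b\log n)\Big\}\le c\,e^{-\theta t},$$ where the positive constants $b,c,\theta$ depend on $\mathcal{F}$ only. *)

theory Defs
  imports
    "HOL-Probability.Probability"
    "HOL-Library.Landau_Symbols"
    "HOL-Library.Function_Algebras"
    "Jordan_Normal_Form.Char_Poly"
begin

text \<open>Real-valued functions as a real vector space; provides \<open>fn.span\<close> and \<open>fn.independent\<close>.\<close>

definition fscale :: "real \<Rightarrow> ('a \<Rightarrow> real) \<Rightarrow> 'a \<Rightarrow> real"
  where "fscale c f = (\<lambda>x. c * f x)"

global_interpretation fn: vector_space "fscale :: real \<Rightarrow> ('a \<Rightarrow> real) \<Rightarrow> 'a \<Rightarrow> real"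
  by unfold_locales (auto simp: fscale_def plus_fun_def algebra_simps)


section \<open>Signed measures\<close>

text \<open>A finite signed Borel measure is a real set function; only its values on Borel sets matter.\<close>

definition signed_measure :: "('a::topological_space set \<Rightarrow> real) \<Rightarrow> bool"
  where "signed_measure Q \<longleftrightarrow> Q {} = 0 \<and>
    (\<forall>A::nat \<Rightarrow> 'a set. range A \<subseteq> sets borel \<and> disjoint_family A \<longrightarrow>
       (\<lambda>i. Q (A i)) sums Q (\<Union>i. A i))"

definition unit_signed_measures :: "('a::topological_space set \<Rightarrow> real) set"
  where "unit_signed_measures = {Q. signed_measure Q \<and> Q UNIV = 1}"

text \<open>
  Jordan decomposition: the upper variation of \<open>Q\<close> on \<open>A\<close> is the supremum of \<open>Q B\<close> over Borel
  \<open>B \<subseteq> A\<close>. The choice \<open>B = {}\<close> contributes 0, so truncation by \<open>ennreal\<close> is harmless.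
\<close>

definition upper_variation :: "('a::topological_space set \<Rightarrow> real) \<Rightarrow> 'a measure"
  where "upper_variation Q =
    measure_of UNIV (sets borel) (\<lambda>A. SUP B\<in>{B \<in> sets borel. B \<subseteq> A}. ennreal (Q B))"

definition lower_variation :: "('a::topological_space set \<Rightarrow> real) \<Rightarrow> 'a measure"
  where "lower_variation Q = upper_variation (\<lambda>A. - Q A)"

definition sm_integrable :: "('a::topological_space set \<Rightarrow> real) \<Rightarrow> ('a \<Rightarrow> real) \<Rightarrow> bool"
  where "sm_integrable Q f \<longleftrightarrow> integrable (upper_variation Q) f \<and> integrable (lower_variation Q) f"

definition sm_integral :: "('a::topological_space set \<Rightarrow> real) \<Rightarrow> ('a \<Rightarrow> real) \<Rightarrow> real"
  where "sm_integral Q f = integral\<^sup>L (upper_variation Q) f - integral\<^sup>L (lower_variation Q) f"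

definition moment_model ::
    "('a::topological_space \<Rightarrow> real) set \<Rightarrow> ('a set \<Rightarrow> real) \<Rightarrow> ('a set \<Rightarrow> real) set"
  where "moment_model F Q0 = {Q \<in> unit_signed_measures.
    \<forall>f\<in>F. sm_integrable Q f \<and> sm_integral Q f = sm_integral Q0 f}"


section \<open>Samples and the test statistic\<close>

text \<open>The sample is indexed from 0, so the first \<open>n\<close> observations are \<open>X 0, \<dots>, X (n - 1)\<close>.\<close>

definition iid_sample ::
    "'w measure \<Rightarrow> 'a::topological_space measure \<Rightarrow> (nat \<Rightarrow> 'w \<Rightarrow> 'a) \<Rightarrow> bool"
  where "iid_sample M P X \<longleftrightarrow> prob_space M \<and> prob_space.indep_vars M (\<lambda>_. borel) X UNIV \<and>
    (\<forall>i. distr M borel (X i) = P)"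

definition emp :: "nat \<Rightarrow> (nat \<Rightarrow> 'a) \<Rightarrow> ('a \<Rightarrow> real) \<Rightarrow> real"
  where "emp n x f = (\<Sum>i<n. f (x i)) / real n"

text \<open>
  The supremum is taken in the extended reals: it is infinite when the empirical covariance matrix
  is singular in a direction along which the moment constraint is violated.
\<close>

definition chi2_stat ::
    "('a::topological_space set \<Rightarrow> real) \<Rightarrow> ('a \<Rightarrow> real) set \<Rightarrow> nat \<Rightarrow> (nat \<Rightarrow> 'a) \<Rightarrow> ereal"
  where "chi2_stat Q0 G n x = (SUP f\<in>fn.span (G \<union> {\<lambda>_. 1}).
    ereal ((sm_integral Q0 f - emp n x f) - 1/4 * emp n x (\<lambda>y. (f y)\<^sup>2)))"


section \<open>Covariance\<close>

definition cov :: "'a measure \<Rightarrow> ('a \<Rightarrow> real) \<Rightarrow> ('a \<Rightarrow> real) \<Rightarrow> real"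
  where "cov P f g = (\<integral>x. f x * g x \<partial>P) - (\<integral>x. f x \<partial>P) * (\<integral>x. g x \<partial>P)"

definition cov_mat :: "'a measure \<Rightarrow> nat \<Rightarrow> (nat \<Rightarrow> 'a \<Rightarrow> real) \<Rightarrow> real mat"
  where "cov_mat P k f = mat k k (\<lambda>(i, j). cov P (f i) (f j))"

definition min_eigenvalue :: "real mat \<Rightarrow> real"
  where "min_eigenvalue A = Min {l. eigenvalue A l}"


section \<open>Brownian bridges, pregaussian and KMT classes\<close>

definition normal_law :: "real \<Rightarrow> real \<Rightarrow> real measure"
  where "normal_law m s = (if s = 0 then return borel m else density lborel (normal_density m s))"

definition gaussian_process :: "'w measure \<Rightarrow> 'i set \<Rightarrow> ('i \<Rightarrow> 'w \<Rightarrow> real) \<Rightarrow> bool"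
  where "gaussian_process N I B \<longleftrightarrow> prob_space N \<and> (\<forall>i\<in>I. B i \<in> borel_measurable N) \<and>
    (\<forall>J a. finite J \<and> J \<subseteq> I \<longrightarrow>
      (\<exists>m s. s \<ge> 0 \<and> distr N borel (\<lambda>w. \<Sum>j\<in>J. a j * B j w) = normal_law m s))"

definition brownian_bridge ::
    "'w measure \<Rightarrow> 'a measure \<Rightarrow> ('a \<Rightarrow> real) set \<Rightarrow> (('a \<Rightarrow> real) \<Rightarrow> 'w \<Rightarrow> real) \<Rightarrow> bool"
  where "brownian_bridge N P F B \<longleftrightarrow>
    (\<forall>f\<in>F. f \<in> borel_measurable P \<and> integrable P (\<lambda>x. (f x)\<^sup>2)) \<and>
    gaussian_process N F B \<and>
    (\<forall>f\<in>F. (\<integral>w. B f w \<partial>N) = 0) \<and>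
    (\<forall>f\<in>F. \<forall>g\<in>F. (\<integral>w. B f w * B g w \<partial>N) = cov P f g)"

text \<open>The intrinsic (pseudo)metric of the bridge: the standard deviation of \<open>f - g\<close> under \<open>P\<close>,
  which is the \<open>L\<^sup>2\<close> distance of \<open>B f\<close> and \<open>B g\<close>. (The variance of \<open>\<bar>f - g\<bar>\<close> would not satisfy the
  triangle inequality.)\<close>

definition rho :: "'a measure \<Rightarrow> ('a \<Rightarrow> real) \<Rightarrow> ('a \<Rightarrow> real) \<Rightarrow> real"
  where "rho P f g = sqrt (prob_space.variance P (\<lambda>x. f x - g x))"

text \<open>
  HOL cannot quantify over the type of the underlying sample space, so it is fixed here to one
  that carries the canonical process on the coordinate space over \<open>F\<close>.
\<close>

definition pregaussian :: "'a measure \<Rightarrow> ('a \<Rightarrow> real) set \<Rightarrow> bool"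
  where "pregaussian P F \<longleftrightarrow>
    (\<exists>(N :: (('a \<Rightarrow> real) \<Rightarrow> real) measure) B. brownian_bridge N P F B \<and>
      (AE w in N. (\<exists>C. \<forall>f\<in>F. \<bar>B f w\<bar> \<le> C) \<and>
        (\<forall>e>0. \<exists>d>0. \<forall>f\<in>F. \<forall>g\<in>F. rho P f g < d \<longrightarrow> \<bar>B f w - B g w\<bar> < e)))"

text \<open>
  The KMT property concerns only \<open>F\<close>, \<open>P\<close> and \<open>\<delta>\<close>: for each \<open>n\<close> an i.i.d. sample from \<open>P\<close> and a
  bridge are realised on a common probability space. The type of that space carries the
  joint law of the sample and the bridge; for countable \<open>F\<close> every coupling on any other space,
  in particular on an enlargement of the space of a given sample, can be transported to it.
  The event in the bound is measurable for countable \<open>F\<close>; for uncountable \<open>F\<close> outer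
  probabilities would be needed.
\<close>

definition KMT ::
    "(nat \<Rightarrow> real) \<Rightarrow> 'a::topological_space measure \<Rightarrow> ('a \<Rightarrow> real) set \<Rightarrow> bool"
  where "KMT \<delta> P F \<longleftrightarrow>
    (\<forall>n\<ge>1. \<delta> (Suc n) \<le> \<delta> n) \<and> (\<exists>a>0. \<delta> \<in> o(\<lambda>n. real n powr (- a))) \<and>
    pregaussian P F \<and>
    (\<exists>b>0. \<exists>c>0. \<exists>\<theta>>0. \<forall>n\<ge>1.
      \<exists>(N :: ((nat \<Rightarrow> 'a) \<times> (('a \<Rightarrow> real) \<Rightarrow> real)) measure) X B.
        iid_sample N P X \<and> brownian_bridge N P F B \<and>
        (\<forall>t>0. measure N {w \<in> space N.
            (SUP f\<in>F. ereal \<bar>sqrt (real n) * (emp n (\<lambda>i. X i w) f - (\<integral>x. f x \<partial>P)) - B f w\<bar>)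
              \<ge> ereal (\<delta> n * (t + b * ln (real n)))}
          \<le> c * exp (- \<theta> * t)))"

end

(*
  Under H0 the supremum over constants in the dual problem replaces second moments by empirical
  variances.  In coordinates that are orthonormal for the covariance of P, write eta for the squared
  norm of the normalised empirical process of the class.  If the empirical covariance form lies
  within a factor 1 +- tau of the identity, then n chi^2 differs from eta by at most 2 tau eta.

  Replacing the empirical process by the KMT bridge changes eta by o_P(sqrt k) (first rate condition,
  as the coordinate change has operator norm at most lam^(-1/2)), and the squared norm of a standard
  Gaussian vector satisfies the central limit theorem.  Moreover tau = o_P(k^(-1/2)) (second rate
  condition), because the Frobenius norm of the covariance error is O_P(k n^(-1/2)).  This last bound
  needs fourth moments that are uniform over F.  They come from the KMT coupling for n = 1: g - P g
  is a Gaussian variable of bounded variance (pregaussian paths are bounded) plus an error with an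
  exponential tail.
*)
theory Submission
  imports Defs
begin

section \<open>Quadratic forms\<close>

text \<open>The coupling supplies for each n a probability space of its own, with a sample of its
  own. The bridge is therefore compared with eta on that space; eta is a function of the sample
  alone, so its limit law carries over to the given space, and only there is the statistic compared
  with eta. The bridge is known through the laws of its finite linear combinations, so a Gaussian
  vector Y is at hand only through one-dimensional characteristic functions. Its squared norm is
  identified by means of the bounded variable exp(-|Y|^2 / 2): the moments of this variable are
  values of the Laplace transform of |Y|^2, and one-dimensional uniqueness suffices. The norming
  sqrt (2 k) fixes the accuracy: eta has mean k, so a relative error tau contributes at the order
  tau * sqrt k. Optimising over constants adds an error of its own, since centring at empirical
  means instead of means under P costs eta / n in relative size. The second rate condition covers it
  because lam stays bounded above.\<close>

definition bil :: "(nat \<Rightarrow> nat \<Rightarrow> real) \<Rightarrow> nat \<Rightarrow> (nat \<Rightarrow> real) \<Rightarrow> (nat \<Rightarrow> real) \<Rightarrow> real"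
  where "bil S k x y = (\<Sum>p<k. \<Sum>q<k. x p * y q * S p q)"

lemma bil_add_left: "bil S k (\<lambda>p. x p + y p) z = bil S k x z + bil S k y z"
  and bil_add_right: "bil S k z (\<lambda>p. x p + y p) = bil S k z x + bil S k z y"
  and bil_scale_left: "bil S k (\<lambda>p. c * x p) z = c * bil S k x z"
  and bil_scale_right: "bil S k z (\<lambda>p. c * x p) = c * bil S k z x"
  and bil_zero_left: "bil S k (\<lambda>p. 0) z = 0"
  and bil_zero_right: "bil S k z (\<lambda>p. 0) = 0"
  by (simp_all add: bil_def algebra_simps sum.distrib sum_distrib_left)

lemma bil_sum_left:
  fixes m :: nat
  shows "bil S k (\<lambda>p. \<Sum>i<m. a i * A i p) z = (\<Sum>i<m. a i * bil S k (A i) z)"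
  by (induction m) (simp_all add: bil_add_left bil_scale_left bil_zero_left)

lemma bil_sum_right:
  fixes m :: nat
  shows "bil S k z (\<lambda>p. \<Sum>i<m. a i * A i p) = (\<Sum>i<m. a i * bil S k z (A i))"
  by (induction m) (simp_all add: bil_add_right bil_scale_right bil_zero_right)

lemma bil_commute:
  assumes "\<And>p q. S p q = S q p"
  shows "bil S k x y = bil S k y x"
  unfolding bil_def by (subst sum.swap) (simp add: assms mult.commute mult.left_commute)

lemma bil_cong:
  assumes "\<And>p. p < k \<Longrightarrow> x p = x' p" "\<And>p. p < k \<Longrightarrow> y p = y' p"
  shows "bil S k x y = bil S k x' y'"
  unfolding bil_def using assms by (intro sum.cong) auto

lemma bil_orthonormal:
  fixes k :: nat
  assumes "\<And>i j. i < k \<Longrightarrow> j < k \<Longrightarrow> bil S m (A i) (A j) = (if i = j then 1 else 0)"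
  shows "bil S m (\<lambda>p. \<Sum>i<k. a i * A i p) (\<lambda>p. \<Sum>i<k. a i * A i p) = (\<Sum>i<k. (a i)\<^sup>2)"
proof -
  have "bil S m (\<lambda>p. \<Sum>i<k. a i * A i p) (\<lambda>p. \<Sum>i<k. a i * A i p) =
      (\<Sum>i<k. a i * (\<Sum>j<k. a j * (if i = j then 1 else 0)))"
    by (simp add: bil_sum_left bil_sum_right assms)
  also have "\<dots> = (\<Sum>i<k. (a i)\<^sup>2)"
    by (intro sum.cong) (auto simp: power2_eq_square if_distrib cong: if_cong)
  finally show ?thesis .
qed

text \<open>A positive linear term would dominate the quadratic one for small negative t. This is
  the first-order condition at a minimum.\<close>

lemma linear_coefficient_zero:
  fixes a b :: real
  assumes "\<And>t. 0 \<le> 2 * t * a + t\<^sup>2 * b" "a \<ge> 0"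
  shows "a = 0"
proof (rule ccontr)
  assume "a \<noteq> 0"
  hence a: "a > 0" using assms by simp
  \<comment> \<open>This size gives t^2 * b <= - t * a, so the polynomial would be at most t * a <
    0.\<close>
  define t where "t = - a / (\<bar>b\<bar> + 1)"
  have t: "t < 0" unfolding t_def using a by (intro divide_neg_pos) auto
  have ta: "t * (\<bar>b\<bar> + 1) = - a"
    unfolding t_def by (simp add: add_nonneg_eq_0_iff)
  have "t\<^sup>2 * b \<le> t\<^sup>2 * (\<bar>b\<bar> + 1)" by (intro mult_left_mono) auto
  also have "\<dots> = t * (t * (\<bar>b\<bar> + 1))" by (simp add: power2_eq_square)
  also have "\<dots> = - t * a" unfolding ta by simp
  finally have "0 \<le> t * a" using assms(1)[of t] by simp
  thus False using t a by (simp add: zero_le_mult_iff)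
qed

text \<open>Vectors are functions on \<open>nat\<close>. Pinning the coordinates from k on to 0
  places the unit sphere of R^k inside a product of compact sets, so Tychonoff's theorem applies in
  the product topology.\<close>

lemma compact_coordinate_sphere:
  "compact {x :: nat \<Rightarrow> real. (\<forall>p. x p \<in> (if p < k then {-1..1} else {0})) \<and> (\<Sum>p<k. (x p)\<^sup>2) = 1}"
proof -
  have c: "compact (Pi\<^sub>E UNIV (\<lambda>p. if p < k then {-1..1} else {0::real}))"
  proof -
    have "compactin (product_topology (\<lambda>_. euclidean) UNIV) (Pi\<^sub>E UNIV (\<lambda>p. if p < k then {-1..1} else {0::real}))"
      by (subst compactin_PiE) (auto simp: compactin_euclidean_iff)
    thus ?thesis
      by (simp add: euclidean_product_topology compactin_euclidean_iff)
  qed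
  have cl: "closed {x :: nat \<Rightarrow> real. (\<Sum>p<k. (x p)\<^sup>2) = 1}"
    by (intro closed_Collect_eq continuous_intros continuous_on_product_coordinates)
  have eq: "{x :: nat \<Rightarrow> real. (\<forall>p. x p \<in> (if p < k then {-1..1} else {0})) \<and> (\<Sum>p<k. (x p)\<^sup>2) = 1}
     = Pi\<^sub>E UNIV (\<lambda>p. if p < k then {-1..1} else {0}) \<inter> {x. (\<Sum>p<k. (x p)\<^sup>2) = 1}"
    by (rule Set.set_eqI) (simp only: PiE_UNIV_domain Pi_def mem_Collect_eq Int_iff UNIV_I simp_thms)
  show ?thesis unfolding eq by (rule compact_Int_closed[OF c cl])
qed

lemma finite_eigenvalues:
  assumes "(A :: real mat) \<in> carrier_mat n n"
  shows "finite {l. eigenvalue A l}"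
proof -
  have "char_poly A \<noteq> 0" using degree_monic_char_poly[OF assms] by auto
  thus ?thesis using eigenvalue_root_char_poly[OF assms] poly_roots_finite by simp
qed

text \<open>The minimum of the form on the unit sphere is attained, and by the first-order condition
  it is an eigenvalue. \<open>min_eigenvalue\<close> cannot exceed it, being the least element of a
  finite set that contains it. No diagonalisation enters.\<close>

lemma min_eigenvalue_le_rayleigh:
  assumes sym: "\<And>p q. S p q = S q p" and k: "k > 0"
  shows "min_eigenvalue (mat k k (\<lambda>(i, j). S i j)) * (\<Sum>p<k. (b p)\<^sup>2) \<le> bil S k b b"
proof -
  define K where "K = {x :: nat \<Rightarrow> real. (\<forall>p. x p \<in> (if p < k then {-1..1} else {0})) \<and> (\<Sum>p<k. (x p)\<^sup>2) = 1}"
  let ?A = "mat k k (\<lambda>(i, j). S i j)"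
  have "compact K" unfolding K_def by (rule compact_coordinate_sphere)
  moreover have "(\<lambda>p. if p = 0 then 1 else 0) \<in> K"
    using k by (auto simp: K_def if_distrib[of "\<lambda>x. x^2"] sum.delta cong: if_cong)
  hence "K \<noteq> {}" by blast
  moreover have "continuous_on K (\<lambda>x. bil S k x x)" unfolding bil_def
    by (intro continuous_intros continuous_on_subset[OF continuous_on_product_coordinates]) auto
  ultimately obtain x where x: "x \<in> K" and min: "\<And>y. y \<in> K \<Longrightarrow> bil S k x x \<le> bil S k y y"
    using continuous_attains_inf[of K "\<lambda>x. bil S k x x"] by blast
  define \<mu> where "\<mu> = bil S k x x"
  have nx: "(\<Sum>p<k. (x p)\<^sup>2) = 1" using x by (simp add: K_def)
  have ray: "\<mu> * (\<Sum>p<k. (y p)\<^sup>2) \<le> bil S k y y" for y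
  proof (cases "(\<Sum>p<k. (y p)\<^sup>2) = 0")
    case True
    hence "y p = 0" if "p < k" for p using that by (simp add: sum_nonneg_eq_0_iff)
    hence "bil S k y y = 0" by (simp add: bil_def)
    thus ?thesis using True by simp
  next
    case False
    define r where "r = (\<Sum>p<k. (y p)\<^sup>2)"
    have r: "r > 0" using False sum_nonneg[of "{..<k}" "\<lambda>p. (y p)\<^sup>2"] unfolding r_def by auto
    define z where "z = (\<lambda>p. if p < k then (1 / sqrt r) * y p else 0)"
    have "(\<Sum>p<k. (z p)\<^sup>2) = (\<Sum>p<k. (y p)\<^sup>2 / r)"
      using r by (intro sum.cong) (auto simp: z_def power_divide)
    also have "\<dots> = 1" using r by (simp add: sum_divide_distrib[symmetric] r_def)
    finally have nz: "(\<Sum>p<k. (z p)\<^sup>2) = 1" .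
    have "\<bar>z p\<bar> \<le> 1" if "p < k" for p
    proof -
      have "(z p)\<^sup>2 \<le> (\<Sum>p<k. (z p)\<^sup>2)" using that by (intro member_le_sum) auto
      thus ?thesis using nz by (simp add: abs_square_le_1)
    qed
    moreover have "z p = 0" if "\<not> p < k" for p using that by (simp add: z_def)
    ultimately have "z \<in> K" using nz by (auto simp: K_def abs_le_iff minus_le_iff)
    hence "\<mu> \<le> bil S k z z" unfolding \<mu>_def by (rule min)
    also have "\<dots> = bil S k (\<lambda>p. (1 / sqrt r) * y p) (\<lambda>p. (1 / sqrt r) * y p)"
      by (rule bil_cong) (auto simp: z_def)
    also have "\<dots> = (1 / r) * bil S k y y"
      unfolding bil_scale_left bil_scale_right using r by (simp add: field_simps)
    finally show ?thesis using r by (simp add: r_def[symmetric] field_simps)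
  qed
  \<comment> \<open>The residual of the eigenvalue equation. Moving the minimiser in this very
    direction makes the linear coefficient equal to the squared norm of the residual, which must
    therefore vanish.\<close>
  define w where "w = (\<lambda>p. (\<Sum>q<k. S p q * x q) - \<mu> * x p)"
  have "(\<Sum>p<k. (w p)\<^sup>2) = 0"
  proof (rule linear_coefficient_zero)
    fix t :: real
    have "bil S k x w = bil S k w x" by (rule bil_commute) (rule sym)
    moreover have "bil S k w x = (\<Sum>p<k. w p * (\<Sum>q<k. S p q * x q))"
      by (simp add: bil_def sum_distrib_left mult_ac)
    moreover have "\<dots> = (\<Sum>p<k. (w p)\<^sup>2 + \<mu> * (x p * w p))"
      by (intro sum.cong) (auto simp: w_def power2_eq_square algebra_simps)
    ultimately have xw: "bil S k x w = (\<Sum>p<k. (w p)\<^sup>2) + \<mu> * (\<Sum>p<k. x p * w p)"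
        "bil S k w x = (\<Sum>p<k. (w p)\<^sup>2) + \<mu> * (\<Sum>p<k. x p * w p)"
      by (simp_all add: sum.distrib sum_distrib_left)
    have "(\<Sum>p<k. (x p + t * w p)\<^sup>2) = 1 + 2 * t * (\<Sum>p<k. x p * w p) + t\<^sup>2 * (\<Sum>p<k. (w p)\<^sup>2)"
      unfolding nx[symmetric] by (simp add: power2_eq_square algebra_simps sum.distrib sum_distrib_left)
    hence "\<mu> * (1 + 2 * t * (\<Sum>p<k. x p * w p) + t\<^sup>2 * (\<Sum>p<k. (w p)\<^sup>2))
        \<le> bil S k (\<lambda>p. x p + t * w p) (\<lambda>p. x p + t * w p)" using ray[of "\<lambda>p. x p + t * w p"] by simp
    also have "\<dots> = \<mu> + 2 * t * bil S k x w + t\<^sup>2 * bil S k w w"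
      unfolding bil_add_left bil_add_right bil_scale_left bil_scale_right
      by (simp add: \<mu>_def xw power2_eq_square algebra_simps)
    finally show "0 \<le> 2 * t * (\<Sum>p<k. (w p)\<^sup>2) + t\<^sup>2 * (bil S k w w - \<mu> * (\<Sum>p<k. (w p)\<^sup>2))"
      unfolding xw by (simp add: algebra_simps)
  qed (intro sum_nonneg, simp)
  hence w0: "w p = 0" if "p < k" for p using that by (simp add: sum_nonneg_eq_0_iff)
  have "eigenvector ?A (vec k x) \<mu>"
    unfolding eigenvector_def
  proof (intro conjI)
    show "vec k x \<noteq> 0\<^sub>v (dim_row ?A)"
    proof
      assume "vec k x = 0\<^sub>v (dim_row ?A)"
      hence "vec k x $ p = 0" if "p < k" for p using that by simp
      hence "(\<Sum>p<k. (x p)\<^sup>2) = 0" by simp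
      thus False using nx by simp
    qed
    show "?A *\<^sub>v vec k x = \<mu> \<cdot>\<^sub>v vec k x"
    proof (rule eq_vecI)
      fix p assume "p < dim_vec (\<mu> \<cdot>\<^sub>v vec k x)"
      thus "(?A *\<^sub>v vec k x) $ p = (\<mu> \<cdot>\<^sub>v vec k x) $ p"
        using w0[of p] by (simp add: scalar_prod_def w_def atLeast0LessThan)
    qed simp
  qed simp
  hence "eigenvalue ?A \<mu>" unfolding eigenvalue_def by blast
  hence "min_eigenvalue ?A \<le> \<mu>"
    unfolding min_eigenvalue_def by (intro Min_le finite_eigenvalues[of _ k]) auto
  hence "min_eigenvalue ?A * (\<Sum>p<k. (b p)\<^sup>2) \<le> \<mu> * (\<Sum>p<k. (b p)\<^sup>2)"
    by (intro mult_right_mono sum_nonneg) auto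
  thus ?thesis using ray[of b] by linarith
qed

text \<open>Triangularity keeps the induction going: the vector obtained from the new unit vector
  \<open>u\<close> has coordinate 1 at m, so the form is positive on it and it can be
  normalised.\<close>

lemma gram_schmidt_bil:
  assumes sym: "\<And>p q. S p q = S q p"
    and pos: "\<And>x. \<exists>p<k. x p \<noteq> 0 \<Longrightarrow> bil S k x x > 0"
    and "m \<le> k"
  shows "\<exists>A. (\<forall>i<m. \<forall>p>i. A i p = 0) \<and> (\<forall>i<m. \<forall>j<m. bil S k (A i) (A j) = (if i = j then 1 else 0))"
  using \<open>m \<le> k\<close>
proof (induction m)
  case 0
  show ?case by simp
next
  case (Suc m)
  have "\<exists>A. (\<forall>i<m. \<forall>p>i. A i p = 0) \<and> (\<forall>i<m. \<forall>j<m. bil S k (A i) (A j) = (if i = j then 1 else 0))"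
    using Suc by simp
  then obtain A where A: "(\<forall>i<m. \<forall>p>i. A i p = 0) \<and> (\<forall>i<m. \<forall>j<m. bil S k (A i) (A j) = (if i = j then 1 else 0))"
    by (rule exE)
  hence tri: "\<And>i p. i < m \<Longrightarrow> p > i \<Longrightarrow> A i p = 0"
    and orth: "\<And>i j. i < m \<Longrightarrow> j < m \<Longrightarrow> bil S k (A i) (A j) = (if i = j then 1 else 0)" by simp_all
  define u where "u = (\<lambda>p. if p = m then 1 else (0::real))"
  define x where "x = (\<lambda>p. u p + (\<Sum>i<m. (- bil S k u (A i)) * A i p))"
  have xm: "x m = 1" using tri by (simp add: x_def u_def)
  have xp: "x p = 0" if "p > m" for p using tri that by (simp add: x_def u_def)
  have xA: "bil S k x (A j) = 0" if "j < m" for j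
  proof -
    have "bil S k x (A j) = bil S k u (A j) - (\<Sum>i<m. bil S k u (A i) * (if i = j then 1 else 0))"
      unfolding x_def bil_add_left bil_sum_left using that by (simp add: orth sum_negf)
    also have "\<dots> = 0" using that by (simp add: if_distrib cong: if_cong)
    finally show ?thesis .
  qed
  hence Ax: "bil S k (A j) x = 0" if "j < m" for j using that bil_commute[of S k] sym by metis
  define s where "s = 1 / sqrt (bil S k x x)"
  have "bil S k x x > 0" using xm Suc.prems by (intro pos exI[of _ m]) auto
  hence s: "s * (s * bil S k x x) = 1" by (simp add: s_def)
  define A' where "A' = A(m := (\<lambda>p. s * x p))"
  have "bil S k (A' i) (A' j) = (if i = j then 1 else 0)" if "i < Suc m" "j < Suc m" for i j
    using that orth xA Ax s by (auto simp: A'_def bil_scale_left bil_scale_right less_Suc_eq)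
  moreover have "A' i p = 0" if "i < Suc m" "p > i" for i p
    using that tri xp by (auto simp: A'_def less_Suc_eq)
  ultimately show ?case by blast
qed

text \<open>Orthonormality reads A (S A^T) = I. A one-sided inverse of a square matrix is two-sided,
  so (S A^T) A = I, and this is the expansion.\<close>

lemma orthonormal_expansion:
  assumes orth: "\<And>i j. i < k \<Longrightarrow> j < k \<Longrightarrow> bil S k (A i) (A j) = (if i = j then 1 else 0)"
    and p: "p < k"
  shows "(\<Sum>i<k. bil S k b (A i) * A i p) = b p"
proof -
  define MA where "MA = mat k k (\<lambda>(i, j). A i j)"
  define R where "R = mat k k (\<lambda>(q, i). \<Sum>r<k. S q r * A i r)"
  have c: "MA \<in> carrier_mat k k" "R \<in> carrier_mat k k" by (simp_all add: MA_def R_def)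
  have "MA * R = 1\<^sub>m k"
  proof (rule eq_matI)
    fix i j assume "i < dim_row (1\<^sub>m k)" "j < dim_col (1\<^sub>m k)"
    hence ij: "i < k" "j < k" by auto
    have "(MA * R) $$ (i, j) = bil S k (A i) (A j)"
      using ij by (simp add: MA_def R_def scalar_prod_def bil_def atLeast0LessThan sum_distrib_left mult_ac)
    thus "(MA * R) $$ (i, j) = 1\<^sub>m k $$ (i, j)" using ij orth by simp
  qed (simp_all add: MA_def R_def)
  hence RM: "R * MA = 1\<^sub>m k" by (rule mat_mult_left_right_inverse[OF c])
  have key: "(\<Sum>i<k. (\<Sum>r<k. S q r * A i r) * A i p) = (if q = p then 1 else 0)" if "q < k" for q
  proof -
    have "(R * MA) $$ (q, p) = (\<Sum>i<k. (\<Sum>r<k. S q r * A i r) * A i p)"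
      using that p by (simp add: MA_def R_def scalar_prod_def atLeast0LessThan)
    thus ?thesis using RM that p by simp
  qed
  have "(\<Sum>i<k. bil S k b (A i) * A i p) = (\<Sum>i<k. \<Sum>q<k. b q * ((\<Sum>r<k. S q r * A i r) * A i p))"
    unfolding bil_def by (simp add: sum_distrib_left sum_distrib_right mult_ac)
  also have "\<dots> = (\<Sum>q<k. b q * (\<Sum>i<k. (\<Sum>r<k. S q r * A i r) * A i p))"
    by (subst sum.swap) (simp add: sum_distrib_left)
  also have "\<dots> = (\<Sum>q<k. b q * (if q = p then 1 else 0))" using key by simp
  also have "\<dots> = b p" using p by (simp add: if_distrib cong: if_cong)
  finally show ?thesis .
qed

text \<open>The last two conclusions bound a map and its transpose, both of norm at most lam^(-1/2).
  The last one controls how the change of coordinates enlarges an error vector.\<close>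

lemma orthonormal_coordinates:
  assumes sym: "\<And>p q. S p q = S q p" and lam: "lam > 0"
    and ray: "\<And>b. lam * (\<Sum>p<k. (b p)\<^sup>2) \<le> bil S k b b"
  obtains A :: "nat \<Rightarrow> nat \<Rightarrow> real" where
    "\<And>i j. i < k \<Longrightarrow> j < k \<Longrightarrow> bil S k (A i) (A j) = (if i = j then 1 else 0)"
    "\<And>b p. p < k \<Longrightarrow> (\<Sum>i<k. bil S k b (A i) * A i p) = b p"
    "\<And>a. lam * (\<Sum>p<k. (\<Sum>i<k. a i * A i p)\<^sup>2) \<le> (\<Sum>i<k. (a i)\<^sup>2)"
    "\<And>u. lam * (\<Sum>i<k. (\<Sum>p<k. A i p * u p)\<^sup>2) \<le> (\<Sum>p<k. (u p)\<^sup>2)"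
proof -
  have pos: "bil S k x x > 0" if "\<exists>p<k. x p \<noteq> 0" for x
  proof -
    have "(\<Sum>p<k. (x p)\<^sup>2) > 0" using that by (auto intro!: sum_pos2)
    thus ?thesis using ray[of x] lam by (meson less_le_trans mult_pos_pos)
  qed
  obtain A where orth: "\<And>i j. i < k \<Longrightarrow> j < k \<Longrightarrow> bil S k (A i) (A j) = (if i = j then 1 else 0)"
    using gram_schmidt_bil[OF sym pos order_refl] by metis
  have A3: "lam * (\<Sum>p<k. (\<Sum>i<k. a i * A i p)\<^sup>2) \<le> (\<Sum>i<k. (a i)\<^sup>2)" for a
    using ray[of "\<lambda>p. \<Sum>i<k. a i * A i p"] by (simp add: bil_orthonormal[OF orth])
  have A4: "lam * (\<Sum>i<k. (\<Sum>p<k. A i p * u p)\<^sup>2) \<le> (\<Sum>p<k. (u p)\<^sup>2)" for u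
  proof -
    \<comment> \<open>Pair v = A u with itself: |v|^2 = <A^T v, u>. The third claim bounds A^T v,
      and Cauchy-Schwarz then bounds |v|.\<close>
    define v where "v = (\<lambda>i. \<Sum>p<k. A i p * u p)"
    define g where "g = (\<lambda>p. \<Sum>i<k. v i * A i p)"
    define V where "V = (\<Sum>i<k. (v i)\<^sup>2)"
    have V0: "V \<ge> 0" unfolding V_def by (intro sum_nonneg) auto
    have "V = (\<Sum>i<k. \<Sum>p<k. v i * (A i p * u p))"
      unfolding V_def power2_eq_square by (simp add: sum_distrib_left v_def)
    also have "\<dots> = (\<Sum>p<k. g p * u p)"
      by (subst sum.swap) (simp add: g_def sum_distrib_right mult.assoc)
    finally have "V\<^sup>2 = (\<Sum>p<k. g p * u p)\<^sup>2" by simp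
    also have "\<dots> \<le> (\<Sum>p<k. (g p)\<^sup>2) * (\<Sum>p<k. (u p)\<^sup>2)" by (rule Cauchy_Schwarz_ineq_sum)
    finally have "lam * V\<^sup>2 \<le> (lam * (\<Sum>p<k. (g p)\<^sup>2)) * (\<Sum>p<k. (u p)\<^sup>2)"
      using lam by (simp add: mult.assoc)
    also have "\<dots> \<le> V * (\<Sum>p<k. (u p)\<^sup>2)"
      using A3[of v] unfolding V_def g_def by (intro mult_right_mono sum_nonneg) auto
    finally have *: "V * (lam * V) \<le> V * (\<Sum>p<k. (u p)\<^sup>2)" by (simp add: power2_eq_square mult_ac)
    have "lam * V \<le> (\<Sum>p<k. (u p)\<^sup>2)"
    proof (cases "V = 0")
      case True
      thus ?thesis by (simp add: sum_nonneg)
    next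
      case False
      thus ?thesis using * V0 by (simp add: mult_le_cancel_left)
    qed
    thus ?thesis by (simp add: V_def v_def)
  qed
  show thesis using that[OF orth orthonormal_expansion[OF orth] A3 A4] by blast
qed

section \<open>Variation measures of a signed measure\<close>

lemma signed_measure_empty: "signed_measure Q \<Longrightarrow> Q {} = 0"
  by (simp add: signed_measure_def)

lemma signed_measure_sums:
  assumes "signed_measure Q" "range A \<subseteq> sets borel" "disjoint_family A"
  shows "(\<lambda>i. Q (A i)) sums Q (\<Union>i. A i)"
  using assms by (simp add: signed_measure_def)

lemma signed_measure_Un:
  fixes Q :: "'a::topological_space set \<Rightarrow> real"
  assumes Q: "signed_measure Q" and AB: "A \<in> sets borel" "B \<in> sets borel" "A \<inter> B = {}"
  shows "Q (A \<union> B) = Q A + Q B"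
proof -
  have "(\<lambda>i. Q (binaryset A B i)) sums Q (\<Union>i. binaryset A B i)"
    using AB by (intro signed_measure_sums[OF Q])
      (auto simp: disjoint_family_on_def binaryset_def)
  moreover have "(\<lambda>i. Q (binaryset A B i)) sums (Q A + Q B)"
    by (rule binaryset_sums) (rule signed_measure_empty[OF Q])
  ultimately show ?thesis by (metis UN_binaryset_eq sums_unique2)
qed

lemma signed_measure_Diff:
  fixes Q :: "'a::topological_space set \<Rightarrow> real"
  assumes Q: "signed_measure Q" and "A \<in> sets borel" "B \<in> sets borel" "B \<subseteq> A"
  shows "Q (A - B) = Q A - Q B"
proof -
  have "Q ((A - B) \<union> B) = Q (A - B) + Q B"
    using assms by (intro signed_measure_Un[OF Q]) auto
  moreover have "(A - B) \<union> B = A" using assms by auto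
  ultimately show ?thesis by simp
qed

lemma signed_measure_uminus: "signed_measure Q \<Longrightarrow> signed_measure (\<lambda>A. - Q A)"
  by (auto simp: signed_measure_def intro: sums_minus)

text \<open>If \<open>Q\<close> were unbounded, one could peel off disjoint sets of mass at least 1 in absolute value
  for ever, keeping an unbounded rest, in contradiction to countable additivity.\<close>

lemma signed_measure_bounded:
  fixes Q :: "'a::topological_space set \<Rightarrow> real"
  assumes Q: "signed_measure Q"
  shows "\<exists>C. \<forall>B\<in>sets borel. \<bar>Q B\<bar> \<le> C"
proof (rule ccontr)
  assume contra: "\<not> ?thesis"
  define unb where "unb E \<longleftrightarrow> E \<in> sets borel \<and> (\<forall>C. \<exists>B\<in>sets borel. B \<subseteq> E \<and> \<bar>Q B\<bar> > C)" for E
  have step: "\<exists>E'. unb E' \<and> E' \<subseteq> E \<and> \<bar>Q (E - E')\<bar> \<ge> 1" if E: "unb E" for E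
  proof -
    from E have Eb: "E \<in> sets borel" by (simp add: unb_def)
    \<comment> \<open>The threshold |Q E| + 1 makes both B and E - B heavier than 1, so whichever of
      the two is still unbounded can be kept and the other one removed.\<close>
    from E obtain B where B: "B \<in> sets borel" "B \<subseteq> E" "\<bar>Q B\<bar> > \<bar>Q E\<bar> + 1"
      unfolding unb_def by blast
    have d: "Q (E - B) = Q E - Q B" using signed_measure_Diff[OF Q Eb B(1,2)] .
    show ?thesis
    proof (cases "unb B")
      case True
      thus ?thesis using B d by (intro exI[of _ B]) auto
    next
      case False
      hence "\<exists>C. \<forall>D\<in>sets borel. D \<subseteq> B \<longrightarrow> \<not> \<bar>Q D\<bar> > C" using B(1) unfolding unb_def by blast
      then obtain C where C: "\<And>D. D \<in> sets borel \<Longrightarrow> D \<subseteq> B \<Longrightarrow> \<bar>Q D\<bar> \<le> C"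
        unfolding not_less by blast
      have "unb (E - B)" unfolding unb_def
      proof (intro conjI allI)
        fix C'
        obtain D where D: "D \<in> sets borel" "D \<subseteq> E" "\<bar>Q D\<bar> > C' + C"
          using E unfolding unb_def by blast
        have "Q (D - D \<inter> B) = Q D - Q (D \<inter> B)"
          using D B by (intro signed_measure_Diff[OF Q]) auto
        moreover have "\<bar>Q (D \<inter> B)\<bar> \<le> C" using D B by (intro C) auto
        ultimately have "\<bar>Q (D - D \<inter> B)\<bar> > C'" using D by linarith
        moreover have "D - D \<inter> B \<in> sets borel" "D - D \<inter> B \<subseteq> E - B" using D B by auto
        ultimately show "\<exists>B'\<in>sets borel. B' \<subseteq> E - B \<and> \<bar>Q B'\<bar> > C'" by blast
      qed (use Eb B in auto)
      moreover have "E - (E - B) = B" using B by auto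
      ultimately show ?thesis using B by (intro exI[of _ "E - B"]) auto
    qed
  qed
  have "unb UNIV" using contra by (auto simp: unb_def not_le)
  then obtain E where E: "\<And>n. unb (E n)" "\<And>n. E (Suc n) \<subseteq> E n \<and> \<bar>Q (E n - E (Suc n))\<bar> \<ge> 1"
    using dependent_nat_choice[of "\<lambda>_. unb" "\<lambda>_ E E'. E' \<subseteq> E \<and> \<bar>Q (E - E')\<bar> \<ge> 1"] step
    by metis
  have dec: "E m \<subseteq> E n" if "n \<le> m" for m n
    using that E(2) by (induction m rule: dec_induct) auto
  have "disjoint_family (\<lambda>n. E n - E (Suc n))"
    unfolding disjoint_family_on_def
  proof (intro ballI impI)
    fix m n :: nat assume "m \<noteq> n"
    thus "(E m - E (Suc m)) \<inter> (E n - E (Suc n)) = {}"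
      using dec[of "Suc m" n] dec[of "Suc n" m] by (cases "m < n") auto
  qed
  moreover have "range (\<lambda>n. E n - E (Suc n)) \<subseteq> sets borel" using E(1) by (auto simp: unb_def)
  ultimately have "summable (\<lambda>n. Q (E n - E (Suc n)))"
    using signed_measure_sums[OF Q] sums_summable by blast
  hence "(\<lambda>n. Q (E n - E (Suc n))) \<longlonglongrightarrow> 0" by (rule summable_LIMSEQ_zero)
  then obtain n where "\<bar>Q (E n - E (Suc n))\<bar> < 1"
    using LIMSEQ_D[of _ 0 1] by fastforce
  thus False using E(2)[of n] by linarith
qed

text \<open>\<open>ennreal\<close> truncates at 0, and the positive part is subadditive; the
  summands may have any sign.\<close>

lemma ennreal_sum_le: "ennreal (\<Sum>i\<in>I. x i) \<le> (\<Sum>i\<in>I. ennreal (x i))"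
proof (induction I rule: infinite_finite_induct)
  case (insert j I)
  have "ennreal (x j + (\<Sum>i\<in>I. x i)) \<le> ennreal (x j) + ennreal (\<Sum>i\<in>I. x i)"
    by (cases "x j \<ge> 0"; cases "(\<Sum>i\<in>I. x i) \<ge> 0")
      (auto simp: ennreal_plus ennreal_neg intro: ennreal_leI)
  also have "\<dots> \<le> ennreal (x j) + (\<Sum>i\<in>I. ennreal (x i))" by (intro add_left_mono insert)
  finally show ?case using insert by simp
qed auto

context
  fixes Q :: "'a::topological_space set \<Rightarrow> real"
  assumes Q: "signed_measure Q"
begin

text \<open>Subadditivity cuts a competitor along the pieces \<open>A i\<close>; superadditivity
  joins competitors of disjoint pieces. This yields a measure without a Hahn decomposition.\<close>

lemma countably_additive_upper_variation:
  "countably_additive (sets borel) (\<lambda>A. SUP B\<in>{B \<in> sets borel. B \<subseteq> A}. ennreal (Q B))"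
proof (rule countably_additiveI)
  fix A :: "nat \<Rightarrow> 'a set"
  assume A: "range A \<subseteq> sets borel" "disjoint_family A"
  define U where "U A = (SUP B\<in>{B \<in> sets borel. B \<subseteq> A}. ennreal (Q B))" for A
  have ub: "ennreal (Q B) \<le> U A" if "B \<in> sets borel" "B \<subseteq> A" for A B
    unfolding U_def using that by (intro SUP_upper) auto
  have Uadd: "U A + U B \<le> U (A \<union> B)" if AB: "A \<inter> B = {}" for A B
  proof -
    have ne: "{C \<in> sets borel. C \<subseteq> D} \<noteq> {}" for D :: "'a set" by blast
    have "ennreal (Q C) + ennreal (Q D) \<le> U (A \<union> B)"
      if CD: "C \<in> sets borel" "C \<subseteq> A" "D \<in> sets borel" "D \<subseteq> B" for C D
    proof -
      have *: "Q (C \<union> D) = Q C + Q D" using CD AB by (intro signed_measure_Un[OF Q]) auto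
      have "ennreal (Q C) \<le> U (A \<union> B)" "ennreal (Q D) \<le> U (A \<union> B)"
        "ennreal (Q (C \<union> D)) \<le> U (A \<union> B)" using CD by (auto intro!: ub)
      \<comment> \<open>A negative value is truncated to 0, and then the other set alone is a
        competitor in the union.\<close>
      thus ?thesis unfolding *
        by (cases "Q C \<ge> 0"; cases "Q D \<ge> 0") (auto simp: ennreal_neg ennreal_plus)
    qed
    hence "(SUP C\<in>{C \<in> sets borel. C \<subseteq> A}. SUP D\<in>{D \<in> sets borel. D \<subseteq> B}. ennreal (Q C) + ennreal (Q D))
        \<le> U (A \<union> B)" by (intro SUP_least) auto
    also have "(SUP C\<in>{C \<in> sets borel. C \<subseteq> A}. SUP D\<in>{D \<in> sets borel. D \<subseteq> B}. ennreal (Q C) + ennreal (Q D))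
        = (SUP C\<in>{C \<in> sets borel. C \<subseteq> A}. ennreal (Q C) + U B)"
      unfolding U_def by (simp only: ennreal_SUP_add_right[OF ne])
    also have "\<dots> = U A + U B"
      by (subst (2) U_def) (simp only: ennreal_SUP_add_left[OF ne])
    finally show ?thesis .
  qed
  have "U (\<Union>i. A i) \<le> (\<Sum>i. U (A i))"
    unfolding U_def[of "\<Union>i. A i"]
  proof (intro SUP_least)
    fix B assume "B \<in> {B \<in> sets borel. B \<subseteq> (\<Union>i. A i)}"
    hence B: "B \<in> sets borel" "B \<subseteq> (\<Union>i. A i)" by auto
    have "(\<lambda>i. Q (B \<inter> A i)) sums Q (\<Union>i. B \<inter> A i)"
      using A B by (intro signed_measure_sums[OF Q]) (auto simp: disjoint_family_on_def)
    also have "(\<Union>i. B \<inter> A i) = B" using B by auto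
    finally have "(\<lambda>n. ennreal (\<Sum>i<n. Q (B \<inter> A i))) \<longlonglongrightarrow> ennreal (Q B)"
      unfolding sums_def by (rule tendsto_ennrealI)
    moreover have "ennreal (\<Sum>i<n. Q (B \<inter> A i)) \<le> (\<Sum>i. U (A i))" for n
    proof -
      have "ennreal (\<Sum>i<n. Q (B \<inter> A i)) \<le> (\<Sum>i<n. ennreal (Q (B \<inter> A i)))" by (rule ennreal_sum_le)
      also have "\<dots> \<le> (\<Sum>i<n. U (A i))" using A B by (intro sum_mono ub) auto
      also have "\<dots> \<le> (\<Sum>i. U (A i))" by (intro sum_le_suminf) auto
      finally show ?thesis .
    qed
    ultimately show "ennreal (Q B) \<le> (\<Sum>i. U (A i))" by (intro LIMSEQ_le_const2) auto
  qed
  moreover have "(\<Sum>i. U (A i)) \<le> U (\<Union>i. A i)"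
  proof (intro suminf_le_const)
    fix n
    have "(\<Sum>i<n. U (A i)) \<le> U (\<Union>i<n. A i)"
    proof (induction n)
      case 0 show ?case by simp
    next
      case (Suc n)
      have dj: "A i \<inter> A n = {}" if "i < n" for i
        using A(2) that by (simp add: disjoint_family_on_def)
      have "(\<Sum>i<Suc n. U (A i)) \<le> U (\<Union>i<n. A i) + U (A n)"
        using Suc by (simp add: add_right_mono)
      also have "\<dots> \<le> U ((\<Union>i<n. A i) \<union> A n)"
        using dj by (intro Uadd) blast
      also have "(\<Union>i<n. A i) \<union> A n = (\<Union>i<Suc n. A i)" by (auto simp: less_Suc_eq)
      finally show ?case .
    qed
    also have "\<dots> \<le> U (\<Union>i. A i)" unfolding U_def by (intro SUP_subset_mono) auto
    finally show "(\<Sum>i<n. U (A i)) \<le> U (\<Union>i. A i)" .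
  qed auto
  ultimately show "(\<Sum>i. SUP B\<in>{B \<in> sets borel. B \<subseteq> A i}. ennreal (Q B)) =
      (SUP B\<in>{B \<in> sets borel. B \<subseteq> (\<Union>i. A i)}. ennreal (Q B))"
    unfolding U_def by (rule antisym[rotated])
qed

lemma emeasure_upper_variation:
  assumes "A \<in> sets borel"
  shows "emeasure (upper_variation Q) A = (SUP B\<in>{B \<in> sets borel. B \<subseteq> A}. ennreal (Q B))"
  unfolding upper_variation_def
proof (rule emeasure_measure_of_sigma)
  show "sigma_algebra UNIV (sets (borel :: 'a measure))"
    using sets.sigma_algebra_axioms[of "borel :: 'a measure"] by simp
  have "{B \<in> sets borel. B \<subseteq> ({} :: 'a set)} = {{}}" by auto
  thus "positive (sets borel) (\<lambda>A. SUP B\<in>{B \<in> sets borel. B \<subseteq> A}. ennreal (Q B))"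
    using signed_measure_empty[OF Q] by (simp add: positive_def)
qed (use assms countably_additive_upper_variation in auto)

end

lemma space_upper_variation [simp]: "space (upper_variation Q) = UNIV"
  by (simp add: upper_variation_def space_measure_of_conv)

lemma sets_upper_variation [simp]: "sets (upper_variation Q) = sets borel"
  unfolding upper_variation_def
  using sets.sets_measure_of_eq[of "borel"] by simp

lemma finite_measure_upper_variation:
  assumes Q: "signed_measure Q"
  shows "finite_measure (upper_variation Q)"
proof (rule finite_measureI)
  obtain C where C: "\<And>B. B \<in> sets borel \<Longrightarrow> \<bar>Q B\<bar> \<le> C"
    using signed_measure_bounded[OF Q] by blast
  have "emeasure (upper_variation Q) UNIV \<le> ennreal C"
    unfolding emeasure_upper_variation[OF Q, of UNIV, simplified]
    using C by (intro SUP_least ennreal_leI) (auto simp: abs_le_iff)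
  thus "emeasure (upper_variation Q) (space (upper_variation Q)) \<noteq> \<infinity>"
    by (auto simp: top_unique)
qed

lemma measure_upper_variation_UNIV:
  assumes Q: "signed_measure Q"
  shows "B \<in> sets borel \<Longrightarrow> Q B \<le> measure (upper_variation Q) UNIV"
    and "(\<And>B. B \<in> sets borel \<Longrightarrow> Q B \<le> c) \<Longrightarrow> measure (upper_variation Q) UNIV \<le> c"
proof -
  interpret finite_measure "upper_variation Q" by (rule finite_measure_upper_variation[OF Q])
  note * = emeasure_upper_variation[OF Q, of UNIV, simplified, symmetric]
  show "Q B \<le> measure (upper_variation Q) UNIV" if "B \<in> sets borel"
  proof -
    have "ennreal (Q B) \<le> emeasure (upper_variation Q) UNIV"
      unfolding *[symmetric] using that by (intro SUP_upper) auto
    thus ?thesis by (simp add: emeasure_eq_measure)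
  qed
  show "measure (upper_variation Q) UNIV \<le> c" if c: "\<And>B. B \<in> sets borel \<Longrightarrow> Q B \<le> c"
  proof -
    have "0 \<le> c" using c[of "{}"] signed_measure_empty[OF Q] by simp
    moreover have "emeasure (upper_variation Q) UNIV \<le> ennreal c"
      unfolding *[symmetric] using c by (intro SUP_least ennreal_leI) auto
    ultimately show ?thesis by (simp add: emeasure_eq_measure)
  qed
qed

text \<open>Complementation turns a competitor for Q into one for -Q, shifted by
  \<open>Q UNIV\<close>. The whole space suffices, since the identity serves to integrate
  constants.\<close>

lemma variation_difference_UNIV:
  assumes Q: "signed_measure Q"
  shows "measure (upper_variation Q) UNIV - measure (lower_variation Q) UNIV = Q UNIV"
proof -
  note Q' = signed_measure_uminus[OF Q]
  have c: "Q (- B) = Q UNIV - Q B" if "B \<in> sets borel" for B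
    using signed_measure_Diff[OF Q, of UNIV B] that by (simp add: Compl_eq_Diff_UNIV)
  have cb: "- B \<in> sets borel" if "B \<in> sets borel" for B :: "'a set"
    using that by (auto simp: Compl_eq_Diff_UNIV)
  have "measure (upper_variation Q) UNIV \<le> Q UNIV + measure (lower_variation Q) UNIV"
  proof (rule measure_upper_variation_UNIV(2)[OF Q])
    fix B :: "'a set" assume B: "B \<in> sets borel"
    show "Q B \<le> Q UNIV + measure (lower_variation Q) UNIV"
      using measure_upper_variation_UNIV(1)[OF Q' cb[OF B]] c[OF B]
      unfolding lower_variation_def by linarith
  qed
  moreover have "measure (lower_variation Q) UNIV \<le> measure (upper_variation Q) UNIV - Q UNIV"
    unfolding lower_variation_def
  proof (rule measure_upper_variation_UNIV(2)[OF Q'])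
    fix B :: "'a set" assume B: "B \<in> sets borel"
    show "- Q B \<le> measure (upper_variation Q) UNIV - Q UNIV"
      using measure_upper_variation_UNIV(1)[OF Q cb[OF B]] c[OF B] by linarith
  qed
  ultimately show ?thesis by linarith
qed

text \<open>The constant contributes c times the difference of the total masses of the two
  variations. This difference is \<open>Q UNIV\<close>, and here the unit mass of Q enters.\<close>

lemma sm_integral_affine:
  fixes Q :: "'a::topological_space set \<Rightarrow> real" and k :: nat
  assumes Q: "Q \<in> unit_signed_measures" and f: "\<And>p. p < k \<Longrightarrow> sm_integrable Q (f p)"
  shows "sm_integral Q (\<lambda>x. (\<Sum>p<k. b p * f p x) + c) = (\<Sum>p<k. b p * sm_integral Q (f p)) + c"
proof -
  have Q: "signed_measure Q" "Q UNIV = 1" using assms by (auto simp: unit_signed_measures_def)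
  interpret U: finite_measure "upper_variation Q" by (rule finite_measure_upper_variation[OF Q(1)])
  interpret L: finite_measure "lower_variation Q" unfolding lower_variation_def
    by (rule finite_measure_upper_variation[OF signed_measure_uminus[OF Q(1)]])
  have i: "\<And>p. p < k \<Longrightarrow> integrable (upper_variation Q) (f p)"
    "\<And>p. p < k \<Longrightarrow> integrable (lower_variation Q) (f p)"
    using f by (auto simp: sm_integrable_def)
  have "space (lower_variation Q) = UNIV" by (simp add: lower_variation_def)
  moreover have "(\<integral>x. (\<Sum>p<k. b p * f p x) + c \<partial>upper_variation Q) =
      (\<Sum>p<k. b p * (\<integral>x. f p x \<partial>upper_variation Q)) + c * measure (upper_variation Q) UNIV"
    using i by (subst Bochner_Integration.integral_add) (auto simp: Bochner_Integration.integral_sum)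
  moreover have "(\<integral>x. (\<Sum>p<k. b p * f p x) + c \<partial>lower_variation Q) =
      (\<Sum>p<k. b p * (\<integral>x. f p x \<partial>lower_variation Q)) + c * measure (lower_variation Q) UNIV"
    using i calculation(1) by (subst Bochner_Integration.integral_add) (auto simp: Bochner_Integration.integral_sum)
  moreover have "c * measure (upper_variation Q) UNIV - c * measure (lower_variation Q) UNIV = c"
    using variation_difference_UNIV[OF Q(1)] Q(2) by (metis mult.right_neutral right_diff_distrib)
  ultimately show ?thesis
    by (simp add: sm_integral_def sum_subtractf right_diff_distrib)
qed

text \<open>By monotonicity every set is its own best competitor, so the upper variation of P is P
  and the lower one vanishes. Under H0 this turns integrals against Q0 into means under P.\<close>

lemma sm_integral_measure:
  fixes P :: "'a::topological_space measure"
  assumes P: "finite_measure P" "sets P = sets borel"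
  shows "sm_integral (measure P) g = (\<integral>x. g x \<partial>P)"
proof -
  interpret finite_measure P by fact
  have sp: "space P = UNIV" using sets_eq_imp_space_eq[OF P(2)] by simp
  have Q: "signed_measure (measure P)"
    unfolding signed_measure_def using P(2) by (auto intro!: finite_measure_UNION)
  have "upper_variation (measure P) = P"
  proof (rule measure_eqI)
    fix A assume "A \<in> sets (upper_variation (measure P))"
    hence A: "A \<in> sets borel" by simp
    have "(SUP B\<in>{B \<in> sets borel. B \<subseteq> A}. ennreal (measure P B)) = ennreal (measure P A)"
      using A P(2) by (intro antisym SUP_least SUP_upper ennreal_leI finite_measure_mono) auto
    thus "emeasure (upper_variation (measure P)) A = emeasure P A"
      using emeasure_upper_variation[OF Q A] by (simp add: emeasure_eq_measure)
  qed (simp add: P)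
  moreover have "lower_variation (measure P) = null_measure borel"
  proof (rule measure_eqI)
    fix A assume "A \<in> sets (lower_variation (measure P))"
    hence A: "A \<in> sets borel" by (simp add: lower_variation_def)
    have "emeasure (lower_variation (measure P)) A = (SUP B\<in>{B \<in> sets borel. B \<subseteq> A}. ennreal (- measure P B))"
      unfolding lower_variation_def by (rule emeasure_upper_variation[OF signed_measure_uminus[OF Q] A])
    also have "\<dots> = 0" by (intro antisym SUP_least) (auto simp: ennreal_neg)
    finally show "emeasure (lower_variation (measure P)) A = emeasure (null_measure borel) A" by simp
  qed (simp add: lower_variation_def)
  ultimately show ?thesis by (simp add: sm_integral_def)
qed

section \<open>Gaussian vectors\<close>

lemma prob_space_std_normal: "prob_space std_normal_distribution"
  by (simp add: prob_space_normal_density)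

text \<open>Writing every normal law, the degenerate ones included, as an affine image of the
  standard one reduces all moments and characteristic functions to the known ones.\<close>

lemma normal_law_eq_distr:
  assumes "s \<ge> 0"
  shows "normal_law m s = distr std_normal_distribution borel (\<lambda>x. m + s * x)"
proof -
  interpret prob_space std_normal_distribution by (rule prob_space_std_normal)
  show ?thesis
  proof (cases "s = 0")
    case True
    thus ?thesis by (simp add: normal_law_def)
  next
    case False
    hence s: "s > 0" using assms by simp
    have "distributed std_normal_distribution lborel (\<lambda>x. x) std_normal_density"
      by (auto simp: distributed_def intro!: distr_id2)
    from normal_density_affine[OF this, of s m]
    have "distr std_normal_distribution lborel (\<lambda>x. m + s * x) = density lborel (normal_density m s)"
      using s by (simp add: distributed_def)
    moreover have "distr std_normal_distribution lborel (\<lambda>x. m + s * x) =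
        distr std_normal_distribution borel (\<lambda>x. m + s * x)"
      by (rule distr_cong) auto
    ultimately show ?thesis using s by (simp add: normal_law_def)
  qed
qed

lemma normal_law_transfer:
  fixes h :: "real \<Rightarrow> 'b::{banach, second_countable_topology}"
  assumes Z: "Z \<in> borel_measurable N" "distr N borel Z = normal_law m s" "s \<ge> 0"
    and h: "h \<in> borel_measurable borel"
  shows "integrable N (\<lambda>w. h (Z w)) \<longleftrightarrow> integrable std_normal_distribution (\<lambda>x. h (m + s * x))"
    and "(\<integral>w. h (Z w) \<partial>N) = (\<integral>x. h (m + s * x) \<partial>std_normal_distribution)"
proof -
  have *: "distr N borel Z = distr std_normal_distribution borel (\<lambda>x. m + s * x)"
    using Z normal_law_eq_distr by simp
  have "integrable N (\<lambda>w. h (Z w)) \<longleftrightarrow> integrable (distr N borel Z) h"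
    using Z h by (intro integrable_distr_eq[symmetric]) auto
  also have "\<dots> \<longleftrightarrow> integrable std_normal_distribution (\<lambda>x. h (m + s * x))"
    unfolding * using h by (intro integrable_distr_eq) auto
  finally show "integrable N (\<lambda>w. h (Z w)) \<longleftrightarrow> integrable std_normal_distribution (\<lambda>x. h (m + s * x))" .
  have "(\<integral>w. h (Z w) \<partial>N) = integral\<^sup>L (distr N borel Z) h"
    using Z h by (intro integral_distr[symmetric]) auto
  also have "\<dots> = (\<integral>x. h (m + s * x) \<partial>std_normal_distribution)"
    unfolding * using h by (intro integral_distr) auto
  finally show "(\<integral>w. h (Z w) \<partial>N) = (\<integral>x. h (m + s * x) \<partial>std_normal_distribution)" .
qed

text \<open>The standard density stays below 1/2 because 2 * pi >= 4, and the interval has length 2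
  * r.\<close>

lemma std_normal_small_ball:
  assumes "r \<ge> 0"
  shows "measure std_normal_distribution {-r..r} \<le> r"
proof -
  interpret prob_space std_normal_distribution by (rule prob_space_std_normal)
  have "emeasure std_normal_distribution {-r..r}
      = (\<integral>\<^sup>+x. ennreal (std_normal_density x) * indicator {-r..r} x \<partial>lborel)"
    by (intro emeasure_density) auto
  also have "\<dots> \<le> (\<integral>\<^sup>+x. ennreal (1 / 2) * indicator {-r..r} x \<partial>lborel)"
  proof (intro nn_integral_mono mult_right_mono ennreal_leI)
    fix x :: real
    have "2 \<le> sqrt (2 * pi)" using pi_ge_two by (intro real_le_rsqrt) simp
    hence "1 / sqrt (2 * pi) \<le> 1 / 2" by (intro divide_left_mono) auto
    moreover have "exp (- x\<^sup>2 / 2) \<le> 1" by simp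
    ultimately have "1 / sqrt (2 * pi) * exp (- x\<^sup>2 / 2) \<le> 1 / 2 * 1" by (intro mult_mono) auto
    thus "std_normal_density x \<le> 1 / 2" by (simp add: std_normal_density_def)
  qed auto
  also have "\<dots> = ennreal (1 / 2) * ennreal (2 * r)"
    using assms by (subst nn_integral_cmult_indicator) auto
  also have "\<dots> = ennreal r" using assms by (subst ennreal_mult[symmetric]) auto
  finally show ?thesis using assms by (simp add: emeasure_eq_measure)
qed

context
  fixes N :: "'b measure" and Z :: "'b \<Rightarrow> real" and m s :: real
  assumes Z: "Z \<in> borel_measurable N" "distr N borel Z = normal_law m s" "s \<ge> 0"
    and mean: "(\<integral>w. Z w \<partial>N) = 0"
begin

interpretation G: prob_space std_normal_distribution by (rule prob_space_std_normal)

lemma normal_law_centred: "m = 0"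
proof -
  have "(\<integral>w. Z w \<partial>N) = (\<integral>x. m + s * x \<partial>std_normal_distribution)"
    by (rule normal_law_transfer(2)[OF Z]) simp
  also have "\<dots> = m"
    using integrable_std_normal_distribution_moment[of 1] integral_std_normal_distribution_moment_odd[of 1]
    by (simp add: G.prob_space[simplified])
  finally show ?thesis using mean by simp
qed

lemma normal_law_integrable_power: "integrable N (\<lambda>w. Z w ^ j)"
  unfolding normal_law_transfer(1)[OF Z, of "\<lambda>x. x ^ j", simplified]
  using integrable_std_normal_distribution_moment[of j]
  by (simp add: normal_law_centred power_mult_distrib)

lemma normal_law_second_moment: "(\<integral>w. (Z w)\<^sup>2 \<partial>N) = s\<^sup>2"
  using normal_law_transfer(2)[OF Z, of "\<lambda>x. x\<^sup>2"] std_normal_distribution_even_moments(1)[of 1]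
  by (simp add: normal_law_centred power_mult_distrib)

lemma normal_law_fourth_moment: "(\<integral>w. Z w ^ 4 \<partial>N) = 3 * s ^ 4"
  using normal_law_transfer(2)[OF Z, of "\<lambda>x. x ^ 4"] std_normal_distribution_even_moments(1)[of 2]
  by (simp add: normal_law_centred power_mult_distrib fact_numeral)

lemma normal_law_char: "(CLINT w|N. iexp (Z w)) = complex_of_real (exp (- s\<^sup>2 / 2))"
proof -
  have "(CLINT w|N. iexp (Z w)) = (CLINT x|std_normal_distribution. iexp (m + s * x))"
    by (rule normal_law_transfer(2)[OF Z]) simp
  also have "\<dots> = char std_normal_distribution s"
    by (simp add: normal_law_centred char_def)
  finally show ?thesis by (simp add: char_std_normal_distribution)
qed

text \<open>The product form includes s = 0. A lower bound on the probability of staying within c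
  becomes an upper bound on the standard deviation.\<close>

lemma normal_law_small_ball:
  assumes "c \<ge> 0"
  shows "s * measure N {w \<in> space N. \<bar>Z w\<bar> \<le> c} \<le> c"
proof (cases "s = 0")
  case False
  hence s: "s > 0" using Z by simp
  have "measure N {w \<in> space N. \<bar>Z w\<bar> \<le> c} = measure (distr N borel Z) {-c..c}"
    using Z by (subst measure_distr) (auto intro!: arg_cong[where f="measure N"])
  also have "\<dots> = measure std_normal_distribution {x. s * x \<in> {-c..c}}"
    unfolding Z(2) normal_law_eq_distr[OF Z(3)]
    by (subst measure_distr) (auto simp: normal_law_centred vimage_def)
  also have "{x. s * x \<in> {-c..c}} = {-(c/s)..c/s}" using s by (auto simp: field_simps)
  finally show ?thesis using std_normal_small_ball[of "c / s"] assms s by (simp add: field_simps)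
qed (use assms in simp)

end

text \<open>Integrating \<open>exp (\<i> \<sigma> \<langle>Y', Y\<rangle>)\<close> over the product space in either order gives the Laplace
  transforms of the two squared norms.\<close>

lemma laplace_sq_norm_eq:
  fixes Y :: "nat \<Rightarrow> 'b \<Rightarrow> real" and Y' :: "nat \<Rightarrow> 'c \<Rightarrow> real" and k :: nat
  assumes N: "prob_space N" "prob_space N'"
    and Y: "\<And>i. i < k \<Longrightarrow> Y i \<in> borel_measurable N" "\<And>i. i < k \<Longrightarrow> Y' i \<in> borel_measurable N'"
    and char: "\<And>a. (CLINT w|N. iexp (\<Sum>i<k. a i * Y i w)) = complex_of_real (exp (- (\<Sum>i<k. (a i)\<^sup>2) / 2))"
    and char': "\<And>a. (CLINT w|N'. iexp (\<Sum>i<k. a i * Y' i w)) = complex_of_real (exp (- (\<Sum>i<k. (a i)\<^sup>2) / 2))"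
  shows "(\<integral>w. exp (- (\<Sum>i<k. (\<sigma> * Y i w)\<^sup>2) / 2) \<partial>N) = (\<integral>w. exp (- (\<Sum>i<k. (\<sigma> * Y' i w)\<^sup>2) / 2) \<partial>N')"
proof -
  interpret A: prob_space N by fact
  interpret B: prob_space N' by fact
  interpret AB: pair_prob_space N N' ..
  note [measurable] = Y
  define g where "g = (\<lambda>w w'. iexp (\<Sum>i<k. \<sigma> * Y' i w' * Y i w))"
  have "integrable (N \<Otimes>\<^sub>M N') (case_prod g)"
    unfolding g_def by (intro AB.P.integrable_const_bound[of _ 1]) (auto simp: split_beta')
  hence "(\<integral>w'. (\<integral>w. g w w' \<partial>N) \<partial>N') = (\<integral>w. (\<integral>w'. g w w' \<partial>N') \<partial>N)"
    by (rule AB.Fubini_integral)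
  moreover have "(\<integral>w. g w w' \<partial>N) = complex_of_real (exp (- (\<Sum>i<k. (\<sigma> * Y' i w')\<^sup>2) / 2))" for w'
    unfolding g_def using char[of "\<lambda>i. \<sigma> * Y' i w'"] by simp
  moreover have "(\<integral>w'. g w w' \<partial>N') = complex_of_real (exp (- (\<Sum>i<k. (\<sigma> * Y i w)\<^sup>2) / 2))" for w
    unfolding g_def using char'[of "\<lambda>i. \<sigma> * Y i w"] by (simp add: mult_ac)
  ultimately show ?thesis by (simp only: integral_complex_of_real of_real_eq_iff)
qed

text \<open>Termwise integration of the exponential series, dominated by the series of exp |t|.
  Hence variables bounded by 1 with equal moments have equal characteristic functions.\<close>

lemma char_moment_series:
  assumes N: "prob_space N" and U[measurable]: "U \<in> borel_measurable N"
    and bd: "\<And>w. \<bar>U w\<bar> \<le> 1"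
  shows "char (distr N borel U) t = (\<Sum>j. (\<i> * complex_of_real t) ^ j /\<^sub>R fact j * complex_of_real (\<integral>w. U w ^ j \<partial>N))"
proof -
  interpret prob_space N by fact
  define f where "f = (\<lambda>j w. (\<i> * complex_of_real (t * U w)) ^ j /\<^sub>R fact j)"
  have f: "f j w = ((\<i> * complex_of_real t) ^ j /\<^sub>R fact j) * complex_of_real (U w ^ j)" for j w
    by (simp add: f_def power_mult_distrib)
  have fb: "norm (f j w) \<le> \<bar>t\<bar> ^ j /\<^sub>R fact j" for j w
  proof -
    have "\<bar>t * U w\<bar> ^ j \<le> (\<bar>t\<bar> * 1) ^ j" unfolding abs_mult using bd by (intro power_mono mult_left_mono) auto
    thus ?thesis by (simp add: f_def norm_power norm_mult divide_simps flip: power_abs abs_mult)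
  qed
  have fm[measurable]: "f j \<in> borel_measurable N" for j unfolding f_def by measurable
  have int: "integrable N (f j)" for j
    using fb by (intro integrable_const_bound[of _ "\<bar>t\<bar> ^ j /\<^sub>R fact j"]) auto
  have sm: "summable (\<lambda>j. \<bar>t\<bar> ^ j /\<^sub>R fact j)" by (rule summable_exp_generic)
  have s1: "summable (\<lambda>j. norm (f j w))" for w
    by (rule summable_comparison_test'[OF sm]) (use fb in auto)
  have s2: "summable (\<lambda>j. \<integral>w. norm (f j w) \<partial>N)"
  proof (rule summable_comparison_test'[OF sm])
    fix j
    have "(\<integral>w. norm (f j w) \<partial>N) \<le> (\<integral>w. \<bar>t\<bar> ^ j /\<^sub>R fact j \<partial>N)"
      using int fb by (intro integral_mono) auto
    thus "norm (\<integral>w. norm (f j w) \<partial>N) \<le> \<bar>t\<bar> ^ j /\<^sub>R fact j" by (simp add: prob_space)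
  qed
  have "char (distr N borel U) t = (\<integral>w. (\<Sum>j. f j w) \<partial>N)"
    unfolding char_def f_def exp_def by (subst integral_distr) (auto simp flip: exp_def)
  also have "\<dots> = (\<Sum>j. integral\<^sup>L N (f j))"
    using s1 by (intro integral_suminf[OF int _ s2]) auto
  also have "\<dots> = (\<Sum>j. (\<i> * complex_of_real t) ^ j /\<^sub>R fact j * complex_of_real (\<integral>w. U w ^ j \<partial>N))"
  proof (intro arg_cong[where f = suminf] ext)
    fix j
    have "integral\<^sup>L N (f j) = (\<integral>w. ((\<i> * complex_of_real t) ^ j /\<^sub>R fact j) * complex_of_real (U w ^ j) \<partial>N)"
      by (intro Bochner_Integration.integral_cong refl f)
    thus "integral\<^sup>L N (f j) = (\<i> * complex_of_real t) ^ j /\<^sub>R fact j * complex_of_real (\<integral>w. U w ^ j \<partial>N)"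
      by (simp only: Bochner_Integration.integral_mult_right_zero integral_complex_of_real)
  qed
  finally show ?thesis .
qed

text \<open>The variable exp(-|Y|^2 / 2) lies in (0, 1], so its moments determine its law. Its j-th
  moment is the Laplace transform treated in \<open>laplace_sq_norm_eq\<close>, with \<sigma> = sqrt
  j.\<close>

lemma law_sq_norm_eq:
  fixes Y :: "nat \<Rightarrow> 'b \<Rightarrow> real" and Y' :: "nat \<Rightarrow> 'c \<Rightarrow> real" and k :: nat
  assumes N: "prob_space N" "prob_space N'"
    and Y: "\<And>i. i < k \<Longrightarrow> Y i \<in> borel_measurable N" "\<And>i. i < k \<Longrightarrow> Y' i \<in> borel_measurable N'"
    and char: "\<And>a. (CLINT w|N. iexp (\<Sum>i<k. a i * Y i w)) = complex_of_real (exp (- (\<Sum>i<k. (a i)\<^sup>2) / 2))"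
    and char': "\<And>a. (CLINT w|N'. iexp (\<Sum>i<k. a i * Y' i w)) = complex_of_real (exp (- (\<Sum>i<k. (a i)\<^sup>2) / 2))"
  shows "measure N {w \<in> space N. (\<Sum>i<k. (Y i w)\<^sup>2) \<le> y} = measure N' {w \<in> space N'. (\<Sum>i<k. (Y' i w)\<^sup>2) \<le> y}"
proof -
  interpret A: prob_space N by fact
  interpret B: prob_space N' by fact
  note [measurable] = Y
  define U where "U = (\<lambda>w. exp (- (\<Sum>i<k. (Y i w)\<^sup>2) / 2))"
  define U' where "U' = (\<lambda>w. exp (- (\<Sum>i<k. (Y' i w)\<^sup>2) / 2))"
  have [measurable]: "U \<in> borel_measurable N" "U' \<in> borel_measurable N'" by (simp_all add: U_def U'_def)
  have bd: "\<bar>U w\<bar> \<le> 1" "\<bar>U' w'\<bar> \<le> 1" for w w' by (auto simp: U_def U'_def intro!: sum_nonneg)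
  have pw: "exp (- (\<Sum>i<k. (y i)\<^sup>2) / 2) ^ j = exp (- (\<Sum>i<k. (sqrt (real j) * y i)\<^sup>2) / 2)"
    for y :: "nat \<Rightarrow> real" and j :: nat
    by (simp add: exp_of_nat_mult[symmetric] power_mult_distrib flip: sum_distrib_left)
  have "(\<integral>w. U w ^ j \<partial>N) = (\<integral>w. U' w ^ j \<partial>N')" for j
    unfolding U_def U'_def pw by (rule laplace_sq_norm_eq[OF N Y char char'])
  hence "char (distr N borel U) = char (distr N' borel U')"
    by (intro ext) (simp add: char_moment_series[OF N(1) _ bd(1)] char_moment_series[OF N(2) _ bd(2)])
  hence eq: "distr N borel U = distr N' borel U'"
    by (intro Levy_uniqueness A.real_distribution_distr B.real_distribution_distr) auto
  \<comment> \<open>The transformation is decreasing, so an upper bound on the squared norm is a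
    lower bound on \<open>U\<close>.\<close>
  have "measure N {w \<in> space N. (\<Sum>i<k. (Y i w)\<^sup>2) \<le> y} = measure (distr N borel U) {exp (- y / 2)..}"
    by (subst measure_distr) (auto simp: U_def intro!: arg_cong[where f="measure N"])
  also have "\<dots> = measure N' {w \<in> space N'. (\<Sum>i<k. (Y' i w)\<^sup>2) \<le> y}"
    unfolding eq by (subst measure_distr) (auto simp: U'_def intro!: arg_cong[where f="measure N'"])
  finally show ?thesis .
qed

section \<open>Central limit theorem for squared Gaussian norms\<close>

definition gauss_seq :: "(nat \<Rightarrow> real) measure"
  where "gauss_seq = Pi\<^sub>M UNIV (\<lambda>_. std_normal_distribution)"

lemma prob_space_gauss_seq: "prob_space gauss_seq"
  unfolding gauss_seq_def by (intro prob_space_PiM prob_space_std_normal)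

lemma gauss_seq_component:
  "(\<lambda>w. w i) \<in> borel_measurable gauss_seq" "distr gauss_seq borel (\<lambda>w. w i) = std_normal_distribution"
proof -
  interpret product_prob_space "\<lambda>_::nat. std_normal_distribution" UNIV
    by (intro product_prob_spaceI prob_space_std_normal)
  have "(\<lambda>w. w i) \<in> gauss_seq \<rightarrow>\<^sub>M std_normal_distribution"
    unfolding gauss_seq_def by (rule measurable_component_singleton) simp
  thus "(\<lambda>w. w i) \<in> borel_measurable gauss_seq"
    by (simp cong: measurable_cong_sets)
  have "distr gauss_seq borel (\<lambda>w. w i) = distr gauss_seq std_normal_distribution (\<lambda>w. w i)"
    by (rule distr_cong) auto
  thus "distr gauss_seq borel (\<lambda>w. w i) = std_normal_distribution"
    unfolding gauss_seq_def by (simp add: PiM_component)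
qed

lemma gauss_seq_indep: "prob_space.indep_vars gauss_seq (\<lambda>_. borel) (\<lambda>i w. w i) UNIV"
proof -
  interpret prob_space gauss_seq by (rule prob_space_gauss_seq)
  have s: "sets gauss_seq = sets (Pi\<^sub>M UNIV (\<lambda>_. borel))"
    unfolding gauss_seq_def by (intro sets_PiM_cong) auto
  have "distr gauss_seq (Pi\<^sub>M UNIV (\<lambda>_. borel)) (\<lambda>x. \<lambda>i\<in>UNIV. x i) = gauss_seq"
    using s[symmetric] by (simp add: restrict_def distr_id2)
  also have "\<dots> = Pi\<^sub>M UNIV (\<lambda>i. distr gauss_seq borel (\<lambda>w. w i))"
    by (simp add: gauss_seq_component) (simp add: gauss_seq_def)
  finally show ?thesis
    by (subst indep_vars_iff_distr_eq_PiM) (auto simp: gauss_seq_component)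
qed

lemma gauss_seq_char:
  fixes k :: nat
  shows "(CLINT w|gauss_seq. iexp (\<Sum>i<k. a i * w i)) = complex_of_real (exp (- (\<Sum>i<k. (a i)\<^sup>2) / 2))"
proof -
  interpret prob_space gauss_seq by (rule prob_space_gauss_seq)
  have ind: "indep_vars (\<lambda>_. borel) (\<lambda>i w. iexp (a i * w i)) {..<k}"
    by (rule indep_vars_compose2[OF indep_vars_subset[OF gauss_seq_indep]]) auto
  have "(CLINT w|gauss_seq. iexp (\<Sum>i<k. a i * w i)) = (CLINT w|gauss_seq. (\<Prod>i<k. iexp (a i * w i)))"
    by (simp add: exp_sum sum_distrib_left)
  also have "\<dots> = (\<Prod>i<k. CLINT w|gauss_seq. iexp (a i * w i))"
    using gauss_seq_component by (intro indep_vars_lebesgue_integral ind) (auto intro!: integrable_const_bound[of _ 1])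
  also have "\<dots> = (\<Prod>i<k. char std_normal_distribution (a i))"
  proof (intro prod.cong refl)
    fix i
    show "(CLINT w|gauss_seq. iexp (a i * w i)) = char std_normal_distribution (a i)"
      unfolding gauss_seq_component(2)[of i, symmetric] char_def
      by (subst integral_distr) (auto simp: gauss_seq_component)
  qed
  also have "\<dots> = (\<Prod>i<k. complex_of_real (exp (- (a i)\<^sup>2 / 2)))" by (simp add: char_std_normal_distribution)
  also have "\<dots> = complex_of_real (exp (\<Sum>i<k. - (a i)\<^sup>2 / 2))" by (simp add: exp_sum flip: of_real_prod)
  also have "(\<Sum>i<k. - (a i)\<^sup>2 / 2) = - (\<Sum>i<k. (a i)\<^sup>2) / 2" by (simp add: sum_negf sum_divide_distrib)
  finally show ?thesis .
qed

lemma isCont_cdf_std_normal: "isCont (cdf std_normal_distribution) x"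
proof -
  interpret real_distribution std_normal_distribution by (rule real_dist_normal_dist)
  have "emeasure std_normal_distribution {x} = (\<integral>\<^sup>+y. ennreal (std_normal_density y) * indicator {x} y \<partial>lborel)"
    by (intro emeasure_density) auto
  also have "\<dots> = 0" by (intro nn_integral_null_set) (auto simp: null_sets_def)
  finally show ?thesis by (simp add: isCont_cdf measure_def)
qed

text \<open>The squares have mean 1 and variance 3 - 1 = 2, which is the source of the norming sqrt
  (2 k).\<close>

lemma chi_square_clt:
  "(\<lambda>k. measure gauss_seq {w \<in> space gauss_seq. ((\<Sum>i<k. (w i)\<^sup>2) - real k) / sqrt (2 * real k) \<le> x})
    \<longlonglongrightarrow> cdf std_normal_distribution x"
proof -
  interpret prob_space gauss_seq by (rule prob_space_gauss_seq)
  note [measurable] = gauss_seq_component(1)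
  have mom: "integrable gauss_seq (\<lambda>w. w i ^ (2 * j))"
    "(\<integral>w. w i ^ (2 * j) \<partial>gauss_seq) = fact (2 * j) / (2 ^ j * fact j)" for i j
    using std_normal_distribution_even_moments[of j] unfolding gauss_seq_component(2)[of i, symmetric]
    by (simp_all add: integrable_distr_eq integral_distr)
  have m2: "integrable gauss_seq (\<lambda>w. (w i)\<^sup>2)" "(\<integral>w. (w i)\<^sup>2 \<partial>gauss_seq) = 1" for i
    using mom[of i 1] by simp_all
  have m4: "integrable gauss_seq (\<lambda>w. ((w i)\<^sup>2)\<^sup>2)" "(\<integral>w. ((w i)\<^sup>2)\<^sup>2 \<partial>gauss_seq) = 3" for i
    using mom[of i 2] by (simp_all add: fact_numeral)
  have "weak_conv_m (\<lambda>n. distr gauss_seq borel (\<lambda>w. (\<Sum>i<n. (w i)\<^sup>2 - 1) / sqrt (n * (sqrt 2)\<^sup>2))) std_normal_distribution"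
  proof (rule central_limit_theorem)
    show "indep_vars (\<lambda>i. borel) (\<lambda>i w. (w i)\<^sup>2) UNIV"
      by (rule indep_vars_compose2[OF gauss_seq_indep]) auto
    show "variance (\<lambda>w. (w i)\<^sup>2) = (sqrt 2)\<^sup>2" for i
      using m2 m4 by (subst variance_eq) auto
    show "distr gauss_seq borel (\<lambda>w. (w i)\<^sup>2) = distr std_normal_distribution borel (\<lambda>x. x\<^sup>2)" for i
      unfolding gauss_seq_component(2)[of i, symmetric] by (subst distr_distr) (auto simp: comp_def)
  qed (use m2 m4 in auto)
  hence "(\<lambda>n. cdf (distr gauss_seq borel (\<lambda>w. (\<Sum>i<n. (w i)\<^sup>2 - 1) / sqrt (n * (sqrt 2)\<^sup>2))) x)
      \<longlonglongrightarrow> cdf std_normal_distribution x"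
    using isCont_cdf_std_normal unfolding weak_conv_m_def weak_conv_def by blast
  moreover have "cdf (distr gauss_seq borel (\<lambda>w. (\<Sum>i<n. (w i)\<^sup>2 - 1) / sqrt (n * (sqrt 2)\<^sup>2))) x =
      measure gauss_seq {w \<in> space gauss_seq. ((\<Sum>i<n. (w i)\<^sup>2) - real n) / sqrt (2 * real n) \<le> x}" for n
    unfolding cdf_def
    by (subst measure_distr) (auto intro!: arg_cong[where f="measure gauss_seq"] simp: sum_subtractf mult.commute)
  ultimately show ?thesis by simp
qed

text \<open>Space and dimension vary with n, and the vectors are given only through characteristic
  functions of linear combinations. As these fix the law of the squared norm, it agrees with that of
  a partial sum over \<open>gauss_seq\<close>, and the limit along \<open>k n\<close> follows by
  composition.\<close>

lemma gaussian_vector_clt: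
  fixes k :: "nat \<Rightarrow> nat" and Y :: "nat \<Rightarrow> nat \<Rightarrow> 'b \<Rightarrow> real"
  assumes "eventually (\<lambda>n. prob_space (N n) \<and> (\<forall>i<k n. Y n i \<in> borel_measurable (N n)) \<and>
      (\<forall>a. (CLINT w|N n. iexp (\<Sum>i<k n. a i * Y n i w)) = complex_of_real (exp (- (\<Sum>i<k n. (a i)\<^sup>2) / 2)))) sequentially"
    and "filterlim k at_top sequentially"
  shows "(\<lambda>n. measure (N n) {w \<in> space (N n). ((\<Sum>i<k n. (Y n i w)\<^sup>2) - real (k n)) / sqrt (2 * real (k n)) \<le> x})
    \<longlonglongrightarrow> cdf std_normal_distribution x"
proof (rule Lim_transform_eventually)
  show "(\<lambda>n. measure gauss_seq {w \<in> space gauss_seq. ((\<Sum>i<k n. (w i)\<^sup>2) - real (k n)) / sqrt (2 * real (k n)) \<le> x})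
    \<longlonglongrightarrow> cdf std_normal_distribution x"
    by (rule filterlim_compose[OF chi_square_clt assms(2)])
  have "eventually (\<lambda>n. k n > 0) sequentially"
    using assms(2) unfolding filterlim_at_top by (auto dest: spec[of _ 1] simp: Suc_le_eq)
  with assms(1) show "eventually (\<lambda>n. measure gauss_seq {w \<in> space gauss_seq. ((\<Sum>i<k n. (w i)\<^sup>2) - real (k n)) / sqrt (2 * real (k n)) \<le> x}
    = measure (N n) {w \<in> space (N n). ((\<Sum>i<k n. (Y n i w)\<^sup>2) - real (k n)) / sqrt (2 * real (k n)) \<le> x}) sequentially"
  proof eventually_elim
    \<comment> \<open>Positivity of \<open>k n\<close> turns the standardised event into an event on
      the squared norm itself, the form in which the laws were compared.\<close>
    case (elim n)
    have *: "(S - real (k n)) / sqrt (2 * real (k n)) \<le> x \<longleftrightarrow> S \<le> real (k n) + x * sqrt (2 * real (k n))" for S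
      using elim(2) by (simp add: divide_le_eq algebra_simps)
    show ?case unfolding * using elim
      by (intro law_sq_norm_eq prob_space_gauss_seq gauss_seq_component gauss_seq_char) auto
  qed
qed

section \<open>Samples\<close>

lemma integrable_mult_of_squares:
  fixes f g :: "'b \<Rightarrow> real"
  assumes [measurable]: "f \<in> borel_measurable N" "g \<in> borel_measurable N"
    and "integrable N (\<lambda>w. (f w)\<^sup>2)" "integrable N (\<lambda>w. (g w)\<^sup>2)"
  shows "integrable N (\<lambda>w. f w * g w)"
proof (rule Bochner_Integration.integrable_bound)
  show "integrable N (\<lambda>w. (f w)\<^sup>2 + (g w)\<^sup>2)" using assms by simp
  show "AE w in N. norm (f w * g w) \<le> norm ((f w)\<^sup>2 + (g w)\<^sup>2)"
  proof (intro AE_I2)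
    fix w
    have "2 * \<bar>f w\<bar> * \<bar>g w\<bar> \<le> \<bar>f w\<bar>\<^sup>2 + \<bar>g w\<bar>\<^sup>2" by (rule sum_squares_bound)
    moreover have "0 \<le> \<bar>f w\<bar> * \<bar>g w\<bar>" by simp
    ultimately show "norm (f w * g w) \<le> norm ((f w)\<^sup>2 + (g w)\<^sup>2)"
      unfolding real_norm_def abs_mult power2_abs by linarith
  qed
qed simp

lemma iid_sampleD:
  assumes "iid_sample M P X"
  shows "prob_space M" "prob_space.indep_vars M (\<lambda>_. borel) X UNIV"
    "X i \<in> borel_measurable M" "distr M borel (X i) = P"
  using assms prob_space.indep_vars_def2[of M "\<lambda>_. borel" X UNIV] by (auto simp: iid_sample_def)

lemma iid_sample_integral:
  fixes h :: "'a::topological_space \<Rightarrow> real"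
  assumes "iid_sample M P X" and h: "h \<in> borel_measurable borel"
  shows "(\<integral>w. h (X i w) \<partial>M) = (\<integral>x. h x \<partial>P)"
    and "integrable M (\<lambda>w. h (X i w)) \<longleftrightarrow> integrable P h"
  unfolding iid_sampleD(4)[OF assms(1), of i, symmetric]
  using iid_sampleD(3)[OF assms(1)] h by (simp_all add: integral_distr integrable_distr_eq)

text \<open>The law of the whole sequence is a product of copies of P, hence the same on every
  space. This lets a limit law pass from the coupling spaces to the given one.\<close>

lemma iid_sample_law:
  assumes X: "iid_sample M P X" and S: "S \<in> sets (Pi\<^sub>M UNIV (\<lambda>_. borel))"
  shows "measure M {w \<in> space M. (\<lambda>i. X i w) \<in> S} = measure (Pi\<^sub>M UNIV (\<lambda>_. P)) S"
proof -
  interpret prob_space M by (rule iid_sampleD[OF X])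
  note [measurable] = iid_sampleD(3)[OF X]
  have "distr M (Pi\<^sub>M UNIV (\<lambda>_. borel)) (\<lambda>w. \<lambda>i\<in>UNIV. X i w) = Pi\<^sub>M UNIV (\<lambda>i. distr M borel (X i))"
    using iid_sampleD(2)[OF X] by (subst indep_vars_iff_distr_eq_PiM[symmetric]) auto
  hence *: "distr M (Pi\<^sub>M UNIV (\<lambda>_. borel)) (\<lambda>w i. X i w) = Pi\<^sub>M UNIV (\<lambda>_. P)"
    by (simp add: restrict_def iid_sampleD(4)[OF X])
  show ?thesis unfolding *[symmetric] using S
    by (subst measure_distr) (auto intro!: arg_cong[where f="measure M"] measurable_PiM_single' simp: PiE_UNIV_domain)
qed

text \<open>Independence and centring remove the mixed terms; of the n^2 products only the n
  diagonal ones remain.\<close>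

lemma iid_sample_mean_square:
  fixes h :: "'a::topological_space \<Rightarrow> real"
  assumes X: "iid_sample M P X" and h[measurable]: "h \<in> borel_measurable borel"
    and sq: "integrable P (\<lambda>x. (h x)\<^sup>2)" and zero: "(\<integral>x. h x \<partial>P) = 0" and n: "n \<ge> 1"
  shows "integrable M (\<lambda>w. (emp n (\<lambda>i. X i w) h)\<^sup>2)"
    and "(\<integral>w. (emp n (\<lambda>i. X i w) h)\<^sup>2 \<partial>M) = (\<integral>x. (h x)\<^sup>2 \<partial>P) / real n"
proof -
  interpret prob_space M by (rule iid_sampleD[OF X])
  note [measurable] = iid_sampleD(3)[OF X]
  define H where "H = (\<lambda>i w. h (X i w))"
  have [measurable]: "H i \<in> borel_measurable M" for i by (simp add: H_def)
  have sqi: "integrable M (\<lambda>w. (H i w)\<^sup>2)" "(\<integral>w. (H i w)\<^sup>2 \<partial>M) = (\<integral>x. (h x)\<^sup>2 \<partial>P)" for i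
    using iid_sample_integral[OF X, of "\<lambda>x. (h x)\<^sup>2" i] sq by (auto simp: H_def)
  have Hi: "integrable M (H i)" for i
    by (rule square_integrable_imp_integrable[OF _ sqi(1)]) simp
  have H0: "(\<integral>w. H i w \<partial>M) = 0" for i
    using iid_sample_integral(1)[OF X h] zero by (simp add: H_def)
  have ii: "integrable M (\<lambda>w. H i w * H j w)" for i j
    by (intro integrable_mult_of_squares sqi) auto
  have ij: "(\<integral>w. H i w * H j w \<partial>M) = (if i = j then (\<integral>x. (h x)\<^sup>2 \<partial>P) else 0)" for i j
  proof (cases "i = j")
    case True
    thus ?thesis using sqi by (simp add: power2_eq_square)
  next
    case False
    have ind: "indep_vars (\<lambda>_. borel) H {i, j}" unfolding H_def
      by (rule indep_vars_compose2[OF indep_vars_subset[OF iid_sampleD(2)[OF X]]]) auto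
    have "(\<integral>w. (\<Prod>l\<in>{i, j}. H l w) \<partial>M) = (\<Prod>l\<in>{i, j}. \<integral>w. H l w \<partial>M)"
      by (intro indep_vars_lebesgue_integral ind) (auto simp: Hi)
    thus ?thesis using False H0 by simp
  qed
  have *: "(emp n (\<lambda>i. X i w) h)\<^sup>2 = (\<Sum>i<n. \<Sum>j<n. H i w * H j w) / (real n)\<^sup>2" for w
    by (simp add: emp_def H_def power_divide power2_eq_square sum_product)
  show "integrable M (\<lambda>w. (emp n (\<lambda>i. X i w) h)\<^sup>2)" unfolding * using ii by auto
  show "(\<integral>w. (emp n (\<lambda>i. X i w) h)\<^sup>2 \<partial>M) = (\<integral>x. (h x)\<^sup>2 \<partial>P) / real n"
    unfolding * using ii n by (simp add: ij Bochner_Integration.integral_sum power2_eq_square)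
qed

section \<open>Bridges\<close>

lemma brownian_bridgeD:
  assumes "brownian_bridge N P F B"
  shows "prob_space N" "g \<in> F \<Longrightarrow> B g \<in> borel_measurable N"
    "g \<in> F \<Longrightarrow> integrable P (\<lambda>x. (g x)\<^sup>2)" "g \<in> F \<Longrightarrow> g \<in> borel_measurable P"
    "g \<in> F \<Longrightarrow> (\<integral>w. B g w \<partial>N) = 0"
    "g \<in> F \<Longrightarrow> h \<in> F \<Longrightarrow> (\<integral>w. B g w * B h w \<partial>N) = cov P g h"
  using assms by (auto simp: brownian_bridge_def gaussian_process_def)

lemma brownian_bridge_marginal:
  assumes B: "brownian_bridge N P F B" and g: "g \<in> F"
  obtains m s where "s \<ge> 0" "distr N borel (B g) = normal_law m s" "s\<^sup>2 = cov P g g"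
proof -
  have "\<exists>m s. s \<ge> 0 \<and> distr N borel (\<lambda>w. \<Sum>j\<in>{g}. 1 * B j w) = normal_law m s"
    using B g unfolding brownian_bridge_def gaussian_process_def
    by (elim conjE allE[of _ "{g}"] allE[of _ "\<lambda>_. 1"]) auto
  then obtain m s where s: "s \<ge> 0" "distr N borel (B g) = normal_law m s" by auto
  have "s\<^sup>2 = cov P g g"
    using normal_law_second_moment[OF brownian_bridgeD(2)[OF B g] s(2,1) brownian_bridgeD(5)[OF B g]]
      brownian_bridgeD(6)[OF B g g] by (simp add: power2_eq_square)
  with s that show ?thesis by blast
qed

lemma brownian_bridge_moments:
  assumes B: "brownian_bridge N P F B" and g: "g \<in> F"
  shows "integrable N (\<lambda>w. B g w ^ j)" and "(\<integral>w. B g w ^ 4 \<partial>N) = 3 * (cov P g g)\<^sup>2"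
proof -
  obtain m s where s: "s \<ge> 0" "distr N borel (B g) = normal_law m s" "s\<^sup>2 = cov P g g"
    using brownian_bridge_marginal[OF B g] .
  note Z = brownian_bridgeD(2)[OF B g] s(2,1) brownian_bridgeD(5)[OF B g]
  show "integrable N (\<lambda>w. B g w ^ j)" by (rule normal_law_integrable_power[OF Z])
  have "s ^ 4 = (s\<^sup>2)\<^sup>2" by simp
  thus "(\<integral>w. B g w ^ 4 \<partial>N) = 3 * (cov P g g)\<^sup>2"
    using normal_law_fourth_moment[OF Z] s(3) by simp
qed

lemma brownian_bridge_char:
  fixes k :: nat
  assumes B: "brownian_bridge N P F B" and f: "inj_on f {..<k}" "f ` {..<k} \<subseteq> F"
  shows "(CLINT w|N. iexp (\<Sum>p<k. b p * B (f p) w)) =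
    complex_of_real (exp (- bil (\<lambda>p q. cov P (f p) (f q)) k b b / 2))"
proof -
  have fF: "f p \<in> F" if "p < k" for p using f(2) that by auto
  define Z where "Z = (\<lambda>w. \<Sum>p<k. b p * B (f p) w)"
  \<comment> \<open>The Gaussian property speaks of finite sets of functions, so the coefficients
    are carried over from indices to functions. Injectivity of f makes this unambiguous.\<close>
  define a where "a = (\<lambda>j. b (inv_into {..<k} f j))"
  have gp: "\<exists>m s. s \<ge> 0 \<and> distr N borel (\<lambda>w. \<Sum>j\<in>J. a j * B j w) = normal_law m s"
    if "finite J" "J \<subseteq> F" for J a
    using B that unfolding brownian_bridge_def gaussian_process_def by blast
  have "(\<lambda>w. \<Sum>j\<in>f ` {..<k}. a j * B j w) = Z"
    unfolding Z_def using f(1) by (intro ext) (simp add: sum.reindex a_def)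
  with gp[of "f ` {..<k}" a] f(2) obtain m s where s: "s \<ge> 0" "distr N borel Z = normal_law m s" by auto
  have Zm: "Z \<in> borel_measurable N"
    unfolding Z_def using brownian_bridgeD(2)[OF B fF] by (intro borel_measurable_sum borel_measurable_times) auto
  have i2: "integrable N (\<lambda>w. B (f p) w * B (f q) w)" if "p < k" "q < k" for p q
    using brownian_bridgeD(2)[OF B fF] brownian_bridge_moments(1)[OF B fF] that
    by (intro integrable_mult_of_squares) auto
  have "(\<integral>w. Z w \<partial>N) = (\<Sum>p<k. b p * (\<integral>w. B (f p) w \<partial>N))"
    unfolding Z_def using brownian_bridge_moments(1)[OF B fF, of _ 1]
    by (subst Bochner_Integration.integral_sum) auto
  hence mean: "(\<integral>w. Z w \<partial>N) = 0" using brownian_bridgeD(5)[OF B fF] by simp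
  have "(Z w)\<^sup>2 = (\<Sum>p<k. \<Sum>q<k. b p * b q * (B (f p) w * B (f q) w))" for w
    unfolding Z_def power2_eq_square sum_product by (simp add: mult_ac)
  hence "(\<integral>w. (Z w)\<^sup>2 \<partial>N) = (\<Sum>p<k. \<integral>w. (\<Sum>q<k. b p * b q * (B (f p) w * B (f q) w)) \<partial>N)"
    using i2 by (simp only:) (intro Bochner_Integration.integral_sum Bochner_Integration.integrable_sum
      integrable_mult_right, auto)
  also have "\<dots> = (\<Sum>p<k. \<Sum>q<k. b p * b q * (\<integral>w. B (f p) w * B (f q) w \<partial>N))"
    using i2 by (intro sum.cong refl) (subst Bochner_Integration.integral_sum, auto)
  also have "\<dots> = bil (\<lambda>p q. cov P (f p) (f q)) k b b"
    unfolding bil_def using brownian_bridgeD(6)[OF B fF fF] by simp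
  finally have "s\<^sup>2 = bil (\<lambda>p q. cov P (f p) (f q)) k b b"
    using normal_law_second_moment[OF Zm s(2,1) mean] by simp
  thus ?thesis using normal_law_char[OF Zm s(2,1) mean] by (simp add: Z_def)
qed

text \<open>Almost surely bounded paths: some level exceeds the whole process with probability at most
  one half, which by the small ball estimate limits the standard deviations.\<close>

lemma pregaussian_variance_bounded:
  assumes "countable F" "pregaussian P F"
  shows "\<exists>V. \<forall>g\<in>F. cov P g g \<le> V"
proof -
  from assms(2) obtain N :: "(('a \<Rightarrow> real) \<Rightarrow> real) measure" and B where B: "brownian_bridge N P F B"
    and bd: "AE w in N. \<exists>C. \<forall>g\<in>F. \<bar>B g w\<bar> \<le> C"
    unfolding pregaussian_def by force
  interpret prob_space N by (rule brownian_bridgeD[OF B])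
  \<comment> \<open>Countability of F makes these events measurable. They increase to an event of
    probability 1, so one of them has probability above 1/2.\<close>
  define A where "A = (\<lambda>m::nat. {w \<in> space N. \<forall>g\<in>F. \<bar>B g w\<bar> \<le> real m})"
  have A[measurable]: "A m \<in> sets N" for m
    unfolding A_def
  proof (rule sets.sets_Collect_countable_All')
    fix g assume "g \<in> F"
    note [measurable] = brownian_bridgeD(2)[OF B this]
    show "{w \<in> space N. \<bar>B g w\<bar> \<le> real m} \<in> sets N" by measurable
  qed fact
  have "incseq A" unfolding A_def
    by (intro incseq_SucI) (auto intro: order_trans)
  hence lim: "(\<lambda>m. prob (A m)) \<longlonglongrightarrow> prob (\<Union>m. A m)"
    using A by (intro finite_Lim_measure_incseq) auto
  have "AE w in N. w \<in> (\<Union>m. A m)"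
    using bd AE_space
  proof eventually_elim
    case (elim w)
    then obtain C where C: "\<And>g. g \<in> F \<Longrightarrow> \<bar>B g w\<bar> \<le> C" by blast
    obtain m :: nat where "C \<le> real m" using real_arch_simple by blast
    hence "w \<in> A m" using C elim(2) by (force simp: A_def)
    thus ?case by blast
  qed
  hence "prob (\<Union>m. A m) = 1" by (subst prob_eq_1) auto
  with lim have "eventually (\<lambda>m. prob (A m) > 1 / 2) sequentially"
    by (intro order_tendstoD(1)[of _ "prob (\<Union>m. A m)"]) auto
  then obtain m where m: "prob (A m) > 1 / 2" by (auto simp: eventually_sequentially)
  have "cov P g g \<le> (2 * real m)\<^sup>2" if g: "g \<in> F" for g
  proof -
    obtain \<mu> s where s: "s \<ge> 0" "distr N borel (B g) = normal_law \<mu> s" "s\<^sup>2 = cov P g g"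
      using brownian_bridge_marginal[OF B g] .
    have [measurable]: "B g \<in> borel_measurable N" by (rule brownian_bridgeD(2)[OF B g])
    have "prob (A m) \<le> prob {w \<in> space N. \<bar>B g w\<bar> \<le> real m}"
      using g by (intro finite_measure_mono) (auto simp: A_def)
    hence "s * (1 / 2) \<le> s * prob {w \<in> space N. \<bar>B g w\<bar> \<le> real m}"
      using m s by (intro mult_left_mono) auto
    also have "\<dots> \<le> real m"
      by (rule normal_law_small_ball[OF _ s(2,1) brownian_bridgeD(5)[OF B g]]) auto
    finally have "s \<le> 2 * real m" by simp
    thus ?thesis unfolding s(3)[symmetric] using s(1) by (intro power_mono)
  qed
  thus ?thesis by blast
qed

text \<open>Slice by the integer part m of |D| / d. On slice m the fourth power is at most L
  exp(\<theta> (m + 1) / 2), while the slice has probability of order exp(-\<theta> m), so a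
  geometric series bounds the moment. The bound is chosen before D, hence uniform over a
  class.\<close>

lemma fourth_moment_of_exponential_tail:
  assumes N: "prob_space N" and d: "d > 0" and \<theta>: "\<theta> > 0" and c: "c \<ge> 0"
  shows "\<exists>K. \<forall>D \<in> borel_measurable N.
    (\<forall>t>0. measure N {w \<in> space N. \<bar>D w\<bar> \<ge> d * t} \<le> c * exp (- \<theta> * t)) \<longrightarrow>
      integrable N (\<lambda>w. D w ^ 4) \<and> (\<integral>w. D w ^ 4 \<partial>N) \<le> K"
proof -
  interpret prob_space N by fact
  \<comment> \<open>From y <= exp y at y = \<theta> |D| / (8 d), raised to the fourth power: |D|^4
    <= L exp(\<theta> |D| / (2 d)). Half of the exponential decay is left over.\<close>
  define L where "L = (8 * d / \<theta>) ^ 4"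
  define u where "u = (\<lambda>m::nat. L * exp (\<theta> / 2 * (real m + 1)) * (max c 1 * exp (- \<theta> * real m)))"
  have L: "L > 0" unfolding L_def using d \<theta> by simp
  have u0: "u m \<ge> 0" for m unfolding u_def using L c by (intro mult_nonneg_nonneg) auto
  have "u m = (L * exp (\<theta> / 2) * max c 1) * exp (- \<theta> / 2) ^ m" for m
  proof -
    have "exp (\<theta> / 2 * (real m + 1)) * exp (- \<theta> * real m) = exp (\<theta> / 2) * exp (- \<theta> / 2) ^ m"
      by (simp add: exp_of_nat_mult[symmetric] exp_add[symmetric] field_simps)
    thus ?thesis by (simp add: u_def mult_ac)
  qed
  hence "u = (\<lambda>m. (L * exp (\<theta> / 2) * max c 1) * exp (- \<theta> / 2) ^ m)" by (rule ext)
  hence su: "summable u" using \<theta> by (simp add: summable_mult summable_geometric)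
  have "integrable N (\<lambda>w. D w ^ 4) \<and> (\<integral>w. D w ^ 4 \<partial>N) \<le> suminf u"
    if [measurable]: "D \<in> borel_measurable N"
      and tail: "\<And>t. t > 0 \<Longrightarrow> measure N {w \<in> space N. \<bar>D w\<bar> \<ge> d * t} \<le> c * exp (- \<theta> * t)" for D
  proof -
    define E where "E = (\<lambda>m::nat. {w \<in> space N. \<bar>D w\<bar> \<ge> d * real m})"
    have [measurable]: "E m \<in> sets N" for m by (simp add: E_def)
    have E: "prob (E m) \<le> max c 1 * exp (- \<theta> * real m)" for m
    \<comment> \<open>The tail hypothesis excludes t = 0; at m = 0 the factor \<open>max c 1\<close>
      bounds any probability.\<close>
    proof (cases "m = 0")
      case True
      thus ?thesis by (simp add: le_max_iff_disj)
    next
      case False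
      hence "prob (E m) \<le> c * exp (- \<theta> * real m)" unfolding E_def by (intro tail) simp
      also have "\<dots> \<le> max c 1 * exp (- \<theta> * real m)" by (intro mult_right_mono) auto
      finally show ?thesis .
    qed
    have one: "h m \<le> suminf h" for h :: "nat \<Rightarrow> ennreal" and m
      using sum_le_suminf[OF summableI, of "{m}" h] by simp
    have pw: "ennreal (D w ^ 4) \<le> (\<Sum>m. ennreal (L * exp (\<theta> / 2 * (real m + 1))) * indicator (E m) w)"
      if w: "w \<in> space N" for w
    proof -
      define m where "m = nat \<lfloor>\<bar>D w\<bar> / d\<rfloor>"
      have fl: "real m \<le> \<bar>D w\<bar> / d" "\<bar>D w\<bar> / d \<le> real m + 1"
        using d by (auto simp: m_def)
      hence "w \<in> E m" using d w by (simp add: E_def field_simps)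
      have "D w ^ 4 = \<bar>D w\<bar> ^ 4" by simp
      also have "\<dots> = L * (\<theta> * \<bar>D w\<bar> / (8 * d)) ^ 4"
        using d \<theta> by (simp add: L_def power_mult_distrib[symmetric] del: power_abs)
      also have "\<dots> \<le> L * (exp (\<theta> * \<bar>D w\<bar> / (8 * d))) ^ 4"
      proof (intro mult_left_mono power_mono)
        show "\<theta> * \<bar>D w\<bar> / (8 * d) \<le> exp (\<theta> * \<bar>D w\<bar> / (8 * d))"
          using exp_ge_add_one_self[of "\<theta> * \<bar>D w\<bar> / (8 * d)"] by linarith
      qed (use L d \<theta> in auto)
      also have "(exp (\<theta> * \<bar>D w\<bar> / (8 * d))) ^ 4 = exp (\<theta> / 2 * (\<bar>D w\<bar> / d))"
        by (simp add: exp_of_nat_mult[symmetric])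
      also have "L * \<dots> \<le> L * exp (\<theta> / 2 * (real m + 1))"
        using L \<theta> fl(2) by (intro mult_left_mono exp_mono) auto
      finally have "ennreal (D w ^ 4) \<le> ennreal (L * exp (\<theta> / 2 * (real m + 1))) * indicator (E m) w"
        using \<open>w \<in> E m\<close> by (simp add: ennreal_leI)
      also have "\<dots> \<le> (\<Sum>m. ennreal (L * exp (\<theta> / 2 * (real m + 1))) * indicator (E m) w)"
        by (rule one[of "\<lambda>m. ennreal (L * exp (\<theta> / 2 * (real m + 1))) * indicator (E m) w"])
      finally show ?thesis .
    qed
    have "(\<integral>\<^sup>+w. ennreal (D w ^ 4) \<partial>N) \<le> (\<integral>\<^sup>+w. (\<Sum>m. ennreal (L * exp (\<theta> / 2 * (real m + 1))) * indicator (E m) w) \<partial>N)"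
      by (intro nn_integral_mono pw)
    also have "\<dots> = (\<Sum>m. ennreal (L * exp (\<theta> / 2 * (real m + 1))) * emeasure N (E m))"
      by (subst nn_integral_suminf) (auto simp: nn_integral_cmult_indicator)
    also have "\<dots> \<le> (\<Sum>m. ennreal (u m))"
    proof (intro suminf_le)
      fix m
      have "ennreal (L * exp (\<theta> / 2 * (real m + 1))) * emeasure N (E m) =
          ennreal (L * exp (\<theta> / 2 * (real m + 1)) * prob (E m))"
        using L by (simp add: emeasure_eq_measure ennreal_mult)
      also have "\<dots> \<le> ennreal (u m)"
        unfolding u_def using L E by (intro ennreal_leI mult_left_mono) auto
      finally show "ennreal (L * exp (\<theta> / 2 * (real m + 1))) * emeasure N (E m) \<le> ennreal (u m)" .
    qed auto
    also have "\<dots> = ennreal (suminf u)"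
      using su u0 by (intro suminf_ennreal ennreal_suminf_neq_top) auto
    finally have *: "(\<integral>\<^sup>+w. ennreal (D w ^ 4) \<partial>N) \<le> ennreal (suminf u)" .
    hence "integrable N (\<lambda>w. D w ^ 4)"
      by (intro integrableI_nonneg) (auto simp: top_unique less_top[symmetric])
    moreover from this have "(\<integral>w. D w ^ 4 \<partial>N) \<le> suminf u"
      using * su u0 by (simp add: nn_integral_eq_integral ennreal_le_iff suminf_nonneg)
    ultimately show ?thesis by blast
  qed
  thus ?thesis by (intro exI[of _ "suminf u"]) blast
qed

section \<open>Consequences of the KMT coupling\<close>

definition coupling_error ::
    "'a measure \<Rightarrow> nat \<Rightarrow> (nat \<Rightarrow> 'w \<Rightarrow> 'a) \<Rightarrow> (('a \<Rightarrow> real) \<Rightarrow> 'w \<Rightarrow> real) \<Rightarrow> ('a \<Rightarrow> real) \<Rightarrow> 'w \<Rightarrow> real"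
  where "coupling_error P n X B g w = sqrt (real n) * (emp n (\<lambda>i. X i w) g - (\<integral>x. g x \<partial>P)) - B g w"

lemma coupling_error_measurable:
  assumes "iid_sample N P X" "brownian_bridge N P F B" "g \<in> F" "g \<in> borel_measurable borel"
  shows "coupling_error P n X B g \<in> borel_measurable N"
  unfolding coupling_error_def emp_def
  using iid_sampleD(3)[OF assms(1)] brownian_bridgeD(2)[OF assms(2,3)] assms(4) by measurable

text \<open>A member of G whose error reaches r lifts the supremum over F to at least r.
  Monotonicity of the measure asks for measurability of the larger event, which the countability of
  F provides.\<close>

lemma coupling_error_tail:
  assumes X: "iid_sample N P X" and B: "brownian_bridge N P F B" and F: "countable F"
    and meas: "\<And>g. g \<in> F \<Longrightarrow> g \<in> borel_measurable borel" and G: "G \<subseteq> F"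
  shows "measure N {w \<in> space N. \<exists>g\<in>G. \<bar>coupling_error P n X B g w\<bar> \<ge> r}
    \<le> measure N {w \<in> space N. (SUP g\<in>F. ereal \<bar>sqrt (real n) * (emp n (\<lambda>i. X i w) g - (\<integral>x. g x \<partial>P)) - B g w\<bar>) \<ge> ereal r}"
  unfolding coupling_error_def[symmetric]
proof -
  interpret prob_space N by (rule iid_sampleD[OF X])
  have [measurable]: "(\<lambda>w. SUP g\<in>F. ereal \<bar>coupling_error P n X B g w\<bar>) \<in> borel_measurable N"
    using coupling_error_measurable[OF X B _ meas] by (intro borel_measurable_SUP F) auto
  show "measure N {w \<in> space N. \<exists>g\<in>G. \<bar>coupling_error P n X B g w\<bar> \<ge> r}
    \<le> measure N {w \<in> space N. (SUP g\<in>F. ereal \<bar>coupling_error P n X B g w\<bar>) \<ge> ereal r}"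
  proof (intro finite_measure_mono subsetI)
    fix w assume "w \<in> {w \<in> space N. \<exists>g\<in>G. \<bar>coupling_error P n X B g w\<bar> \<ge> r}"
    then obtain g where g: "w \<in> space N" "g \<in> F" "\<bar>coupling_error P n X B g w\<bar> \<ge> r" using G by blast
    have "ereal r \<le> ereal \<bar>coupling_error P n X B g w\<bar>" using g by simp
    also have "\<dots> \<le> (SUP g\<in>F. ereal \<bar>coupling_error P n X B g w\<bar>)" using g by (intro SUP_upper)
    finally show "w \<in> {w \<in> space N. (SUP g\<in>F. ereal \<bar>coupling_error P n X B g w\<bar>) \<ge> ereal r}"
      using g by simp
  qed auto
qed

text \<open>Choice turns the existence of a coupling for each n into sequences. The constants b, c,
  \<theta> stay common to all n, as the passage to the limit requires.\<close>

lemma KMT_coupling: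
  fixes P :: "'a::topological_space measure"
  assumes KMT: "KMT \<delta> P F" and F: "countable F"
    and meas: "\<And>g. g \<in> F \<Longrightarrow> g \<in> borel_measurable borel"
  obtains b c \<theta> :: real and N :: "nat \<Rightarrow> ((nat \<Rightarrow> 'a) \<times> (('a \<Rightarrow> real) \<Rightarrow> real)) measure" and X B
  where "b > 0" "c > 0" "\<theta> > 0"
    "\<And>n. n \<ge> 1 \<Longrightarrow> iid_sample (N n) P (X n)" "\<And>n. n \<ge> 1 \<Longrightarrow> brownian_bridge (N n) P F (B n)"
    "\<And>n t G. n \<ge> 1 \<Longrightarrow> t > 0 \<Longrightarrow> G \<subseteq> F \<Longrightarrow>
      measure (N n) {w \<in> space (N n). \<exists>g\<in>G. \<bar>coupling_error P n (X n) (B n) g w\<bar> \<ge> \<delta> n * (t + b * ln (real n))}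
        \<le> c * exp (- \<theta> * t)"
proof -
  define good where "good = (\<lambda>b c \<theta> n (N :: ((nat \<Rightarrow> 'a) \<times> (('a \<Rightarrow> real) \<Rightarrow> real)) measure) X B.
    iid_sample N P X \<and> brownian_bridge N P F B \<and>
        (\<forall>t>0. measure N {w \<in> space N.
            (SUP f\<in>F. ereal \<bar>sqrt (real n) * (emp n (\<lambda>i. X i w) f - (\<integral>x. f x \<partial>P)) - B f w\<bar>)
              \<ge> ereal (\<delta> n * (t + b * ln (real n)))} \<le> c * exp (- \<theta> * t)))"
  have "\<exists>b>0. \<exists>c>0. \<exists>\<theta>>0. \<forall>n\<ge>1. \<exists>N X B. good b c \<theta> n N X B"
    using KMT unfolding KMT_def good_def by (elim conjE)
  then obtain b c \<theta> where bc: "b > 0" "c > 0" "\<theta> > 0" and ex: "\<forall>n\<ge>1. \<exists>N X B. good b c \<theta> n N X B"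
    by blast
  have "\<exists>T. n \<ge> 1 \<longrightarrow> good b c \<theta> n (fst T) (fst (snd T)) (snd (snd T))" for n
  proof (cases "n \<ge> 1")
    case True
    then obtain N X B where "good b c \<theta> n N X B" using ex by blast
    thus ?thesis by (intro exI[of _ "(N, X, B)"]) simp
  qed simp
  hence "\<exists>T. \<forall>n. n \<ge> 1 \<longrightarrow> good b c \<theta> n (fst (T n)) (fst (snd (T n))) (snd (snd (T n)))"
    by (intro choice allI)
  then obtain T where T: "\<And>n. n \<ge> 1 \<Longrightarrow> good b c \<theta> n (fst (T n)) (fst (snd (T n))) (snd (snd (T n)))"
    by blast
  show thesis
  proof (rule that[OF bc, of "\<lambda>n. fst (T n)" "\<lambda>n. fst (snd (T n))" "\<lambda>n. snd (snd (T n))"])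
    fix n :: nat assume n: "n \<ge> 1"
    show X: "iid_sample (fst (T n)) P (fst (snd (T n)))" using T[OF n] by (simp add: good_def)
    show B: "brownian_bridge (fst (T n)) P F (snd (snd (T n)))" using T[OF n] by (simp add: good_def)
    fix t :: real and G assume t: "t > 0" and G: "G \<subseteq> F"
    show "measure (fst (T n)) {w \<in> space (fst (T n)). \<exists>g\<in>G.
          \<bar>coupling_error P n (fst (snd (T n))) (snd (snd (T n))) g w\<bar> \<ge> \<delta> n * (t + b * ln (real n))}
        \<le> c * exp (- \<theta> * t)"
      using coupling_error_tail[OF X B F meas G] T[OF n] t
      unfolding good_def by (blast intro: order_trans)
  qed
qed

lemma power4_add_le: "(a + b) ^ 4 \<le> 8 * a ^ 4 + 8 * (b :: real) ^ 4"
proof -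
  have "(x + y)\<^sup>2 \<le> 2 * x\<^sup>2 + 2 * y\<^sup>2" for x y :: real
    using sum_squares_bound[of x y] by (simp add: power2_sum)
  note * = this
  have "(a + b) ^ 4 = ((a + b)\<^sup>2)\<^sup>2" by simp
  also have "\<dots> \<le> (2 * a\<^sup>2 + 2 * b\<^sup>2)\<^sup>2" by (intro power_mono *) auto
  also have "\<dots> \<le> 2 * (2 * a\<^sup>2)\<^sup>2 + 2 * (2 * b\<^sup>2)\<^sup>2" by (rule *)
  finally show ?thesis by (simp add: power_mult_distrib)
qed

text \<open>The coupling for a sample of size 1 represents \<open>g - P g\<close> as a Gaussian variable plus an error
  with an exponential tail.\<close>

lemma KMT_fourth_moment_bounded:
  fixes P :: "'a::topological_space measure"
  assumes KMT: "KMT \<delta> P F" and F: "countable F" "F \<noteq> {}"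
    and meas: "\<And>g. g \<in> F \<Longrightarrow> g \<in> borel_measurable borel"
  shows "\<exists>K. \<forall>g\<in>F. integrable P (\<lambda>x. (g x - (\<integral>y. g y \<partial>P)) ^ 4) \<and> (\<integral>x. (g x - (\<integral>y. g y \<partial>P)) ^ 4 \<partial>P) \<le> K"
proof -
  obtain b c \<theta> :: real and N :: "nat \<Rightarrow> ((nat \<Rightarrow> 'a) \<times> (('a \<Rightarrow> real) \<Rightarrow> real)) measure" and X B
    where bc: "b > 0" "c > 0" "\<theta> > 0"
    and X: "\<And>n. n \<ge> 1 \<Longrightarrow> iid_sample (N n) P (X n)" and B: "\<And>n. n \<ge> 1 \<Longrightarrow> brownian_bridge (N n) P F (B n)"
    and tail: "\<And>n t G. n \<ge> 1 \<Longrightarrow> t > 0 \<Longrightarrow> G \<subseteq> F \<Longrightarrow>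
      measure (N n) {w \<in> space (N n). \<exists>g\<in>G. \<bar>coupling_error P n (X n) (B n) g w\<bar> \<ge> \<delta> n * (t + b * ln (real n))}
        \<le> c * exp (- \<theta> * t)"
    by (rule KMT_coupling[OF KMT F(1) meas]) blast+
  define N1 where "N1 = N 1"
  define X1 where "X1 = X 1"
  define B1 where "B1 = B 1"
  define D where "D = coupling_error P 1 X1 B1"
  have X1: "iid_sample N1 P X1" and B1: "brownian_bridge N1 P F B1"
    unfolding N1_def X1_def B1_def using X[of 1] B[of 1] by auto
  interpret prob_space N1 by (rule iid_sampleD[OF X1])
  \<comment> \<open>For n = 1 the logarithm vanishes and the threshold is just
    \<open>\<delta> 1 * t\<close>.\<close>
  have tail1: "measure N1 {w \<in> space N1. \<bar>D g w\<bar> \<ge> \<delta> 1 * t} \<le> c * exp (- \<theta> * t)" if "t > 0" "g \<in> F" for t g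
    using tail[of 1 t "{g}"] that by (simp add: N1_def X1_def B1_def D_def)
  have d: "\<delta> 1 > 0"
  proof (rule ccontr)
    assume neg: "\<not> \<delta> 1 > 0"
    obtain g where g: "g \<in> F" using F by blast
    \<comment> \<open>If \<delta> 1 were not positive, the event would be the whole space for every
      t. This choice of t gives 1 <= c exp(-(c + 1)), impossible because exp (c + 1) > c.\<close>
    define t where "t = (c + 1) / \<theta>"
    have t: "t > 0" "\<theta> * t = c + 1" using bc by (simp_all add: t_def)
    have "\<delta> 1 * t \<le> \<bar>D g w\<bar>" for w
      using neg t by (intro order_trans[OF mult_nonpos_nonneg]) auto
    hence "{w \<in> space N1. \<bar>D g w\<bar> \<ge> \<delta> 1 * t} = space N1" by auto
    hence "1 \<le> c * exp (- (c + 1))" using tail1[OF t(1) g] t(2) by (simp add: prob_space)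
    hence "exp (c + 1) * 1 \<le> exp (c + 1) * (c * exp (- (c + 1)))" by (intro mult_left_mono) auto
    also have "\<dots> = c * (exp (c + 1) * exp (- (c + 1)))" by (simp only: mult_ac)
    also have "exp (c + 1) * exp (- (c + 1)) = 1" unfolding exp_add[symmetric] by simp
    finally have "exp (c + 1) \<le> c" by simp
    thus False using exp_ge_add_one_self[of "c + 1"] by linarith
  qed
  obtain K1 where "\<forall>D \<in> borel_measurable N1.
      (\<forall>t>0. measure N1 {w \<in> space N1. \<bar>D w\<bar> \<ge> \<delta> 1 * t} \<le> c * exp (- \<theta> * t)) \<longrightarrow>
      integrable N1 (\<lambda>w. D w ^ 4) \<and> (\<integral>w. D w ^ 4 \<partial>N1) \<le> K1"
    using fourth_moment_of_exponential_tail[OF prob_space_axioms d bc(3) less_imp_le[OF bc(2)]] by (rule exE)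
  note K1 = this[THEN bspec, THEN mp]
  have pg: "pregaussian P F" using KMT unfolding KMT_def by (elim conjE)
  obtain V where "\<forall>g\<in>F. cov P g g \<le> V"
    using pregaussian_variance_bounded[OF F(1) pg] by (rule exE)
  note V = this[THEN bspec]
  have "integrable P (\<lambda>x. (g x - (\<integral>y. g y \<partial>P)) ^ 4) \<and>
      (\<integral>x. (g x - (\<integral>y. g y \<partial>P)) ^ 4 \<partial>P) \<le> 8 * K1 + 8 * (3 * V\<^sup>2)" if g: "g \<in> F" for g
  proof -
    note [measurable] = meas[OF g] iid_sampleD(3)[OF X1] brownian_bridgeD(2)[OF B1 g]
    have [measurable]: "D g \<in> borel_measurable N1"
      unfolding D_def by (rule coupling_error_measurable[OF X1 B1 g meas[OF g]])
    define Y where "Y = (\<lambda>w. g (X1 0 w) - (\<integral>y. g y \<partial>P))"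
    have Y: "Y w = D g w + B1 g w" for w by (simp add: Y_def D_def coupling_error_def emp_def)
    have iD: "integrable N1 (\<lambda>w. D g w ^ 4)" "(\<integral>w. D g w ^ 4 \<partial>N1) \<le> K1"
      using K1[of "D g"] tail1[OF _ g] by simp_all
    have iB: "integrable N1 (\<lambda>w. B1 g w ^ 4)" "(\<integral>w. B1 g w ^ 4 \<partial>N1) = 3 * (cov P g g)\<^sup>2"
      by (rule brownian_bridge_moments[OF B1 g])+
    have "0 \<le> cov P g g"
      unfolding brownian_bridgeD(6)[OF B1 g g, symmetric] by (intro integral_nonneg_AE AE_I2) simp
    hence "(cov P g g)\<^sup>2 \<le> V\<^sup>2" using V[OF g] by (intro power_mono)
    hence iB': "(\<integral>w. B1 g w ^ 4 \<partial>N1) \<le> 3 * V\<^sup>2" using iB by simp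
    have ub: "Y w ^ 4 \<le> 8 * D g w ^ 4 + 8 * B1 g w ^ 4" for w unfolding Y by (rule power4_add_le)
    have iY: "integrable N1 (\<lambda>w. Y w ^ 4)"
    proof (rule Bochner_Integration.integrable_bound)
      show "integrable N1 (\<lambda>w. 8 * D g w ^ 4 + 8 * B1 g w ^ 4)" using iD iB by simp
      show "AE w in N1. norm (Y w ^ 4) \<le> norm (8 * D g w ^ 4 + 8 * B1 g w ^ 4)"
        using ub by (intro AE_I2) (simp add: order_trans[OF _ abs_ge_self])
    qed (simp add: Y_def)
    have "(\<integral>w. Y w ^ 4 \<partial>N1) \<le> (\<integral>w. 8 * D g w ^ 4 + 8 * B1 g w ^ 4 \<partial>N1)"
      using iY iD iB ub by (intro integral_mono) auto
    also have "\<dots> \<le> 8 * K1 + 8 * (3 * V\<^sup>2)" using iD iB iB' by simp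
    finally show ?thesis
      using iid_sample_integral[OF X1, of "\<lambda>x. (g x - (\<integral>y. g y \<partial>P)) ^ 4" 0] iY by (simp add: Y_def)
  qed
  thus ?thesis by blast
qed

section \<open>Perturbation of limit laws\<close>

text \<open>Off a small event, V lies between the events U <= x - \<epsilon> and U <= x +
  \<epsilon>, and continuity of the limit closes the gap. V is an event rather than a comparison of
  real variables, so that the extended-real statistic fits.\<close>

lemma cdf_limit_perturbation:
  fixes \<Phi> :: "real \<Rightarrow> real"
  assumes U: "\<And>x. (\<lambda>n. measure (N n) {w \<in> space (N n). U n w \<le> x}) \<longlonglongrightarrow> \<Phi> x"
    and cont: "isCont \<Phi> x"
    and ev: "eventually (\<lambda>n. prob_space (N n) \<and> U n \<in> borel_measurable (N n) \<and>
      {w \<in> space (N n). V n w} \<in> sets (N n)) sequentially"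
    and bad: "\<And>\<epsilon> \<kappa>. \<epsilon> > 0 \<Longrightarrow> \<kappa> > 0 \<Longrightarrow> eventually (\<lambda>n. \<exists>E\<in>sets (N n). measure (N n) E \<le> \<kappa> \<and>
      (\<forall>w\<in>space (N n) - E. (V n w \<longrightarrow> U n w \<le> x + \<epsilon>) \<and> (U n w \<le> x - \<epsilon> \<longrightarrow> V n w))) sequentially"
  shows "(\<lambda>n. measure (N n) {w \<in> space (N n). V n w}) \<longlonglongrightarrow> \<Phi> x"
proof (rule LIMSEQ_I)
  fix r :: real assume r: "r > 0"
  obtain d where d: "d > 0" "\<And>y. \<bar>y - x\<bar> < d \<Longrightarrow> \<bar>\<Phi> y - \<Phi> x\<bar> < r / 3"
    using cont[unfolded continuous_at_eps_delta, rule_format, of "r / 3"] r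
    by (auto simp: dist_real_def)
  have r3: "r / 3 > 0" using r by simp
  define \<epsilon> where "\<epsilon> = d / 2"
  have \<epsilon>: "\<epsilon> > 0" "\<bar>\<Phi> (x + \<epsilon>) - \<Phi> x\<bar> < r / 3" "\<bar>\<Phi> (x - \<epsilon>) - \<Phi> x\<bar> < r / 3"
    using d by (auto simp: \<epsilon>_def)
  have u1: "eventually (\<lambda>n. measure (N n) {w \<in> space (N n). U n w \<le> x + \<epsilon>} < \<Phi> (x + \<epsilon>) + r / 3) sequentially"
    using U[of "x + \<epsilon>"] r by (intro order_tendstoD) auto
  have u2: "eventually (\<lambda>n. measure (N n) {w \<in> space (N n). U n w \<le> x - \<epsilon>} > \<Phi> (x - \<epsilon>) - r / 3) sequentially"
    using U[of "x - \<epsilon>"] r by (intro order_tendstoD) auto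
  have "eventually (\<lambda>n. norm (measure (N n) {w \<in> space (N n). V n w} - \<Phi> x) < r) sequentially"
    using ev bad[OF \<epsilon>(1) r3] u1 u2
  proof eventually_elim
    case (elim n)
    from elim(1) interpret prob_space "N n" by blast
    have [measurable]: "U n \<in> borel_measurable (N n)" and Vm: "{w \<in> space (N n). V n w} \<in> sets (N n)"
      using elim(1) by blast+
    from elim(2) r obtain E where E: "E \<in> sets (N n)" "prob E \<le> r / 3"
      and E': "\<And>w. w \<in> space (N n) - E \<Longrightarrow> V n w \<Longrightarrow> U n w \<le> x + \<epsilon>"
        "\<And>w. w \<in> space (N n) - E \<Longrightarrow> U n w \<le> x - \<epsilon> \<Longrightarrow> V n w" by auto
    have "prob {w \<in> space (N n). V n w} \<le> prob ({w \<in> space (N n). U n w \<le> x + \<epsilon>} \<union> E)"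
      using E E' by (intro finite_measure_mono) auto
    also have "\<dots> \<le> prob {w \<in> space (N n). U n w \<le> x + \<epsilon>} + prob E"
      using E by (intro measure_Un_le) auto
    finally have 1: "prob {w \<in> space (N n). V n w} < \<Phi> x + r"
      using E(2) elim(3) \<epsilon>(2) r by linarith
    have "prob {w \<in> space (N n). U n w \<le> x - \<epsilon>} \<le> prob ({w \<in> space (N n). V n w} \<union> E)"
      using E E' Vm by (intro finite_measure_mono) auto
    also have "\<dots> \<le> prob {w \<in> space (N n). V n w} + prob E"
      using E Vm by (intro measure_Un_le) auto
    finally have 2: "prob {w \<in> space (N n). V n w} > \<Phi> x - r"
      using E(2) elim(4) \<epsilon>(3) r by linarith
    show ?case using 1 2 by (simp add: abs_less_iff)
  qed
  thus "\<exists>no. \<forall>n\<ge>no. norm (measure (N n) {w \<in> space (N n). V n w} - \<Phi> x) < r"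
    by (simp add: eventually_sequentially)
qed

section \<open>The statistic in coordinates\<close>

lemma emp_add: "emp n x (\<lambda>y. g y + h y) = emp n x g + emp n x h"
  by (simp add: emp_def sum.distrib add_divide_distrib)

lemma emp_cmult: "emp n x (\<lambda>y. c * g y) = c * emp n x g"
  by (simp add: emp_def sum_distrib_left)

lemma emp_const: "n \<ge> 1 \<Longrightarrow> emp n x (\<lambda>_. c) = c"
  by (simp add: emp_def)

lemma emp_sum: "finite I \<Longrightarrow> emp n x (\<lambda>y. \<Sum>i\<in>I. c i * g i y) = (\<Sum>i\<in>I. c i * emp n x (g i))"
  by (induction I rule: finite_induct) (simp_all add: emp_add emp_cmult, simp add: emp_def)

lemma emp_measurable [measurable]:
  assumes "g \<in> borel_measurable borel"
  shows "(\<lambda>x. emp n x g) \<in> borel_measurable (Pi\<^sub>M UNIV (\<lambda>_. borel))"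
  unfolding emp_def using assms by measurable

lemma fscale_sum_apply: "(\<Sum>p\<in>I. fscale (b p) (f p)) y = (\<Sum>p\<in>I. b p * f p y)"
  by (induction I rule: infinite_finite_induct) (simp_all add: fscale_def)

text \<open>Passing from the span to coefficients makes the objective an explicit quadratic in
  finitely many parameters.\<close>

lemma span_with_constants:
  fixes f :: "nat \<Rightarrow> 'a \<Rightarrow> real"
  assumes f: "f ` {..<k} = G"
  shows "fn.span (G \<union> {\<lambda>_. 1}) = range (\<lambda>(b, c) y. (\<Sum>p<k. b p * f p y) + c)" (is "_ = ?V")
proof (intro Set.equalityI)
  have V: "(\<lambda>y. (\<Sum>p<k. b p * f p y) + c) \<in> ?V" for b c by (rule range_eqI[of _ _ "(b, c)"]) simp
  show "fn.span (G \<union> {\<lambda>_. 1}) \<subseteq> ?V"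
  proof (rule fn.span_minimal)
    show "G \<union> {\<lambda>_. 1} \<subseteq> ?V"
    proof
      fix g assume "g \<in> G \<union> {\<lambda>_. 1}"
      then consider q where "q < k" "g = f q" | "g = (\<lambda>_. 1)" using f by auto
      thus "g \<in> ?V"
      proof cases
        case 1
        have eq: "g = (\<lambda>y. (\<Sum>p<k. (if p = q then 1 else 0) * f p y) + 0)"
          using 1 by (auto simp: if_distrib[of "\<lambda>u. u * _"] cong: if_cong)
        show ?thesis by (rule ssubst[OF eq, of "\<lambda>u. u \<in> ?V"]) (rule V)
      next
        case 2
        thus ?thesis using V[of "\<lambda>_. 0" 1] by simp
      qed
    qed
    show "fn.subspace ?V"
    proof (rule fn.subspaceI)
      show "0 \<in> ?V" using V[of "\<lambda>_. 0" 0] by (simp add: zero_fun_def)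
    next
      fix g h assume "g \<in> ?V" "h \<in> ?V"
      then obtain b c b' c' where gh: "g = (\<lambda>y. (\<Sum>p<k. b p * f p y) + c)" "h = (\<lambda>y. (\<Sum>p<k. b' p * f p y) + c')" by auto
      have "g + h = (\<lambda>y. (\<Sum>p<k. (b p + b' p) * f p y) + (c + c'))"
        unfolding gh by (auto simp: plus_fun_def algebra_simps sum.distrib)
      thus "g + h \<in> ?V" using V by simp
    next
      fix r g assume "g \<in> ?V"
      then obtain b c where g: "g = (\<lambda>y. (\<Sum>p<k. b p * f p y) + c)" by auto
      have "fscale r g = (\<lambda>y. (\<Sum>p<k. (r * b p) * f p y) + r * c)"
        unfolding g by (auto simp: fscale_def algebra_simps sum_distrib_left)
      thus "fscale r g \<in> ?V" using V by simp
    qed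
  qed
  show "?V \<subseteq> fn.span (G \<union> {\<lambda>_. 1})"
  proof
    fix g assume "g \<in> ?V"
    then obtain b c where g: "g = (\<lambda>y. (\<Sum>p<k. b p * f p y) + c)" by auto
    have "(\<Sum>p<k. fscale (b p) (f p)) + fscale c (\<lambda>_. 1) \<in> fn.span (G \<union> {\<lambda>_. 1})"
      using f by (intro fn.span_add fn.span_sum fn.span_scale fn.span_base) auto
    also have "(\<Sum>p<k. fscale (b p) (f p)) + fscale c (\<lambda>_. 1) = g"
      unfolding g by (rule ext) (simp add: fscale_sum_apply plus_fun_def, simp add: fscale_def)
    finally show "g \<in> fn.span (G \<union> {\<lambda>_. 1})" .
  qed
qed

text \<open>The constant c is absent from the linear part: Q0 and the empirical measure both have
  mass 1, so it cancels there. It acts through the quadratic part alone.\<close>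

definition dual_obj ::
    "(nat \<Rightarrow> real) \<Rightarrow> nat \<Rightarrow> (nat \<Rightarrow> 'a \<Rightarrow> real) \<Rightarrow> nat \<Rightarrow> (nat \<Rightarrow> 'a) \<Rightarrow> (nat \<Rightarrow> real) \<Rightarrow> real \<Rightarrow> real"
  where "dual_obj m k f n x b c =
    (\<Sum>p<k. b p * (m p - emp n x (f p))) - 1/4 * emp n x (\<lambda>y. ((\<Sum>p<k. b p * f p y) + c)\<^sup>2)"

lemma chi2_stat_eq_SUP:
  fixes f :: "nat \<Rightarrow> 'a::topological_space \<Rightarrow> real"
  assumes f: "f ` {..<k} = G" and Q: "Q \<in> unit_signed_measures"
    and int: "\<And>p. p < k \<Longrightarrow> sm_integrable Q (f p)" and m: "\<And>p. p < k \<Longrightarrow> sm_integral Q (f p) = m p"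
    and n: "n \<ge> 1"
  shows "chi2_stat Q G n x = (SUP (b, c)\<in>UNIV. ereal (dual_obj m k f n x b c))"
proof -
  have "sm_integral Q (\<lambda>y. (\<Sum>p<k. b p * f p y) + c) - emp n x (\<lambda>y. (\<Sum>p<k. b p * f p y) + c)
      = (\<Sum>p<k. b p * (m p - emp n x (f p)))" for b c
  proof -
    have "sm_integral Q (\<lambda>y. (\<Sum>p<k. b p * f p y) + c) = (\<Sum>p<k. b p * m p) + c"
      using sm_integral_affine[OF Q int, where b = b and c = c] m by simp
    thus ?thesis
      using n by (simp add: emp_add emp_const emp_sum right_diff_distrib sum_subtractf)
  qed
  thus ?thesis
    unfolding chi2_stat_def span_with_constants[OF f] image_image
    by (intro SUP_cong) (auto simp: dual_obj_def)
qed

lemma rational_sequence: "\<exists>s. (\<forall>j::nat. s j \<in> \<rat>) \<and> s \<longlonglongrightarrow> (r::real)"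
proof -
  have "\<forall>j::nat. \<exists>q. q \<in> \<rat> \<and> r < q \<and> q < r + inverse (real (Suc j))"
    using Rats_dense_in_real[of r "r + inverse (real (Suc j))" for j] by auto
  then obtain s where s: "\<forall>j. s j \<in> \<rat> \<and> r < s j \<and> s j < r + inverse (real (Suc j))"
    unfolding choice_iff by (rule exE)
  have "s \<longlonglongrightarrow> r"
    by (rule tendsto_sandwich[OF _ _ tendsto_const LIMSEQ_inverse_real_of_nat_add])
      (use s in \<open>auto intro!: always_eventually less_imp_le\<close>)
  with s show ?thesis by blast
qed

lemma tendsto_dual_obj:
  assumes "\<And>p. p < k \<Longrightarrow> (\<lambda>j. bs j p) \<longlonglongrightarrow> b p" "cs \<longlonglongrightarrow> c"
  shows "(\<lambda>j. dual_obj m k f n x (bs j) (cs j)) \<longlonglongrightarrow> dual_obj m k f n x b c"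
  unfolding dual_obj_def emp_def divide_inverse using assms by (auto intro!: tendsto_intros)

lemma dual_obj_cong:
  assumes "\<And>p. p < k \<Longrightarrow> b p = b' p"
  shows "dual_obj m k f n x b c = dual_obj m k f n x b' c"
  unfolding dual_obj_def using assms by simp

text \<open>The objective is continuous in finitely many coefficients, so a countable dense set
  yields the same supremum, which makes the statistic measurable. Extensional functions on the
  indices below k keep the parameter set countable.\<close>

lemma SUP_dual_obj_rational:
  "(SUP (b, c)\<in>UNIV. ereal (dual_obj m k f n x b c)) =
    (SUP (b, c)\<in>(Pi\<^sub>E {..<k} (\<lambda>_. \<rat>)) \<times> \<rat>. ereal (dual_obj m k f n x b c))" (is "?l = ?r")
proof (rule antisym)
  show "?r \<le> ?l" by (intro SUP_subset_mono) auto
  show "?l \<le> ?r"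
  proof (intro SUP_least, clarify)
    fix b :: "nat \<Rightarrow> real" and c :: real
    have "\<forall>p. \<exists>s. (\<forall>j::nat. s j \<in> \<rat>) \<and> s \<longlonglongrightarrow> b p" using rational_sequence by blast
    then obtain s where s: "\<And>p j. s p j \<in> \<rat>" "\<And>p. s p \<longlonglongrightarrow> b p" unfolding choice_iff by blast
    obtain cs where cs: "\<And>j. cs j \<in> \<rat>" "cs \<longlonglongrightarrow> c" using rational_sequence[of c] by blast
    define bs where "bs = (\<lambda>j. \<lambda>p\<in>{..<k}. s p j)"
    have "(\<lambda>j. dual_obj m k f n x (bs j) (cs j)) \<longlonglongrightarrow> dual_obj m k f n x b c"
      using s cs by (intro tendsto_dual_obj) (auto simp: bs_def)
    hence lim: "(\<lambda>j. ereal (dual_obj m k f n x (bs j) (cs j))) \<longlonglongrightarrow> ereal (dual_obj m k f n x b c)"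
      by (rule tendsto_ereal)
    have ub: "ereal (dual_obj m k f n x (bs j) (cs j)) \<le> ?r" for j
      using s cs by (intro SUP_upper2[of "(bs j, cs j)"]) (auto simp: bs_def)
    show "ereal (dual_obj m k f n x b c) \<le> ?r"
      by (rule LIMSEQ_le_const2[OF lim]) (use ub in blast)
  qed
qed

lemma measurable_SUP_dual_obj:
  assumes f: "\<And>p. p < k \<Longrightarrow> f p \<in> borel_measurable borel"
    and X: "\<And>i. X i \<in> borel_measurable M"
  shows "(\<lambda>w. SUP (b, c)\<in>UNIV. ereal (dual_obj m k f n (\<lambda>i. X i w) b c)) \<in> borel_measurable M"
  unfolding SUP_dual_obj_rational
proof (rule borel_measurable_SUP)
  show "countable ((Pi\<^sub>E {..<k} (\<lambda>_. \<rat>)) \<times> (\<rat> :: real set))"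
    by (intro countable_SIGMA countable_PiE countable_rat) auto
  fix bc :: "(nat \<Rightarrow> real) \<times> real"
  have "(\<lambda>w. f p (X i w)) \<in> borel_measurable M" if "p < k" for p i
    using measurable_compose[OF X f[OF that]] .
  thus "(\<lambda>w. case bc of (b, c) \<Rightarrow> ereal (dual_obj m k f n (\<lambda>i. X i w) b c)) \<in> borel_measurable M"
    unfolding dual_obj_def emp_def by (cases bc) (auto intro!: borel_measurable_ereal borel_measurable_diff borel_measurable_add
      borel_measurable_sum borel_measurable_times borel_measurable_divide borel_measurable_power)
qed

section \<open>Orthonormal coordinates of a finite class\<close>

lemma abs_sq_norm_diff_le:
  fixes w v :: "nat \<Rightarrow> real" and k :: nat
  shows "\<bar>(\<Sum>i<k. (w i)\<^sup>2) - (\<Sum>i<k. (w i - v i)\<^sup>2)\<bar> \<le>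
    2 * sqrt (\<Sum>i<k. (w i)\<^sup>2) * sqrt (\<Sum>i<k. (v i)\<^sup>2) + (\<Sum>i<k. (v i)\<^sup>2)"
proof -
  have 1: "\<bar>\<Sum>i<k. w i * v i\<bar> \<le> sqrt (\<Sum>i<k. (w i)\<^sup>2) * sqrt (\<Sum>i<k. (v i)\<^sup>2)"
    unfolding real_sqrt_mult[symmetric] by (intro real_le_rsqrt) (simp add: Cauchy_Schwarz_ineq_sum)
  have 2: "(\<Sum>i<k. (w i)\<^sup>2) - (\<Sum>i<k. (w i - v i)\<^sup>2) = 2 * (\<Sum>i<k. w i * v i) - (\<Sum>i<k. (v i)\<^sup>2)"
    by (simp add: power2_diff sum.distrib sum_subtractf sum_distrib_left mult_ac)
  have 3: "(\<Sum>i<k. (v i)\<^sup>2) \<ge> 0" by (intro sum_nonneg) auto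
  show ?thesis unfolding 2
    using abs_le_D1[OF 1] abs_le_D2[OF 1] 3 by (intro abs_leI) linarith+
qed

text \<open>Everything that concerns a single finite class, with limits left to the end. The bound K
  will be the same for all classes, while k, lam and A change with n. \<open>contract\<close> says
  that A has operator norm at most lam^(-1/2).\<close>

locale orthonormal_class =
  fixes P :: "'a::topological_space measure" and k :: nat and f :: "nat \<Rightarrow> 'a \<Rightarrow> real"
    and A :: "nat \<Rightarrow> nat \<Rightarrow> real" and lam K :: real
  assumes P: "prob_space P" "sets P = sets borel"
    and f_meas: "\<And>p. p < k \<Longrightarrow> f p \<in> borel_measurable borel"
    and f_sq: "\<And>p. p < k \<Longrightarrow> integrable P (\<lambda>x. (f p x)\<^sup>2)"
    and fourth_int: "\<And>p. p < k \<Longrightarrow> integrable P (\<lambda>x. (f p x - (\<integral>y. f p y \<partial>P)) ^ 4)"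
    and fourth_le: "\<And>p. p < k \<Longrightarrow> (\<integral>x. (f p x - (\<integral>y. f p y \<partial>P)) ^ 4 \<partial>P) \<le> K"
    and K: "K \<ge> 0" and lam: "lam > 0"
    and ray: "\<And>b. lam * (\<Sum>p<k. (b p)\<^sup>2) \<le> bil (\<lambda>p q. cov P (f p) (f q)) k b b"
    and orth: "\<And>i j. i < k \<Longrightarrow> j < k \<Longrightarrow>
      bil (\<lambda>p q. cov P (f p) (f q)) k (A i) (A j) = (if i = j then 1 else 0)"
    and expand: "\<And>b p. p < k \<Longrightarrow> (\<Sum>i<k. bil (\<lambda>p q. cov P (f p) (f q)) k b (A i) * A i p) = b p"
    and contract: "\<And>u. lam * (\<Sum>i<k. (\<Sum>p<k. A i p * u p)\<^sup>2) \<le> (\<Sum>p<k. (u p)\<^sup>2)"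
begin

definition S :: "nat \<Rightarrow> nat \<Rightarrow> real"
  where "S p q = cov P (f p) (f q)"

definition fb :: "nat \<Rightarrow> 'a \<Rightarrow> real"
  where "fb p y = f p y - (\<integral>z. f p z \<partial>P)"

definition e :: "nat \<Rightarrow> 'a \<Rightarrow> real"
  where "e i y = (\<Sum>p<k. A i p * fb p y)"

definition W :: "nat \<Rightarrow> (nat \<Rightarrow> 'a) \<Rightarrow> nat \<Rightarrow> real"
  where "W n x i = sqrt (real n) * emp n x (e i)"

definition eta :: "nat \<Rightarrow> (nat \<Rightarrow> 'a) \<Rightarrow> real"
  where "eta n x = (\<Sum>i<k. (W n x i)\<^sup>2)"

text \<open>Squared Frobenius distance between S and the empirical second moments centred at the
  means under P. The further centring at empirical means is accounted for separately, by eta /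
  n.\<close>

definition cov_err :: "nat \<Rightarrow> (nat \<Rightarrow> 'a) \<Rightarrow> real"
  where "cov_err n x = (\<Sum>p<k. \<Sum>q<k. (emp n x (\<lambda>y. fb p y * fb q y) - S p q)\<^sup>2)"

interpretation prob_space P by (rule P)

lemma fb_meas: "p < k \<Longrightarrow> fb p \<in> borel_measurable borel"
  unfolding fb_def using f_meas by measurable

lemma borel_P: "g \<in> borel_measurable borel \<Longrightarrow> g \<in> borel_measurable P"
  using P(2) by (simp cong: measurable_cong_sets)

lemma f_int: "p < k \<Longrightarrow> integrable P (f p)"
  by (rule square_integrable_imp_integrable[OF borel_P[OF f_meas] f_sq])

lemma fb_int: "p < k \<Longrightarrow> integrable P (fb p)"
  and fb_mean: "p < k \<Longrightarrow> (\<integral>x. fb p x \<partial>P) = 0"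
  using f_int by (auto simp: fb_def[abs_def] prob_space)

lemma fb_prod: "p < k \<Longrightarrow> q < k \<Longrightarrow> integrable P (\<lambda>x. fb p x * fb q x)"
  and fb_cov: "p < k \<Longrightarrow> q < k \<Longrightarrow> (\<integral>x. fb p x * fb q x \<partial>P) = S p q"
proof -
  assume pq: "p < k" "q < k"
  have ff: "integrable P (\<lambda>x. f p x * f q x)"
    using pq by (intro integrable_mult_of_squares borel_P f_meas f_sq)
  have *: "fb p x * fb q x = f p x * f q x - (\<integral>z. f q z \<partial>P) * f p x - (\<integral>z. f p z \<partial>P) * f q x
      + (\<integral>z. f p z \<partial>P) * (\<integral>z. f q z \<partial>P)" for x
    by (simp add: fb_def algebra_simps)
  show "integrable P (\<lambda>x. fb p x * fb q x)"
    unfolding * using pq ff f_int by auto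
  show "(\<integral>x. fb p x * fb q x \<partial>P) = S p q"
    unfolding * using pq ff f_int by (simp add: S_def cov_def prob_space)
qed

lemma e_meas: "e i \<in> borel_measurable borel"
  unfolding e_def using fb_meas by (intro borel_measurable_sum borel_measurable_times) auto

lemma e_mean: "(\<integral>x. e i x \<partial>P) = 0"
  unfolding e_def using fb_int fb_mean by (simp add: Bochner_Integration.integral_sum)

lemma e_sq: "integrable P (\<lambda>x. (e i x)\<^sup>2)"
  and e_norm: "i < k \<Longrightarrow> (\<integral>x. (e i x)\<^sup>2 \<partial>P) = 1"
proof -
  have *: "(e i x)\<^sup>2 = (\<Sum>p<k. \<Sum>q<k. A i p * A i q * (fb p x * fb q x))" for x
    unfolding e_def power2_eq_square sum_product by (simp add: mult_ac)
  show "integrable P (\<lambda>x. (e i x)\<^sup>2)"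
    unfolding * using fb_prod by (intro Bochner_Integration.integrable_sum integrable_mult_right) auto
  assume i: "i < k"
  have "(\<integral>x. (e i x)\<^sup>2 \<partial>P) = (\<Sum>p<k. \<integral>x. (\<Sum>q<k. A i p * A i q * (fb p x * fb q x)) \<partial>P)"
    unfolding * using fb_prod by (intro Bochner_Integration.integral_sum Bochner_Integration.integrable_sum
      integrable_mult_right) auto
  also have "\<dots> = (\<Sum>p<k. \<Sum>q<k. A i p * A i q * S p q)"
    using fb_prod fb_cov by (intro sum.cong refl) (subst Bochner_Integration.integral_sum, auto)
  also have "\<dots> = 1" using orth[OF i i] by (simp add: bil_def S_def)
  finally show "(\<integral>x. (e i x)\<^sup>2 \<partial>P) = 1" .
qed

lemma eta_measurable: "eta n \<in> borel_measurable (Pi\<^sub>M UNIV (\<lambda>_. borel))"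
  unfolding eta_def W_def using e_meas by measurable

lemma eta_nonneg: "eta n x \<ge> 0"
  unfolding eta_def by (intro sum_nonneg) auto

lemma cov_err_nonneg: "cov_err n x \<ge> 0"
  unfolding cov_err_def by (intro sum_nonneg) auto

section \<open>Expectations of \<open>eta\<close> and of the covariance error\<close>

lemma mean_eta:
  assumes X: "iid_sample M P X" and n: "n \<ge> 1"
  shows "integrable M (\<lambda>w. eta n (\<lambda>i. X i w))" "(\<integral>w. eta n (\<lambda>i. X i w) \<partial>M) = real k"
proof -
  note ms = iid_sample_mean_square[OF X e_meas e_sq e_mean n]
  have *: "eta n (\<lambda>i. X i w) = (\<Sum>i<k. real n * (emp n (\<lambda>i. X i w) (e i))\<^sup>2)" for w
    by (simp add: eta_def W_def power_mult_distrib)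
  show "integrable M (\<lambda>w. eta n (\<lambda>i. X i w))" unfolding * using ms by auto
  have "(\<integral>w. eta n (\<lambda>i. X i w) \<partial>M) = (\<Sum>i<k. real n * ((\<integral>x. (e i x)\<^sup>2 \<partial>P) / real n))"
    unfolding * using ms by (subst Bochner_Integration.integral_sum) auto
  also have "\<dots> = real k" using n e_norm by simp
  finally show "(\<integral>w. eta n (\<lambda>i. X i w) \<partial>M) = real k" .
qed

text \<open>Each of the k^2 entries is an average of n independent centred terms whose second moment
  is at most K, by (a b)^2 <= (a^4 + b^4) / 2.\<close>

lemma mean_cov_err:
  assumes X: "iid_sample M P X" and n: "n \<ge> 1"
  shows "integrable M (\<lambda>w. cov_err n (\<lambda>i. X i w))" "(\<integral>w. cov_err n (\<lambda>i. X i w) \<partial>M) \<le> (real k)\<^sup>2 * K / real n"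
proof -
  define h where "h = (\<lambda>p q y. fb p y * fb q y - S p q)"
  have hm: "h p q \<in> borel_measurable borel" if "p < k" "q < k" for p q
    using fb_meas[OF that(1)] fb_meas[OF that(2)] unfolding h_def by measurable
  have h0: "(\<integral>y. h p q y \<partial>P) = 0" if "p < k" "q < k" for p q
    using fb_prod[OF that] fb_cov[OF that] by (simp add: h_def prob_space)
  have fourth: "integrable P (\<lambda>y. fb p y ^ 4)" "(\<integral>y. fb p y ^ 4 \<partial>P) \<le> K" if "p < k" for p
    using fourth_int[OF that] fourth_le[OF that] by (simp_all add: fb_def)
  have sq4: "((a * b)\<^sup>2 :: real) \<le> (a ^ 4 + b ^ 4) / 2" for a b
  proof -
    have "2 * a\<^sup>2 * b\<^sup>2 \<le> (a\<^sup>2)\<^sup>2 + (b\<^sup>2)\<^sup>2" by (rule sum_squares_bound)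
    thus ?thesis by (simp add: power_mult_distrib)
  qed
  have hsq: "integrable P (\<lambda>y. (h p q y)\<^sup>2)" "(\<integral>y. (h p q y)\<^sup>2 \<partial>P) \<le> K" if pq: "p < k" "q < k" for p q
  proof -
    note [measurable] = borel_P[OF fb_meas[OF pq(1)]] borel_P[OF fb_meas[OF pq(2)]]
    have i4: "integrable P (\<lambda>y. (fb p y * fb q y)\<^sup>2)"
    proof (rule Bochner_Integration.integrable_bound)
      show "integrable P (\<lambda>y. (fb p y ^ 4 + fb q y ^ 4) / 2)" using fourth pq by auto
      show "AE y in P. norm ((fb p y * fb q y)\<^sup>2) \<le> norm ((fb p y ^ 4 + fb q y ^ 4) / 2)"
        using sq4 by (intro AE_I2) (simp add: order_trans[OF _ abs_ge_self])
    qed simp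
    have *: "(h p q y)\<^sup>2 = (fb p y * fb q y)\<^sup>2 - 2 * S p q * (fb p y * fb q y) + (S p q)\<^sup>2" for y
      by (simp add: h_def power2_diff mult_ac)
    show "integrable P (\<lambda>y. (h p q y)\<^sup>2)" unfolding * using i4 fb_prod[OF pq] by auto
    have "(\<integral>y. (h p q y)\<^sup>2 \<partial>P) = (\<integral>y. (fb p y * fb q y)\<^sup>2 \<partial>P) - (S p q)\<^sup>2"
      unfolding * using i4 fb_prod[OF pq] fb_cov[OF pq] by (simp add: prob_space power2_eq_square)
    also have "\<dots> \<le> (\<integral>y. (fb p y * fb q y)\<^sup>2 \<partial>P)" by simp
    also have "\<dots> \<le> (\<integral>y. (fb p y ^ 4 + fb q y ^ 4) / 2 \<partial>P)"
      using i4 fourth pq sq4 by (intro integral_mono) auto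
    also have "\<dots> \<le> K" using fourth[OF pq(1)] fourth[OF pq(2)] by simp
    finally show "(\<integral>y. (h p q y)\<^sup>2 \<partial>P) \<le> K" .
  qed
  note ms = iid_sample_mean_square[OF X hm hsq(1) h0 n]
  have "emp n x (\<lambda>y. fb p y * fb q y) - S p q = emp n x (h p q)" for p q x
  proof -
    have "emp n x (h p q) = emp n x (\<lambda>y. fb p y * fb q y + - S p q)" by (simp add: h_def)
    also have "\<dots> = emp n x (\<lambda>y. fb p y * fb q y) + emp n x (\<lambda>_. - S p q)" by (rule emp_add)
    finally show ?thesis using n by (simp add: emp_const)
  qed
  hence *: "cov_err n (\<lambda>i. X i w) = (\<Sum>p<k. \<Sum>q<k. (emp n (\<lambda>i. X i w) (h p q))\<^sup>2)" for w
    by (simp add: cov_err_def)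
  show "integrable M (\<lambda>w. cov_err n (\<lambda>i. X i w))"
    unfolding * using ms by (intro Bochner_Integration.integrable_sum) auto
  have "(\<integral>w. cov_err n (\<lambda>i. X i w) \<partial>M) = (\<Sum>p<k. \<integral>w. (\<Sum>q<k. (emp n (\<lambda>i. X i w) (h p q))\<^sup>2) \<partial>M)"
    unfolding * using ms by (intro Bochner_Integration.integral_sum Bochner_Integration.integrable_sum) auto
  also have "\<dots> = (\<Sum>p<k. \<Sum>q<k. (\<integral>y. (h p q y)\<^sup>2 \<partial>P) / real n)"
    using ms by (intro sum.cong refl) (subst Bochner_Integration.integral_sum, auto)
  also have "\<dots> \<le> (\<Sum>p<k. \<Sum>q<k. K / real n)"
    using hsq by (intro sum_mono divide_right_mono) auto
  also have "\<dots> = (real k)\<^sup>2 * K / real n" by (simp add: power2_eq_square)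
  finally show "(\<integral>w. cov_err n (\<lambda>i. X i w) \<partial>M) \<le> (real k)\<^sup>2 * K / real n" .
qed

text \<open>Testing the form on the first unit vector shows that lam is at most a variance, which
  the fourth moment bounds. Thanks to this upper bound the second rate condition also controls
  k^(3/2) / n.\<close>

lemma lam_le:
  assumes "k > 0"
  shows "lam \<le> 1 + K"
proof -
  define b where "b = (\<lambda>p::nat. if p = 0 then 1 else (0::real))"
  have s: "(\<Sum>q<k. (if q = 0 then 1 else 0) * g q) = g 0" for g :: "nat \<Rightarrow> real"
    using assms by (simp add: if_distrib[of "\<lambda>u. u * _"] cong: if_cong)
  have "bil (\<lambda>p q. cov P (f p) (f q)) k b b = (\<Sum>p<k. b p * (\<Sum>q<k. b q * S p q))"
    by (simp add: bil_def S_def sum_distrib_left mult_ac)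
  also have "\<dots> = S 0 0" by (simp add: b_def s)
  finally have "lam \<le> S 0 0" using ray[of b] s[of "\<lambda>_. 1"]
    by (simp add: b_def if_distrib[of "\<lambda>u. u\<^sup>2"] cong: if_cong)
  also have "S 0 0 = (\<integral>y. (fb 0 y)\<^sup>2 \<partial>P)" using fb_cov[of 0 0] assms by (simp add: power2_eq_square)
  also have "\<dots> \<le> (\<integral>y. 1 + fb 0 y ^ 4 \<partial>P)"
  proof (rule integral_mono)
    show "integrable P (\<lambda>y. (fb 0 y)\<^sup>2)" using fb_prod[of 0 0] assms by (simp add: power2_eq_square)
    show "integrable P (\<lambda>y. 1 + fb 0 y ^ 4)" using fourth_int[of 0] assms by (simp add: fb_def)
    fix y
    have "2 * 1 * (fb 0 y)\<^sup>2 \<le> 1\<^sup>2 + ((fb 0 y)\<^sup>2)\<^sup>2" by (rule sum_squares_bound)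
    hence "2 * (fb 0 y)\<^sup>2 \<le> 1 + fb 0 y ^ 4" by simp
    moreover have "(fb 0 y)\<^sup>2 \<ge> 0" by simp
    ultimately show "(fb 0 y)\<^sup>2 \<le> 1 + fb 0 y ^ 4" by linarith
  qed
  also have "\<dots> \<le> 1 + K" using fourth_int[of 0] fourth_le[of 0] assms by (simp add: fb_def prob_space)
  finally show ?thesis .
qed

text \<open>An error of at most r in each of k functions has norm at most r * sqrt k, and the change
  of coordinates enlarges it by at most lam^(-1/2). The product is q.\<close>

lemma eta_coupling:
  assumes n: "n \<ge> 1" and u: "\<And>p. p < k \<Longrightarrow> \<bar>coupling_error P n X B (f p) w\<bar> \<le> r"
    and q: "q = sqrt (real k / lam) * r" and r: "r \<ge> 0"
  shows "\<bar>eta n (\<lambda>i. X i w) - (\<Sum>i<k. (\<Sum>p<k. A i p * B (f p) w)\<^sup>2)\<bar> \<le> 2 * sqrt (eta n (\<lambda>i. X i w)) * q + q\<^sup>2"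
proof -
  define u where "u = (\<lambda>p. coupling_error P n X B (f p) w)"
  define v where "v = (\<lambda>i. \<Sum>p<k. A i p * u p)"
  have q0: "q \<ge> 0" unfolding q using r lam by simp
  have "emp n x (fb p) = emp n x (f p) - (\<integral>y. f p y \<partial>P)" for x p
    using emp_add[of n x "f p" "\<lambda>_. - (\<integral>y. f p y \<partial>P)"] n by (simp add: fb_def[abs_def] emp_const)
  hence "W n (\<lambda>i. X i w) i = (\<Sum>p<k. A i p * (B (f p) w + u p))" for i
    unfolding W_def e_def[abs_def]
    by (simp add: emp_sum u_def coupling_error_def sum_distrib_left mult_ac)
  hence Y: "(\<Sum>p<k. A i p * B (f p) w) = W n (\<lambda>i. X i w) i - v i" for i
    by (simp add: v_def distrib_left sum.distrib)
  have "lam * (\<Sum>i<k. (v i)\<^sup>2) \<le> (\<Sum>p<k. (u p)\<^sup>2)" unfolding v_def by (rule contract)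
  also have "\<dots> \<le> (\<Sum>p<k. r\<^sup>2)"
  proof (rule sum_mono)
    fix p assume "p \<in> {..<k}"
    hence "\<bar>u p\<bar> \<le> \<bar>r\<bar>" using assms(2) r by (simp add: u_def)
    thus "(u p)\<^sup>2 \<le> r\<^sup>2" by (simp only: abs_le_square_iff)
  qed
  finally have v: "(\<Sum>i<k. (v i)\<^sup>2) \<le> q\<^sup>2"
    unfolding q using lam by (simp add: power_mult_distrib field_simps)
  hence "sqrt (\<Sum>i<k. (v i)\<^sup>2) \<le> q" using q0 by (simp add: real_le_lsqrt sum_nonneg)
  hence "2 * sqrt (eta n (\<lambda>i. X i w)) * sqrt (\<Sum>i<k. (v i)\<^sup>2) \<le> 2 * sqrt (eta n (\<lambda>i. X i w)) * q"
    using eta_nonneg by (intro mult_left_mono) auto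
  moreover have "\<bar>eta n (\<lambda>i. X i w) - (\<Sum>i<k. (\<Sum>p<k. A i p * B (f p) w)\<^sup>2)\<bar> \<le>
      2 * sqrt (eta n (\<lambda>i. X i w)) * sqrt (\<Sum>i<k. (v i)\<^sup>2) + (\<Sum>i<k. (v i)\<^sup>2)"
    unfolding Y eta_def by (rule abs_sq_norm_diff_le)
  ultimately show ?thesis using v by linarith
qed

text \<open>The constant is shifted so that c becomes the empirical mean of the test function. Then
  c = 0 is optimal, and what remains of the quadratic part is the empirical variance E -
  g^2.\<close>

lemma dual_obj_coordinates:
  fixes a :: "nat \<Rightarrow> real" and c :: real and x :: "nat \<Rightarrow> 'a"
  assumes n: "n \<ge> 1"
  defines "b \<equiv> \<lambda>p. \<Sum>i<k. a i * A i p"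
  defines "g \<equiv> emp n x (\<lambda>y. \<Sum>i<k. a i * e i y)"
  shows "sqrt (real n) * g = (\<Sum>i<k. a i * W n x i)"
    and "\<bar>emp n x (\<lambda>y. (\<Sum>i<k. a i * e i y)\<^sup>2) - (\<Sum>i<k. (a i)\<^sup>2)\<bar> \<le> (\<Sum>i<k. (a i)\<^sup>2) * (sqrt (cov_err n x) / lam)"
    and "dual_obj (\<lambda>p. \<integral>y. f p y \<partial>P) k f n x b (c - g - (\<Sum>p<k. b p * (\<integral>y. f p y \<partial>P)))
      = - g - 1/4 * (emp n x (\<lambda>y. (\<Sum>i<k. a i * e i y)\<^sup>2) - g\<^sup>2 + c\<^sup>2)"
proof -
  define m where "m = (\<lambda>p. \<integral>y. f p y \<partial>P)"
  have ge: "(\<Sum>i<k. a i * e i y) = (\<Sum>p<k. b p * fb p y)" for y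
  proof -
    have "(\<Sum>i<k. a i * e i y) = (\<Sum>i<k. \<Sum>p<k. a i * A i p * fb p y)"
      by (simp add: e_def sum_distrib_left mult_ac)
    also have "\<dots> = (\<Sum>p<k. b p * fb p y)"
      by (subst sum.swap) (simp add: b_def sum_distrib_right)
    finally show ?thesis .
  qed
  show "sqrt (real n) * g = (\<Sum>i<k. a i * W n x i)"
    by (simp add: g_def emp_sum W_def sum_distrib_left mult_ac)
  have gfb: "g = (\<Sum>p<k. b p * (emp n x (f p) - m p))"
  proof -
    have "emp n x (fb p) = emp n x (f p) - m p" for p
      using emp_add[of n x "f p" "\<lambda>_. - m p"] n by (simp add: fb_def[abs_def] m_def emp_const)
    thus ?thesis unfolding g_def ge by (simp add: emp_sum)
  qed
  define E where "E = emp n x (\<lambda>y. (\<Sum>i<k. a i * e i y)\<^sup>2)"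
  define D where "D = (\<lambda>p q. emp n x (\<lambda>y. fb p y * fb q y) - S p q)"
  have bb: "bil S k b b = (\<Sum>i<k. (a i)\<^sup>2)"
    unfolding b_def S_def[abs_def] by (rule bil_orthonormal) (rule orth)
  have "E = emp n x (\<lambda>y. \<Sum>p<k. b p * (\<Sum>q<k. b q * (fb p y * fb q y)))"
    unfolding E_def ge power2_eq_square sum_product by (simp add: sum_distrib_left mult_ac)
  also have "\<dots> = (\<Sum>p<k. b p * (\<Sum>q<k. b q * emp n x (\<lambda>y. fb p y * fb q y)))"
    by (simp add: emp_sum)
  finally have "E = (\<Sum>p<k. \<Sum>q<k. b p * b q * emp n x (\<lambda>y. fb p y * fb q y))"
    by (simp add: sum_distrib_left mult_ac)
  hence "E - (\<Sum>i<k. (a i)\<^sup>2) = (\<Sum>p<k. \<Sum>q<k. b p * b q * D p q)"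
    unfolding bb[symmetric] bil_def D_def by (simp add: sum_subtractf right_diff_distrib)
  \<comment> \<open>Read the quadratic form as the inner product of the matrix b_p b_q with the
    error matrix. Cauchy-Schwarz over pairs brings in the Frobenius norm of the error, and the norm
    of the first matrix is |b|^2.\<close>
  also have "\<dots> = (\<Sum>z\<in>{..<k} \<times> {..<k}. (b (fst z) * b (snd z)) * D (fst z) (snd z))"
    by (simp add: sum.cartesian_product split_beta)
  finally have "(E - (\<Sum>i<k. (a i)\<^sup>2))\<^sup>2 \<le>
      (\<Sum>z\<in>{..<k} \<times> {..<k}. (b (fst z) * b (snd z))\<^sup>2) * (\<Sum>z\<in>{..<k} \<times> {..<k}. (D (fst z) (snd z))\<^sup>2)"
    by (simp only: Cauchy_Schwarz_ineq_sum)
  also have "(\<Sum>z\<in>{..<k} \<times> {..<k}. (b (fst z) * b (snd z))\<^sup>2) = (\<Sum>p<k. (b p)\<^sup>2)\<^sup>2"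
    unfolding power2_eq_square[of "\<Sum>p<k. (b p)\<^sup>2"] sum_product
    by (simp add: sum.cartesian_product split_beta power_mult_distrib)
  also have "(\<Sum>z\<in>{..<k} \<times> {..<k}. (D (fst z) (snd z))\<^sup>2) = cov_err n x"
    by (simp add: cov_err_def D_def sum.cartesian_product split_beta)
  finally have "\<bar>E - (\<Sum>i<k. (a i)\<^sup>2)\<bar> \<le> sqrt ((\<Sum>p<k. (b p)\<^sup>2)\<^sup>2 * cov_err n x)"
    by (intro real_le_rsqrt) simp
  also have "\<dots> = (\<Sum>p<k. (b p)\<^sup>2) * sqrt (cov_err n x)"
    by (simp add: real_sqrt_mult abs_of_nonneg sum_nonneg)
  also have "\<dots> \<le> ((\<Sum>i<k. (a i)\<^sup>2) / lam) * sqrt (cov_err n x)"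
  proof (rule mult_right_mono)
    have "lam * (\<Sum>p<k. (b p)\<^sup>2) \<le> (\<Sum>i<k. (a i)\<^sup>2)" using ray[of b] bb by (simp add: S_def[abs_def])
    thus "(\<Sum>p<k. (b p)\<^sup>2) \<le> (\<Sum>i<k. (a i)\<^sup>2) / lam" using lam by (simp add: field_simps)
  qed (simp add: cov_err_nonneg)
  finally show "\<bar>emp n x (\<lambda>y. (\<Sum>i<k. a i * e i y)\<^sup>2) - (\<Sum>i<k. (a i)\<^sup>2)\<bar> \<le>
      (\<Sum>i<k. (a i)\<^sup>2) * (sqrt (cov_err n x) / lam)"
    by (simp add: E_def)
  have "((\<Sum>p<k. b p * f p y) + (c - g - (\<Sum>p<k. b p * m p)))\<^sup>2 =
      (\<Sum>i<k. a i * e i y)\<^sup>2 + (2 * (c - g) * (\<Sum>i<k. a i * e i y) + (c - g)\<^sup>2)" for y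
  proof -
    have "(\<Sum>p<k. b p * f p y) + (c - g - (\<Sum>p<k. b p * m p)) = (\<Sum>i<k. a i * e i y) + (c - g)"
      unfolding ge by (simp add: fb_def m_def right_diff_distrib sum_subtractf)
    thus ?thesis by (simp only: power2_sum) (simp add: mult_ac)
  qed
  hence "emp n x (\<lambda>y. ((\<Sum>p<k. b p * f p y) + (c - g - (\<Sum>p<k. b p * m p)))\<^sup>2) = E + (2 * (c - g) * g + (c - g)\<^sup>2)"
    using n by (simp add: emp_add emp_cmult emp_const E_def g_def)
  also have "\<dots> = E - g\<^sup>2 + c\<^sup>2" by (simp add: power2_eq_square algebra_simps)
  finally have "emp n x (\<lambda>y. ((\<Sum>p<k. b p * f p y) + (c - g - (\<Sum>p<k. b p * m p)))\<^sup>2) = E - g\<^sup>2 + c\<^sup>2" .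
  moreover have "(\<Sum>p<k. b p * (m p - emp n x (f p))) = - g"
    unfolding gfb by (simp add: right_diff_distrib sum_subtractf)
  ultimately show "dual_obj (\<lambda>p. \<integral>y. f p y \<partial>P) k f n x b (c - g - (\<Sum>p<k. b p * (\<integral>y. f p y \<partial>P)))
      = - g - 1/4 * (emp n x (\<lambda>y. (\<Sum>i<k. a i * e i y)\<^sup>2) - g\<^sup>2 + c\<^sup>2)"
    unfolding dual_obj_def E_def by (simp add: m_def)
qed

text \<open>The empirical variance is at least (1 - \<tau>) |a|^2: the covariance error and the
  empirical centring take away the two parts of \<tau>. What remains is a concave quadratic in each
  coordinate, bounded by completing the square.\<close>

lemma dual_obj_le:
  assumes n: "n \<ge> 1" and \<tau>: "\<tau> = sqrt (cov_err n x) / lam + eta n x / real n" "\<tau> < 1"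
  shows "real n * dual_obj (\<lambda>p. \<integral>y. f p y \<partial>P) k f n x b c \<le> eta n x / (1 - \<tau>)"
proof -
  \<comment> \<open>By the expansion property these coordinates represent the given b.\<close>
  define a where "a = (\<lambda>i. bil S k b (A i))"
  define s where "s = sqrt (real n)"
  have s: "s > 0" "s\<^sup>2 = real n" using n by (auto simp: s_def)
  define g where "g = emp n x (\<lambda>y. \<Sum>i<k. a i * e i y)"
  define E where "E = emp n x (\<lambda>y. (\<Sum>i<k. a i * e i y)\<^sup>2)"
  define al where "al = (\<Sum>i<k. (a i)\<^sup>2)"
  define bb where "bb = (\<lambda>p. \<Sum>i<k. a i * A i p)"
  define c' where "c' = c + g + (\<Sum>p<k. bb p * (\<integral>y. f p y \<partial>P))"
  note D = dual_obj_coordinates(1,2)[OF n, where a = a and x = x, folded g_def E_def al_def s_def]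
  have D3: "dual_obj (\<lambda>p. \<integral>y. f p y \<partial>P) k f n x bb (c' - g - (\<Sum>p<k. bb p * (\<integral>y. f p y \<partial>P)))
      = - g - 1/4 * (E - g\<^sup>2 + c'\<^sup>2)"
    using dual_obj_coordinates(3)[OF n, where a = a and x = x and c = c'] unfolding g_def E_def bb_def .
  have al0: "al \<ge> 0" unfolding al_def by (intro sum_nonneg) auto
  have "dual_obj (\<lambda>p. \<integral>y. f p y \<partial>P) k f n x b c = dual_obj (\<lambda>p. \<integral>y. f p y \<partial>P) k f n x bb c"
    using expand by (intro dual_obj_cong) (simp add: bb_def a_def S_def[abs_def])
  also have "\<dots> = - g - 1/4 * (E - g\<^sup>2 + c'\<^sup>2)"
    unfolding D3[symmetric] by (simp add: c'_def)
  finally have J: "dual_obj (\<lambda>p. \<integral>y. f p y \<partial>P) k f n x b c = - g - 1/4 * (E - g\<^sup>2 + c'\<^sup>2)" .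
  have "(s * g)\<^sup>2 \<le> al * eta n x"
    unfolding D(1) al_def eta_def by (rule Cauchy_Schwarz_ineq_sum)
  hence g2: "g\<^sup>2 \<le> al * (eta n x / real n)"
    unfolding power_mult_distrib s(2) using n by (simp add: field_simps)
  have "E \<ge> al - al * (sqrt (cov_err n x) / lam)" using D(2) by linarith
  moreover have "al * (1 - \<tau>) = al - al * (sqrt (cov_err n x) / lam) - al * (eta n x / real n)"
    unfolding \<tau>(1) by (simp only: right_diff_distrib distrib_left mult_1_right diff_diff_eq)
  ultimately have "E - g\<^sup>2 + c'\<^sup>2 \<ge> al * (1 - \<tau>)"
    using g2 zero_le_power2[of c'] by linarith
  hence "dual_obj (\<lambda>p. \<integral>y. f p y \<partial>P) k f n x b c \<le> - g - 1/4 * (al * (1 - \<tau>))"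
    unfolding J by simp
  hence "real n * dual_obj (\<lambda>p. \<integral>y. f p y \<partial>P) k f n x b c \<le> real n * (- g - 1/4 * (al * (1 - \<tau>)))"
    by (intro mult_left_mono) auto
  also have "\<dots> = - s * (s * g) - 1/4 * (1 - \<tau>) * (s\<^sup>2 * al)"
    unfolding s(2)[symmetric] by (simp add: power2_eq_square algebra_simps)
  also have "\<dots> = (\<Sum>i<k. - (s * a i) * W n x i - (1 - \<tau>) / 4 * (s * a i)\<^sup>2)"
    unfolding D(1) al_def by (simp add: sum_subtractf sum_distrib_left sum_negf power_mult_distrib mult_ac)
  also have "\<dots> \<le> (\<Sum>i<k. (W n x i)\<^sup>2 / (1 - \<tau>))"
  proof (rule sum_mono)
    fix i
    have "0 \<le> (1 - \<tau>) * ((s * a i) / 2 + W n x i / (1 - \<tau>))\<^sup>2" using \<tau>(2) by simp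
    also have "\<dots> = (1 - \<tau>) / 4 * (s * a i)\<^sup>2 + (s * a i) * W n x i + (W n x i)\<^sup>2 / (1 - \<tau>)"
      using \<tau>(2) by (simp add: power2_eq_square divide_simps) (simp add: algebra_simps)
    finally show "- (s * a i) * W n x i - (1 - \<tau>) / 4 * (s * a i)\<^sup>2 \<le> (W n x i)\<^sup>2 / (1 - \<tau>)" by simp
  qed
  also have "\<dots> = eta n x / (1 - \<tau>)" by (simp add: eta_def sum_divide_distrib)
  finally show ?thesis .
qed

lemma dual_obj_ge:
  assumes n: "n \<ge> 1" and \<tau>: "\<tau> = sqrt (cov_err n x) / lam + eta n x / real n"
  shows "\<exists>b c. real n * dual_obj (\<lambda>p. \<integral>y. f p y \<partial>P) k f n x b c \<ge> eta n x / (1 + \<tau>)"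
proof -
  define s where "s = sqrt (real n)"
  have s: "s > 0" "s\<^sup>2 = real n" using n by (auto simp: s_def)
  have \<tau>0: "\<tau> \<ge> 0" unfolding \<tau> using lam cov_err_nonneg eta_nonneg by simp
  \<comment> \<open>In each coordinate this maximises - (s a) W - (1 + \<tau>) / 4 (s a)^2. The
    constant is taken with c = 0, and the term with g^2 works in favour of the lower bound.\<close>
  define a where "a = (\<lambda>i. - 2 * W n x i / ((1 + \<tau>) * s))"
  define g where "g = emp n x (\<lambda>y. \<Sum>i<k. a i * e i y)"
  define E where "E = emp n x (\<lambda>y. (\<Sum>i<k. a i * e i y)\<^sup>2)"
  define al where "al = (\<Sum>i<k. (a i)\<^sup>2)"
  define bb where "bb = (\<lambda>p. \<Sum>i<k. a i * A i p)"
  note D = dual_obj_coordinates(1,2)[OF n, where a = a and x = x, folded g_def E_def al_def s_def]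
  have D3: "dual_obj (\<lambda>p. \<integral>y. f p y \<partial>P) k f n x bb (0 - g - (\<Sum>p<k. bb p * (\<integral>y. f p y \<partial>P)))
      = - g - 1/4 * (E - g\<^sup>2 + 0\<^sup>2)"
    using dual_obj_coordinates(3)[OF n, where a = a and x = x and c = 0] unfolding g_def E_def bb_def .
  have al0: "al \<ge> 0" unfolding al_def by (intro sum_nonneg) auto
  have al: "al = 4 * eta n x / ((1 + \<tau>)\<^sup>2 * s\<^sup>2)"
    unfolding al_def a_def eta_def
    by (simp add: power_divide power_mult_distrib sum_divide_distrib sum_distrib_left)
  have sg: "s * g = - 2 * eta n x / ((1 + \<tau>) * s)"
    unfolding D(1) eta_def a_def
    by (simp add: sum_divide_distrib sum_distrib_left power2_eq_square sum_negf mult_ac)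
  have "E \<le> al + al * (sqrt (cov_err n x) / lam)" using D(2) by linarith
  also have "\<dots> \<le> al + al * \<tau>" unfolding \<tau> using al0 eta_nonneg by (intro add_left_mono mult_left_mono) auto
  also have "\<dots> = al * (1 + \<tau>)" by (simp add: algebra_simps)
  finally have "E \<le> al * (1 + \<tau>)" .
  moreover have "E - g\<^sup>2 + 0\<^sup>2 \<le> E" by simp
  ultimately have E: "E - g\<^sup>2 + 0\<^sup>2 \<le> al * (1 + \<tau>)" by (rule order_trans[rotated])
  have "eta n x / (1 + \<tau>) = - s * (s * g) - 1/4 * (s\<^sup>2 * (al * (1 + \<tau>)))"
    unfolding sg al using s(1) \<tau>0 by (simp add: power2_eq_square divide_simps)
  also have "\<dots> = s\<^sup>2 * (- g - 1/4 * (al * (1 + \<tau>)))"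
    by (simp add: power2_eq_square algebra_simps)
  also have "\<dots> \<le> s\<^sup>2 * (- g - 1/4 * (E - g\<^sup>2 + 0\<^sup>2))" using E by (intro mult_left_mono) auto
  finally show ?thesis unfolding D3[symmetric] s(2) by blast
qed

text \<open>Multiplied by n, the supremum lies between eta / (1 + \<tau>) and eta / (1 - \<tau>). It
  is therefore finite and may be treated as a real number. The condition \<tau> <= 1/2 gives 1 / (1
  - \<tau>) <= 1 + 2 \<tau>.\<close>

lemma SUP_dual_obj_approx:
  assumes n: "n \<ge> 1" and \<tau>: "\<tau> = sqrt (cov_err n x) / lam + eta n x / real n" "\<tau> \<le> 1 / 2"
  shows "\<exists>r. (SUP (b, c)\<in>UNIV. ereal (dual_obj (\<lambda>p. \<integral>y. f p y \<partial>P) k f n x b c)) = ereal r \<and>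
    \<bar>real n * r - eta n x\<bar> \<le> 2 * \<tau> * eta n x"
proof -
  define J where "J = dual_obj (\<lambda>p. \<integral>y. f p y \<partial>P) k f n x"
  define T where "T = (SUP (b, c)\<in>UNIV. ereal (J b c))"
  have n0: "real n > 0" using n by simp
  have \<tau>0: "\<tau> \<ge> 0" unfolding \<tau>(1) using lam cov_err_nonneg eta_nonneg by simp
  obtain b c where bc: "real n * J b c \<ge> eta n x / (1 + \<tau>)"
    using dual_obj_ge[OF n \<tau>(1)] unfolding J_def by blast
  have lo: "ereal (J b c) \<le> T" unfolding T_def by (intro SUP_upper2[of "(b, c)"]) auto
  have "J b c \<le> eta n x / (1 - \<tau>) / real n" for b c
    using dual_obj_le[OF n \<tau>(1), of b c] \<tau>(2)
    unfolding J_def pos_le_divide_eq[OF n0] by (simp only: mult.commute)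
  hence hi: "T \<le> ereal (eta n x / (1 - \<tau>) / real n)"
    unfolding T_def by (intro SUP_least) auto
  obtain r where r: "T = ereal r" using lo hi by (cases T) auto
  have "real n * r \<le> eta n x / (1 - \<tau>)" using hi unfolding r ereal_less_eq pos_le_divide_eq[OF n0] by (simp only: mult.commute)
  also have "\<dots> \<le> eta n x * (1 + 2 * \<tau>)"
  proof -
    have "\<tau> * (2 * \<tau>) \<le> \<tau> * 1" using \<tau>(2) \<tau>0 by (intro mult_left_mono) auto
    hence "1 \<le> (1 + 2 * \<tau>) * (1 - \<tau>)" by (simp add: algebra_simps)
    hence "eta n x * 1 \<le> eta n x * ((1 + 2 * \<tau>) * (1 - \<tau>))" using eta_nonneg by (intro mult_left_mono)
    thus ?thesis using \<tau>(2) by (simp add: pos_divide_le_eq mult.assoc)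
  qed
  finally have 1: "real n * r \<le> eta n x + 2 * \<tau> * eta n x" by (simp add: algebra_simps)
  have "eta n x * (1 - 2 * \<tau>) \<le> eta n x / (1 + \<tau>)"
  proof -
    have "(1 - 2 * \<tau>) * (1 + \<tau>) \<le> 1" using \<tau>0 by (simp add: algebra_simps)
    hence "eta n x * ((1 - 2 * \<tau>) * (1 + \<tau>)) \<le> eta n x * 1" using eta_nonneg by (intro mult_left_mono)
    thus ?thesis using \<tau>0 by (simp add: pos_le_divide_eq mult.assoc)
  qed
  also have "\<dots> \<le> real n * r" using bc lo r n0 by (meson ereal_less_eq(3) mult_left_mono order_trans less_imp_le)
  finally have "real n * r \<ge> eta n x - 2 * \<tau> * eta n x" by (simp add: algebra_simps)
  with 1 r show ?thesis unfolding T_def J_def by (intro exI[of _ r]) (simp add: abs_le_iff)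
qed

section \<open>Exceptional events of small probability\<close>

lemma eta_large:
  assumes X: "iid_sample M P X" and n: "n \<ge> 1" and k: "k > 0" and L: "L > 0"
  shows "{w \<in> space M. eta n (\<lambda>i. X i w) \<ge> L * real k} \<in> sets M"
    and "measure M {w \<in> space M. eta n (\<lambda>i. X i w) \<ge> L * real k} \<le> 1 / L"
proof -
  have [measurable]: "(\<lambda>w. eta n (\<lambda>i. X i w)) \<in> borel_measurable M"
    using mean_eta(1)[OF X n] by simp
  show "{w \<in> space M. eta n (\<lambda>i. X i w) \<ge> L * real k} \<in> sets M" by measurable
  have "measure M {w \<in> space M. eta n (\<lambda>i. X i w) \<ge> L * real k} \<le> (\<integral>w. eta n (\<lambda>i. X i w) \<partial>M) / (L * real k)"
    using k L eta_nonneg by (intro integral_Markov_inequality_measure[where A = "{}"] mean_eta(1)[OF X n]) auto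
  thus "measure M {w \<in> space M. eta n (\<lambda>i. X i w) \<ge> L * real k} \<le> 1 / L"
    using k L by (simp add: mean_eta(2)[OF X n])
qed

text \<open>The coupling estimate contains sqrt eta, so besides a failed coupling the event of a
  large eta is excluded, at the price 1 / L from Markov's inequality.\<close>

lemma coupling_bad_event:
  assumes X: "iid_sample N P X" and B: "brownian_bridge N P F B" and F: "f ` {..<k} \<subseteq> F"
    and n: "n \<ge> 1" and k: "k > 0" and L: "L > 0" and r: "r \<ge> 0"
    and tail: "measure N {w \<in> space N. \<exists>g\<in>f ` {..<k}. \<bar>coupling_error P n X B g w\<bar> \<ge> r} \<le> \<kappa>"
    and q: "q = sqrt (real k / lam) * r"
  shows "\<exists>E\<in>sets N. measure N E \<le> \<kappa> + 1 / L \<and> (\<forall>w\<in>space N - E.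
    \<bar>eta n (\<lambda>i. X i w) - (\<Sum>i<k. (\<Sum>p<k. A i p * B (f p) w)\<^sup>2)\<bar> \<le> 2 * sqrt (L * real k) * q + q\<^sup>2)"
proof -
  interpret N: prob_space N by (rule iid_sampleD[OF X])
  define E1 where "E1 = {w \<in> space N. \<exists>g\<in>f ` {..<k}. \<bar>coupling_error P n X B g w\<bar> \<ge> r}"
  define E2 where "E2 = {w \<in> space N. eta n (\<lambda>i. X i w) \<ge> L * real k}"
  have "E1 \<in> sets N" unfolding E1_def
  proof (rule sets.sets_Collect_countable_Ex')
    fix g assume g: "g \<in> f ` {..<k}"
    have [measurable]: "coupling_error P n X B g \<in> borel_measurable N"
      using g F f_meas by (intro coupling_error_measurable[OF X B]) auto
    show "{w \<in> space N. \<bar>coupling_error P n X B g w\<bar> \<ge> r} \<in> sets N" by measurable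
  qed auto
  moreover have E2: "E2 \<in> sets N" "measure N E2 \<le> 1 / L"
    unfolding E2_def using eta_large[OF X n k L] by auto
  ultimately have "E1 \<union> E2 \<in> sets N" "measure N (E1 \<union> E2) \<le> \<kappa> + 1 / L"
    using tail measure_Un_le[of E1 N E2] unfolding E1_def[symmetric] by auto
  moreover have "\<bar>eta n (\<lambda>i. X i w) - (\<Sum>i<k. (\<Sum>p<k. A i p * B (f p) w)\<^sup>2)\<bar> \<le> 2 * sqrt (L * real k) * q + q\<^sup>2"
    if w: "w \<in> space N - (E1 \<union> E2)" for w
  proof -
    have q0: "q \<ge> 0" unfolding q using r lam by simp
    have "\<bar>eta n (\<lambda>i. X i w) - (\<Sum>i<k. (\<Sum>p<k. A i p * B (f p) w)\<^sup>2)\<bar> \<le> 2 * sqrt (eta n (\<lambda>i. X i w)) * q + q\<^sup>2"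
      using w r by (intro eta_coupling[OF n _ q]) (auto simp: E1_def not_le intro: less_imp_le)
    also have "\<dots> \<le> 2 * sqrt (L * real k) * q + q\<^sup>2"
      using w q0 by (intro add_right_mono mult_right_mono mult_left_mono real_sqrt_le_mono) (auto simp: E2_def)
    finally show ?thesis .
  qed
  ultimately show ?thesis by blast
qed

text \<open>T bounds the random relative error as long as the covariance error and eta stay below
  their Markov levels.\<close>

lemma statistic_bad_event:
  assumes X: "iid_sample M P X" and n: "n \<ge> 1" and k: "k > 0" and L: "L > 0" and \<kappa>: "\<kappa> > 0"
    and T: "T = sqrt ((K + 1) / \<kappa>) * (real k / (sqrt (real n) * lam)) + L * real k / real n" "T \<le> 1 / 2"
  shows "\<exists>E\<in>sets M. measure M E \<le> \<kappa> + 1 / L \<and> (\<forall>w\<in>space M - E. \<exists>r.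
    (SUP (b, c)\<in>UNIV. ereal (dual_obj (\<lambda>p. \<integral>y. f p y \<partial>P) k f n (\<lambda>i. X i w) b c)) = ereal r \<and>
    \<bar>real n * r - eta n (\<lambda>i. X i w)\<bar> \<le> 2 * T * (L * real k))"
proof -
  interpret M: prob_space M by (rule iid_sampleD[OF X])
  \<comment> \<open>Markov level for the covariance error: its mean is at most k^2 K / n, so this
    level is reached with probability at most \<kappa>. Taking K + 1 keeps the level positive when K
    = 0.\<close>
  define \<rho> where "\<rho> = (real k)\<^sup>2 * ((K + 1) / \<kappa>) / real n"
  have \<rho>: "\<rho> > 0" unfolding \<rho>_def using k n K \<kappa> by simp
  define E1 where "E1 = {w \<in> space M. cov_err n (\<lambda>i. X i w) \<ge> \<rho>}"
  define E2 where "E2 = {w \<in> space M. eta n (\<lambda>i. X i w) \<ge> L * real k}"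
  have [measurable]: "(\<lambda>w. cov_err n (\<lambda>i. X i w)) \<in> borel_measurable M"
    using mean_cov_err(1)[OF X n] by simp
  have E1: "E1 \<in> sets M" unfolding E1_def by measurable
  have "measure M E1 \<le> (\<integral>w. cov_err n (\<lambda>i. X i w) \<partial>M) / \<rho>"
    unfolding E1_def using \<rho> cov_err_nonneg
    by (intro integral_Markov_inequality_measure[where A = "{}"] mean_cov_err(1)[OF X n]) auto
  also have "\<dots> \<le> ((real k)\<^sup>2 * K / real n) / \<rho>"
    using \<rho> by (intro divide_right_mono mean_cov_err(2)[OF X n]) auto
  also have "\<dots> = \<kappa> * (K / (K + 1))" unfolding \<rho>_def using k n by simp
  also have "\<dots> \<le> \<kappa>" using mult_left_mono[of "K / (K + 1)" 1 \<kappa>] \<kappa> K by simp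
  finally have "measure M E1 \<le> \<kappa>" .
  moreover have E2: "E2 \<in> sets M" "measure M E2 \<le> 1 / L"
    unfolding E2_def using eta_large[OF X n k L] by auto
  ultimately have E: "E1 \<union> E2 \<in> sets M" "measure M (E1 \<union> E2) \<le> \<kappa> + 1 / L"
    using E1 measure_Un_le[of E1 M E2] by auto
  have "\<exists>r. (SUP (b, c)\<in>UNIV. ereal (dual_obj (\<lambda>p. \<integral>y. f p y \<partial>P) k f n (\<lambda>i. X i w) b c)) = ereal r \<and>
    \<bar>real n * r - eta n (\<lambda>i. X i w)\<bar> \<le> 2 * T * (L * real k)" if w: "w \<in> space M - (E1 \<union> E2)" for w
  proof -
    define x where "x = (\<lambda>i. X i w)"
    define \<tau> where "\<tau> = sqrt (cov_err n x) / lam + eta n x / real n"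
    have et: "eta n x \<le> L * real k" using w by (auto simp: E2_def x_def)
    have "sqrt (cov_err n x) \<le> sqrt \<rho>" using w by (intro real_sqrt_le_mono) (auto simp: E1_def x_def)
    also have "\<dots> = sqrt ((K + 1) / \<kappa>) * (real k / sqrt (real n))"
      by (simp add: \<rho>_def real_sqrt_mult real_sqrt_divide)
    finally have "sqrt (cov_err n x) / lam \<le> sqrt ((K + 1) / \<kappa>) * (real k / sqrt (real n)) / lam"
      using lam by (intro divide_right_mono) auto
    moreover have "eta n x / real n \<le> L * real k / real n" using et by (intro divide_right_mono) auto
    ultimately have \<tau>T: "\<tau> \<le> T" unfolding \<tau>_def T(1) by simp
    then obtain r where r: "(SUP (b, c)\<in>UNIV. ereal (dual_obj (\<lambda>p. \<integral>y. f p y \<partial>P) k f n x b c)) = ereal r"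
      "\<bar>real n * r - eta n x\<bar> \<le> 2 * \<tau> * eta n x"
      using SUP_dual_obj_approx[OF n \<tau>_def] T(2) by auto
    have "0 \<le> \<tau>" unfolding \<tau>_def using lam cov_err_nonneg eta_nonneg by simp
    hence "2 * \<tau> * eta n x \<le> 2 * T * (L * real k)"
      using \<tau>T et eta_nonneg by (intro mult_mono) auto
    thus ?thesis using r by (auto simp: x_def[symmetric])
  qed
  with E show ?thesis by blast
qed

end

section \<open>The limit theorem\<close>

lemma standardized_diff:
  fixes k :: nat
  assumes k: "k > 0" and d: "\<bar>a - b\<bar> \<le> d" and \<epsilon>: "d \<le> \<epsilon> * sqrt (2 * real k)"
  shows "(a - real k) / sqrt (2 * real k) \<le> x \<Longrightarrow> (b - real k) / sqrt (2 * real k) \<le> x + \<epsilon>"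
    and "(b - real k) / sqrt (2 * real k) \<le> x - \<epsilon> \<Longrightarrow> (a - real k) / sqrt (2 * real k) \<le> x"
proof -
  have s: "sqrt (2 * real k) > 0" using k by simp
  show "(b - real k) / sqrt (2 * real k) \<le> x + \<epsilon>" if "(a - real k) / sqrt (2 * real k) \<le> x"
    using that d \<epsilon> unfolding pos_divide_le_eq[OF s] distrib_right by linarith
  show "(a - real k) / sqrt (2 * real k) \<le> x" if "(b - real k) / sqrt (2 * real k) \<le> x - \<epsilon>"
    using that d \<epsilon> unfolding pos_divide_le_eq[OF s] left_diff_distrib by linarith
qed

lemma powr_minus_half: "x > 0 \<Longrightarrow> x powr (-1/2) = 1 / sqrt x"
  using powr_minus_divide[of x "1/2"] powr_half_sqrt[of x] by simp

theorem theorem3p7: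
  fixes M :: "'w measure"
    and P :: "(real ^ 'd) measure"
    and X :: "nat \<Rightarrow> 'w \<Rightarrow> real ^ 'd"
    and F :: "(real ^ 'd \<Rightarrow> real) set"
    and Env :: "real ^ 'd \<Rightarrow> real"
    and \<delta> :: "nat \<Rightarrow> real"
    and Fn :: "nat \<Rightarrow> (real ^ 'd \<Rightarrow> real) set"
    and f :: "nat \<Rightarrow> nat \<Rightarrow> real ^ 'd \<Rightarrow> real"
    and k :: "nat \<Rightarrow> nat"
    and lam :: "nat \<Rightarrow> real"
    and Q0 :: "(real ^ 'd) set \<Rightarrow> real"
  assumes P: "prob_space P" "sets P = sets borel"
    and X: "iid_sample M P X"
    and F_count: "countable F" "infinite F"
    and F_meas: "\<And>g. g \<in> F \<Longrightarrow> g \<in> borel_measurable borel"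
    and envelope: "\<And>g x. g \<in> F \<Longrightarrow> \<bar>g x\<bar> \<le> Env x"
    and KMT: "KMT \<delta> P F" "\<delta> \<longlonglongrightarrow> 0"
    and Fn_fin: "\<And>n. n \<ge> 1 \<Longrightarrow> finite (Fn n)"
    and Fn_indep: "\<And>n. n \<ge> 1 \<Longrightarrow> fn.independent (Fn n)"
    and Fn_mono: "\<And>n. n \<ge> 1 \<Longrightarrow> Fn n \<subseteq> Fn (Suc n) \<and> Fn (Suc n) \<subset> F"
    and k_def: "\<And>n. k n = card (Fn n)"
    and f_enum: "\<And>n. n \<ge> 1 \<Longrightarrow> bij_betw (f n) {..<k n} (Fn n)"
    and lam_def: "\<And>n. lam n = min_eigenvalue (cov_mat P (k n) (f n))"
    and lam_pos: "eventually (\<lambda>n. lam n > 0) sequentially"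
    and lim_k: "filterlim k at_top sequentially"
    and lim1: "(\<lambda>n. lam n powr (-1/2) * real (k n) powr (1/2) * \<delta> n * ln (real n)) \<longlonglongrightarrow> 0"
    and lim2: "(\<lambda>n. lam n powr (-1) * real (k n) powr (3/2) * real n powr (-1/2)) \<longlonglongrightarrow> 0"
    and Q0: "Q0 \<in> unit_signed_measures" "\<And>g. g \<in> F \<Longrightarrow> sm_integrable Q0 g"
    and H0: "measure P \<in> moment_model F Q0"
  shows "weak_conv
    (\<lambda>n x. measure M {\<omega> \<in> space M.
        (ereal (real n) * chi2_stat Q0 (Fn n) n (\<lambda>i. X i \<omega>) - ereal (real (k n)))
          / ereal (sqrt (2 * real (k n))) \<le> ereal x})
    (cdf std_normal_distribution)"
proof -
  let ?\<Phi> = "cdf std_normal_distribution"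
  interpret M: prob_space M by (rule iid_sampleD[OF X])
  interpret P: prob_space P by (rule P)
  have F_ne: "F \<noteq> {}" using F_count by auto
  obtain b c \<theta> :: real and N :: "nat \<Rightarrow> ((nat \<Rightarrow> real ^ 'd) \<times> ((real ^ 'd \<Rightarrow> real) \<Rightarrow> real)) measure" and Z B
    where bc: "b > 0" "c > 0" "\<theta> > 0"
    and Z: "\<And>n. n \<ge> 1 \<Longrightarrow> iid_sample (N n) P (Z n)" and B: "\<And>n. n \<ge> 1 \<Longrightarrow> brownian_bridge (N n) P F (B n)"
    and tail: "\<And>n t G. n \<ge> 1 \<Longrightarrow> t > 0 \<Longrightarrow> G \<subseteq> F \<Longrightarrow>
      measure (N n) {w \<in> space (N n). \<exists>g\<in>G. \<bar>coupling_error P n (Z n) (B n) g w\<bar> \<ge> \<delta> n * (t + b * ln (real n))}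
        \<le> c * exp (- \<theta> * t)"
    by (rule KMT_coupling[OF KMT(1) F_count(1) F_meas]) blast+
  \<comment> \<open>One bound for all of F, hence for all n although the classes grow.\<close>
  obtain K0 where K0: "\<forall>g\<in>F. integrable P (\<lambda>x. (g x - (\<integral>y. g y \<partial>P)) ^ 4) \<and>
      (\<integral>x. (g x - (\<integral>y. g y \<partial>P)) ^ 4 \<partial>P) \<le> K0"
    using KMT_fourth_moment_bounded[OF KMT(1) F_count(1) F_ne F_meas] by (rule exE)
  define K where "K = max K0 0"
  have K: "K \<ge> 0" by (simp add: K_def)
  have fimg: "f n ` {..<k n} = Fn n" "inj_on (f n) {..<k n}" if "n \<ge> 1" for n
    using f_enum[OF that] by (auto simp: bij_betw_def)
  have FnF: "Fn n \<subseteq> F" if "n \<ge> 1" for n using Fn_mono[OF that] by blast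
  have fF: "f n p \<in> F" if "n \<ge> 1" "p < k n" for n p
    using fimg(1)[OF that(1)] FnF[OF that(1)] that(2) by blast

  \<comment> \<open>All but finitely many n are good. Coordinates are constructed for these and are
    arbitrary elsewhere.\<close>
  define good where "good = (\<lambda>n. n \<ge> 1 \<and> k n > 0 \<and> lam n > 0)"
  have "eventually (\<lambda>n. 1 \<le> k n) sequentially" using lim_k unfolding filterlim_at_top by (rule spec)
  hence ev_good: "eventually good sequentially"
    using lam_pos eventually_ge_at_top[of 1] unfolding good_def by eventually_elim auto
  have "\<exists>A. good n \<longrightarrow> orthonormal_class P (k n) (f n) A (lam n) K" for n
  proof (cases "good n")
    case True
    hence n: "n \<ge> 1" "k n > 0" "lam n > 0" by (auto simp: good_def)
    let ?S = "\<lambda>p q. cov P (f n p) (f n q)"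
    have sym: "?S p q = ?S q p" for p q by (simp add: cov_def mult.commute)
    have ray: "lam n * (\<Sum>p<k n. (b p)\<^sup>2) \<le> bil ?S (k n) b b" for b
      unfolding lam_def cov_mat_def by (rule min_eigenvalue_le_rayleigh[OF sym n(2)])
    obtain A where A:
      "\<And>i j. i < k n \<Longrightarrow> j < k n \<Longrightarrow> bil ?S (k n) (A i) (A j) = (if i = j then 1 else 0)"
      "\<And>b p. p < k n \<Longrightarrow> (\<Sum>i<k n. bil ?S (k n) b (A i) * A i p) = b p"
      "\<And>u. lam n * (\<Sum>i<k n. (\<Sum>p<k n. A i p * u p)\<^sup>2) \<le> (\<Sum>p<k n. (u p)\<^sup>2)"
      by (rule orthonormal_coordinates[OF sym n(3) ray]) blast
    have K4: "integrable P (\<lambda>x. (f n p x - (\<integral>y. f n p y \<partial>P)) ^ 4)"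
      "(\<integral>x. (f n p x - (\<integral>y. f n p y \<partial>P)) ^ 4 \<partial>P) \<le> K" if "p < k n" for p
      using bspec[OF K0 fF[OF n(1) that]] by (auto simp: K_def)
    have "orthonormal_class P (k n) (f n) A (lam n) K"
      by unfold_locales (fact P K K4 n A ray | rule F_meas[OF fF[OF n(1)]] brownian_bridgeD(3)[OF B[OF n(1)] fF[OF n(1)]], assumption)+
    thus ?thesis by blast
  qed simp
  hence "\<exists>A. \<forall>n. good n \<longrightarrow> orthonormal_class P (k n) (f n) (A n) (lam n) K" by (intro choice allI)
  then obtain A where A: "\<And>n. good n \<Longrightarrow> orthonormal_class P (k n) (f n) (A n) (lam n) K" by blast

  \<comment> \<open>A function of the sample sequence alone: it can be evaluated at the coupled
    sample \<open>Z n\<close> as well as at the given sample \<open>X\<close>.\<close>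
  define eta where "eta = (\<lambda>n x. orthonormal_class.eta P (k n) (f n) (A n) n x)"
  define Y where "Y = (\<lambda>n i w. \<Sum>p<k n. A n i p * B n (f n p) w)"
  have eta_m: "eta n \<in> borel_measurable (Pi\<^sub>M UNIV (\<lambda>_. borel))" if "good n" for n
    unfolding eta_def by (rule orthonormal_class.eta_measurable[OF A[OF that]])

  have clt_Y: "(\<lambda>n. measure (N n) {w \<in> space (N n). ((\<Sum>i<k n. (Y n i w)\<^sup>2) - real (k n)) / sqrt (2 * real (k n)) \<le> x})
      \<longlonglongrightarrow> ?\<Phi> x" for x
  proof (rule gaussian_vector_clt[OF _ lim_k])
    show "eventually (\<lambda>n. prob_space (N n) \<and> (\<forall>i<k n. Y n i \<in> borel_measurable (N n)) \<and>
      (\<forall>a. (CLINT w|N n. iexp (\<Sum>i<k n. a i * Y n i w)) = complex_of_real (exp (- (\<Sum>i<k n. (a i)\<^sup>2) / 2)))) sequentially"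
      using ev_good
    proof eventually_elim
      case (elim n)
      hence n: "n \<ge> 1" by (simp add: good_def)
      interpret O: orthonormal_class P "k n" "f n" "A n" "lam n" K by (rule A[OF elim])
      have "Y n i \<in> borel_measurable (N n)" for i
        unfolding Y_def using brownian_bridgeD(2)[OF B[OF n] fF[OF n]]
        by (intro borel_measurable_sum borel_measurable_times) auto
      moreover have "(CLINT w|N n. iexp (\<Sum>i<k n. a i * Y n i w)) = complex_of_real (exp (- (\<Sum>i<k n. (a i)\<^sup>2) / 2))" for a
      proof -
        \<comment> \<open>A combination of \<open>Y n\<close> with coefficients a is a combination
          of the bridge with coefficients b, and orthonormality turns its variance into
          |a|^2.\<close>
        define b where "b = (\<lambda>p. \<Sum>i<k n. a i * A n i p)"
        have "(\<Sum>i<k n. a i * Y n i w) = (\<Sum>p<k n. b p * B n (f n p) w)" for w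
        proof -
          have "(\<Sum>i<k n. a i * Y n i w) = (\<Sum>i<k n. \<Sum>p<k n. a i * A n i p * B n (f n p) w)"
            by (simp add: Y_def sum_distrib_left mult_ac)
          also have "\<dots> = (\<Sum>p<k n. b p * B n (f n p) w)"
            by (subst sum.swap) (simp add: b_def sum_distrib_right)
          finally show ?thesis .
        qed
        moreover have "bil (\<lambda>p q. cov P (f n p) (f n q)) (k n) b b = (\<Sum>i<k n. (a i)\<^sup>2)"
          unfolding b_def by (rule bil_orthonormal) (rule O.orth)
        moreover have "f n ` {..<k n} \<subseteq> F" using fimg(1)[OF n] FnF[OF n] by simp
        ultimately show ?thesis
          using brownian_bridge_char[OF B[OF n] fimg(2)[OF n], of b] by simp
      qed
      ultimately show ?case using brownian_bridgeD(1)[OF B[OF n]] by blast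
    qed
  qed

  have clt_eta_N: "(\<lambda>n. measure (N n) {w \<in> space (N n). (eta n (\<lambda>i. Z n i w) - real (k n)) / sqrt (2 * real (k n)) \<le> x})
      \<longlonglongrightarrow> ?\<Phi> x" for x
  \<comment> \<open>The comparison on the coupling spaces, where sample and bridge live
    together.\<close>
  proof (rule cdf_limit_perturbation[OF clt_Y isCont_cdf_std_normal])
    show "eventually (\<lambda>n. prob_space (N n) \<and>
        (\<lambda>w. ((\<Sum>i<k n. (Y n i w)\<^sup>2) - real (k n)) / sqrt (2 * real (k n))) \<in> borel_measurable (N n) \<and>
        {w \<in> space (N n). (eta n (\<lambda>i. Z n i w) - real (k n)) / sqrt (2 * real (k n)) \<le> x} \<in> sets (N n)) sequentially"
      using ev_good
    proof eventually_elim
      case (elim n)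
      hence n: "n \<ge> 1" by (simp add: good_def)
      have [measurable]: "Y n i \<in> borel_measurable (N n)" for i
        unfolding Y_def using brownian_bridgeD(2)[OF B[OF n] fF[OF n]]
        by (intro borel_measurable_sum borel_measurable_times) auto
      have [measurable]: "(\<lambda>w. eta n (\<lambda>i. Z n i w)) \<in> borel_measurable (N n)"
        unfolding eta_def using orthonormal_class.mean_eta(1)[OF A[OF elim] Z[OF n] n] by simp
      show ?case using brownian_bridgeD(1)[OF B[OF n]] by simp
    qed
  next
    fix \<epsilon> \<kappa> :: real assume \<epsilon>: "\<epsilon> > 0" and \<kappa>: "\<kappa> > 0"
    \<comment> \<open>Half of \<kappa> is spent on a large eta, of probability at most 1 / L, and
      half on a failed coupling.\<close>
    define L where "L = 2 / \<kappa>"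
    have L: "L > 0" using \<kappa> by (simp add: L_def)
    \<comment> \<open>With t = ln n the coupling threshold is (1 + b) \<delta> n ln n; the factor
      sqrt (k / lam) comes from \<open>eta_coupling\<close>. Absolute values spare a discussion of
      signs.\<close>
    define q where "q = (\<lambda>n. (1 + b) * \<bar>lam n powr (-1/2) * real (k n) powr (1/2) * \<delta> n * ln (real n)\<bar>)"
    have q: "q \<longlonglongrightarrow> 0" unfolding q_def using lim1 by (intro tendsto_mult_right_zero tendsto_rabs_zero)
    have "(\<lambda>n. 2 * sqrt L * q n + (q n)\<^sup>2) \<longlonglongrightarrow> 2 * sqrt L * 0 + 0\<^sup>2"
      by (intro tendsto_intros q)
    hence ev_q: "eventually (\<lambda>n. 2 * sqrt L * q n + (q n)\<^sup>2 < \<epsilon>) sequentially"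
      using \<epsilon> by (intro order_tendstoD(2)) auto
    \<comment> \<open>At t = ln n the coupling fails with probability at most c
      n^(-\<theta>).\<close>
    have "((\<lambda>n. c * exp (- \<theta> * ln (real n))) \<longlongrightarrow> 0) sequentially"
      using bc(3) by real_asymp
    hence ev_c: "eventually (\<lambda>n. c * exp (- \<theta> * ln (real n)) < \<kappa> / 2) sequentially"
      using \<kappa> by (intro order_tendstoD(2)) auto
    show "eventually (\<lambda>n. \<exists>E\<in>sets (N n). measure (N n) E \<le> \<kappa> \<and> (\<forall>w\<in>space (N n) - E.
        ((eta n (\<lambda>i. Z n i w) - real (k n)) / sqrt (2 * real (k n)) \<le> x \<longrightarrow>
          ((\<Sum>i<k n. (Y n i w)\<^sup>2) - real (k n)) / sqrt (2 * real (k n)) \<le> x + \<epsilon>) \<and>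
        (((\<Sum>i<k n. (Y n i w)\<^sup>2) - real (k n)) / sqrt (2 * real (k n)) \<le> x - \<epsilon> \<longrightarrow>
          (eta n (\<lambda>i. Z n i w) - real (k n)) / sqrt (2 * real (k n)) \<le> x))) sequentially"
      using ev_good ev_q ev_c eventually_ge_at_top[of 2]
    proof eventually_elim
      case (elim n)
      \<comment> \<open>Here n >= 2 makes ln n positive, as the tail bound asks of t.\<close>
      from elim(1,4) have n: "n \<ge> 1" and k: "k n > 0" and l: "lam n > 0" and ln: "ln (real n) > 0"
        by (auto simp: good_def)
      interpret O: orthonormal_class P "k n" "f n" "A n" "lam n" K by (rule A[OF elim(1)])
      define r where "r = \<bar>\<delta> n * (ln (real n) + b * ln (real n))\<bar>"
      have FG: "f n ` {..<k n} \<subseteq> F" using fimg(1)[OF n] FnF[OF n] by simp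
      interpret Nn: prob_space "N n" by (rule brownian_bridgeD[OF B[OF n]])
      have cm: "coupling_error P n (Z n) (B n) g \<in> borel_measurable (N n)" if "g \<in> f n ` {..<k n}" for g
        using that FG F_meas by (intro coupling_error_measurable[OF Z[OF n] B[OF n]]) auto
      have "measure (N n) {w \<in> space (N n). \<exists>g\<in>f n ` {..<k n}. \<bar>coupling_error P n (Z n) (B n) g w\<bar> \<ge> r}
          \<le> measure (N n) {w \<in> space (N n). \<exists>g\<in>f n ` {..<k n}. \<bar>coupling_error P n (Z n) (B n) g w\<bar>
              \<ge> \<delta> n * (ln (real n) + b * ln (real n))}"
      proof (rule Nn.finite_measure_mono)
        show "{w \<in> space (N n). \<exists>g\<in>f n ` {..<k n}. \<bar>coupling_error P n (Z n) (B n) g w\<bar>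
              \<ge> \<delta> n * (ln (real n) + b * ln (real n))} \<in> sets (N n)"
        proof (rule sets.sets_Collect_countable_Ex')
          fix g assume "g \<in> f n ` {..<k n}"
          note [measurable] = cm[OF this]
          show "{w \<in> space (N n). \<bar>coupling_error P n (Z n) (B n) g w\<bar>
              \<ge> \<delta> n * (ln (real n) + b * ln (real n))} \<in> sets (N n)" by measurable
        qed auto
      qed (unfold r_def, blast intro: order_trans[OF abs_ge_self])
      also have "\<dots> \<le> c * exp (- \<theta> * ln (real n))" by (rule tail[OF n ln FG])
      also have "\<dots> \<le> \<kappa> / 2" using elim(3) by simp
      finally have tl: "measure (N n) {w \<in> space (N n). \<exists>g\<in>f n ` {..<k n}. \<bar>coupling_error P n (Z n) (B n) g w\<bar> \<ge> r} \<le> \<kappa> / 2" .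
      have qn: "q n = sqrt (real (k n) / lam n) * r"
      proof -
        have "lam n powr (-1/2) * real (k n) powr (1/2) = sqrt (real (k n) / lam n)"
          unfolding powr_minus_half[OF l] real_sqrt_divide using powr_half_sqrt[of "real (k n)"] by simp
        moreover have "r = (1 + b) * \<bar>\<delta> n * ln (real n)\<bar>"
        proof -
          have *: "\<delta> n * (ln (real n) + b * ln (real n)) = (1 + b) * (\<delta> n * ln (real n))"
            by (simp add: algebra_simps)
          show ?thesis unfolding r_def * abs_mult using bc by simp
        qed
        ultimately show ?thesis using l k
          by (simp add: q_def abs_mult mult_ac)
      qed
      obtain E where E: "E \<in> sets (N n)" "measure (N n) E \<le> \<kappa> / 2 + 1 / L"
        and d: "\<And>w. w \<in> space (N n) - E \<Longrightarrow>
          \<bar>eta n (\<lambda>i. Z n i w) - (\<Sum>i<k n. (Y n i w)\<^sup>2)\<bar> \<le> 2 * sqrt (L * real (k n)) * q n + (q n)\<^sup>2"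
        using O.coupling_bad_event[OF Z[OF n] B[OF n] FG n k L _ tl qn] unfolding eta_def Y_def
        by (auto simp: r_def)
      \<comment> \<open>Since k >= 1, division by sqrt (2 k) leaves at most 2 sqrt L q +
        q^2.\<close>
      have kk: "2 * sqrt (L * real (k n)) * q n + (q n)\<^sup>2 \<le> \<epsilon> * sqrt (2 * real (k n))"
      proof -
        have s: "sqrt (real (k n)) \<le> sqrt (2 * real (k n))" "1 \<le> sqrt (2 * real (k n))" using k by auto
        have "q n \<ge> 0" using bc by (simp add: q_def)
        hence "2 * sqrt L * q n * sqrt (real (k n)) + (q n)\<^sup>2 * 1 \<le>
            2 * sqrt L * q n * sqrt (2 * real (k n)) + (q n)\<^sup>2 * sqrt (2 * real (k n))"
          using s L by (intro add_mono mult_left_mono) auto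
        also have "\<dots> = (2 * sqrt L * q n + (q n)\<^sup>2) * sqrt (2 * real (k n))" by (simp only: distrib_right)
        also have "\<dots> \<le> \<epsilon> * sqrt (2 * real (k n))" using elim(2) by (intro mult_right_mono) auto
        finally show ?thesis by (simp add: real_sqrt_mult mult_ac)
      qed
      have "measure (N n) E \<le> \<kappa>" using E(2) by (simp add: L_def)
      with E(1) show ?case
        using standardized_diff[OF k d kk] by (intro bexI[of _ E]) blast+
    qed
  qed

  have clt_eta: "(\<lambda>n. measure M {w \<in> space M. (eta n (\<lambda>i. X i w) - real (k n)) / sqrt (2 * real (k n)) \<le> x})
      \<longlonglongrightarrow> ?\<Phi> x" for x
  \<comment> \<open>\<open>X\<close> and \<open>Z n\<close> have the same law as sequences, and the
    event depends on the sequence only.\<close>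
  proof (rule Lim_transform_eventually[OF clt_eta_N])
    show "eventually (\<lambda>n. measure (N n) {w \<in> space (N n). (eta n (\<lambda>i. Z n i w) - real (k n)) / sqrt (2 * real (k n)) \<le> x} =
        measure M {w \<in> space M. (eta n (\<lambda>i. X i w) - real (k n)) / sqrt (2 * real (k n)) \<le> x}) sequentially"
      using ev_good
    proof eventually_elim
      case (elim n)
      hence n: "n \<ge> 1" by (simp add: good_def)
      note [measurable] = eta_m[OF elim]
      define S where "S = {y \<in> space (Pi\<^sub>M UNIV (\<lambda>_. borel :: (real ^ 'd) measure)).
        (eta n y - real (k n)) / sqrt (2 * real (k n)) \<le> x}"
      have S: "S \<in> sets (Pi\<^sub>M UNIV (\<lambda>_. borel))" unfolding S_def by measurable
      show ?case
        using iid_sample_law[OF X S] iid_sample_law[OF Z[OF n] S] by (simp add: S_def space_PiM)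
    qed
  qed

  \<comment> \<open>H0 enters here: on the class, integrals against Q0 agree with means under
    P.\<close>
  have m: "sm_integral Q0 (f n p) = (\<integral>y. f n p y \<partial>P)" if "n \<ge> 1" "p < k n" for n p
    using H0 fF[OF that] sm_integral_measure[OF P.finite_measure_axioms P(2), of "f n p"]
    unfolding moment_model_def by auto
  have chi: "chi2_stat Q0 (Fn n) n x = (SUP (b, c)\<in>UNIV. ereal (dual_obj (\<lambda>p. \<integral>y. f n p y \<partial>P) (k n) (f n) n x b c))"
    if "n \<ge> 1" for n x
    by (rule chi2_stat_eq_SUP[OF fimg(1)[OF that] Q0(1) Q0(2)[OF fF[OF that]] m[OF that] that])

  have "(\<lambda>n. measure M {\<omega> \<in> space M.
        (ereal (real n) * chi2_stat Q0 (Fn n) n (\<lambda>i. X i \<omega>) - ereal (real (k n)))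
          / ereal (sqrt (2 * real (k n))) \<le> ereal x}) \<longlonglongrightarrow> ?\<Phi> x" for x
  proof (rule cdf_limit_perturbation[OF clt_eta isCont_cdf_std_normal])
    show "eventually (\<lambda>n. prob_space M \<and>
        (\<lambda>w. (eta n (\<lambda>i. X i w) - real (k n)) / sqrt (2 * real (k n))) \<in> borel_measurable M \<and>
        {\<omega> \<in> space M. (ereal (real n) * chi2_stat Q0 (Fn n) n (\<lambda>i. X i \<omega>) - ereal (real (k n)))
          / ereal (sqrt (2 * real (k n))) \<le> ereal x} \<in> sets M) sequentially"
      using ev_good
    proof eventually_elim
      case (elim n)
      hence n: "n \<ge> 1" by (simp add: good_def)
      have [measurable]: "(\<lambda>w. eta n (\<lambda>i. X i w)) \<in> borel_measurable M"
        unfolding eta_def using orthonormal_class.mean_eta(1)[OF A[OF elim] X n] by simp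
      have [measurable]: "(\<lambda>w. chi2_stat Q0 (Fn n) n (\<lambda>i. X i w)) \<in> borel_measurable M"
        unfolding chi[OF n] by (intro measurable_SUP_dual_obj iid_sampleD(3)[OF X] F_meas fF n)
      show ?case using M.prob_space_axioms by simp
    qed
  next
    fix \<epsilon> \<kappa> :: real assume \<epsilon>: "\<epsilon> > 0" and \<kappa>: "\<kappa> > 0"
    \<comment> \<open>The same split of \<kappa>, now between a large eta and a large covariance
      error.\<close>
    define L where "L = 2 / \<kappa>"
    have L: "L > 0" using \<kappa> by (simp add: L_def)
    define q where "q = (\<lambda>n. lam n powr (-1) * real (k n) powr (3/2) * real n powr (-1/2))"
    \<comment> \<open>One summand for each part of T: the covariance error is governed by q
      directly, the centring part L k / n through lam <= 1 + K.\<close>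
    define C where "C = sqrt ((K + 1) / (\<kappa> / 2)) + L * (1 + K)"
    define T where "T = (\<lambda>n. sqrt ((K + 1) / (\<kappa> / 2)) * (real (k n) / (sqrt (real n) * lam n)) + L * real (k n) / real n)"
    have C: "C > 0" unfolding C_def using L K \<kappa> by (intro add_nonneg_pos) auto
    have q: "q \<longlonglongrightarrow> 0" unfolding q_def by (rule lim2)
    have "(\<lambda>n. C * q n) \<longlonglongrightarrow> 0" using q by (rule tendsto_mult_right_zero)
    hence ev1: "eventually (\<lambda>n. C * q n < 1 / 2) sequentially" by (intro order_tendstoD(2)) auto
    have "(\<lambda>n. 2 * L * (C * q n)) \<longlonglongrightarrow> 0" by (intro tendsto_mult_right_zero q)
    hence ev2: "eventually (\<lambda>n. 2 * L * (C * q n) < \<epsilon>) sequentially" using \<epsilon> by (intro order_tendstoD(2)) auto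
    show "eventually (\<lambda>n. \<exists>E\<in>sets M. measure M E \<le> \<kappa> \<and> (\<forall>w\<in>space M - E.
        ((ereal (real n) * chi2_stat Q0 (Fn n) n (\<lambda>i. X i w) - ereal (real (k n)))
          / ereal (sqrt (2 * real (k n))) \<le> ereal x \<longrightarrow>
          (eta n (\<lambda>i. X i w) - real (k n)) / sqrt (2 * real (k n)) \<le> x + \<epsilon>) \<and>
        ((eta n (\<lambda>i. X i w) - real (k n)) / sqrt (2 * real (k n)) \<le> x - \<epsilon> \<longrightarrow>
          (ereal (real n) * chi2_stat Q0 (Fn n) n (\<lambda>i. X i w) - ereal (real (k n)))
          / ereal (sqrt (2 * real (k n))) \<le> ereal x))) sequentially"
      using ev_good ev1 ev2
    proof eventually_elim
      case (elim n)
      from elim(1) have n: "n \<ge> 1" and k: "k n > 0" and l: "lam n > 0" by (auto simp: good_def)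
      interpret O: orthonormal_class P "k n" "f n" "A n" "lam n" K by (rule A[OF elim(1)])
      have k1: "1 \<le> sqrt (real (k n))" using k by simp
      have T0: "T n \<ge> 0" unfolding T_def using K \<kappa> L l by (intro add_nonneg_nonneg mult_nonneg_nonneg divide_nonneg_nonneg) auto
      have qn: "q n = real (k n) * sqrt (real (k n)) / (sqrt (real n) * lam n)"
      proof -
        have "real (k n) powr (3/2) = real (k n) powr (1 + 1/2)" by simp
        also have "\<dots> = real (k n) * sqrt (real (k n))" using k by (simp only: powr_add powr_half_sqrt) simp
        finally have "real (k n) powr (3/2) = real (k n) * sqrt (real (k n))" .
        moreover have "lam n powr (-1) = 1 / lam n" using powr_minus_divide[of "lam n" 1] l by simp
        moreover have "real n powr (-1/2) = 1 / sqrt (real n)" using n by (intro powr_minus_half) simp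
        ultimately show ?thesis by (simp add: q_def)
      qed
      have "T n * sqrt (real (k n)) = sqrt ((K + 1) / (\<kappa> / 2)) * q n + L * (lam n * (q n * (1 / sqrt (real n))))"
      proof -
        have "L * real (k n) / real n * sqrt (real (k n)) = L * (lam n * (q n * (1 / sqrt (real n))))"
          unfolding qn using l by (simp add: mult_ac)
        thus ?thesis unfolding T_def distrib_right by (simp add: qn)
      qed
      also have "\<dots> \<le> sqrt ((K + 1) / (\<kappa> / 2)) * q n + L * ((1 + K) * (q n * 1))"
      proof (intro add_left_mono mult_left_mono mult_mono)
        show "lam n \<le> 1 + K" by (rule O.lam_le[OF k])
        show "1 / sqrt (real n) \<le> 1" using n by simp
      qed (use L K l n in \<open>auto simp: qn\<close>)
      also have "\<dots> = C * q n" by (simp add: C_def algebra_simps)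
      finally have Tq: "T n * sqrt (real (k n)) \<le> C * q n" .
      have "T n * 1 \<le> T n * sqrt (real (k n))" using T0 k1 by (intro mult_left_mono)
      hence T12: "T n \<le> 1 / 2" using Tq elim(2) by linarith
      obtain E where E: "E \<in> sets M" "measure M E \<le> \<kappa> / 2 + 1 / L"
        and d: "\<forall>w\<in>space M - E. \<exists>r. chi2_stat Q0 (Fn n) n (\<lambda>i. X i w) = ereal r \<and>
            \<bar>real n * r - eta n (\<lambda>i. X i w)\<bar> \<le> 2 * T n * (L * real (k n))"
        using O.statistic_bad_event[OF X n k L, of "\<kappa> / 2" "T n"] T12 \<kappa>
        unfolding eta_def chi[OF n] by (auto simp: T_def)
      \<comment> \<open>The relative error T acts on an eta of size L k, while the scale is sqrt (2
        k). So T sqrt k decides, and it is at most C q.\<close>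
      have kk: "2 * T n * (L * real (k n)) \<le> \<epsilon> * sqrt (2 * real (k n))"
      proof -
        have "2 * T n * (L * real (k n)) = 2 * L * (T n * sqrt (real (k n))) * sqrt (real (k n))" by simp
        also have "\<dots> \<le> 2 * L * (C * q n) * sqrt (real (k n))"
          using Tq L by (intro mult_right_mono mult_left_mono) auto
        also have "\<dots> \<le> \<epsilon> * sqrt (2 * real (k n))"
          using elim(3) \<epsilon> by (intro mult_mono) auto
        finally show ?thesis .
      qed
      have "measure M E \<le> \<kappa>" using E(2) by (simp add: L_def)
      moreover have "((ereal (real n) * chi2_stat Q0 (Fn n) n (\<lambda>i. X i w) - ereal (real (k n)))
          / ereal (sqrt (2 * real (k n))) \<le> ereal x \<longrightarrow>
          (eta n (\<lambda>i. X i w) - real (k n)) / sqrt (2 * real (k n)) \<le> x + \<epsilon>) \<and>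
        ((eta n (\<lambda>i. X i w) - real (k n)) / sqrt (2 * real (k n)) \<le> x - \<epsilon> \<longrightarrow>
          (ereal (real n) * chi2_stat Q0 (Fn n) n (\<lambda>i. X i w) - ereal (real (k n)))
          / ereal (sqrt (2 * real (k n))) \<le> ereal x)" if w: "w \<in> space M - E" for w
      proof -
        \<comment> \<open>Off E the statistic is finite, so the extended-real arithmetic reduces to
          that of the reals.\<close>
        obtain r where r: "chi2_stat Q0 (Fn n) n (\<lambda>i. X i w) = ereal r"
          "\<bar>real n * r - eta n (\<lambda>i. X i w)\<bar> \<le> 2 * T n * (L * real (k n))" using d w by blast
        have "(ereal (real n) * chi2_stat Q0 (Fn n) n (\<lambda>i. X i w) - ereal (real (k n))) / ereal (sqrt (2 * real (k n)))
            = ereal ((real n * r - real (k n)) / sqrt (2 * real (k n)))" using k by (simp add: r(1))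
        thus ?thesis using standardized_diff[OF k r(2) kk, of x] by simp
      qed
      ultimately show ?case using E(1) by (intro bexI[of _ E]) blast+
    qed
  qed
  thus ?thesis unfolding weak_conv_def by blast
qed

end
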